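(* Let $K\subseteq\mathbb{R}^{dT}$ be compact, $\mu\in\mathcal{P}(K)$, and $p>2$. Then for all $\sigma\in(0,1]$ there exist constants $C_K,C_1,C_2,c_1>0$ such that, setting $M_p=M_p(\mu)$, $$C_{\sigma,p,M_p}=\left(\int_{\mathbb{R}^{dT}}\frac{(\|x\|+\frac12)^2}{1+\|x\|^p}dx\right)^{\frac12}\sqrt{\big(C_1(2^pM_p+1)+C_22^p\sigma^p\big)\frac{1}{(2\pi\sigma)^{dT}}},\qquad c_{\sigma,K}=c_1\Big(\sup_{x\in K}\frac{1+2\|x\|}{2\sigma}+1\Big),$$ one has for all $x>0$ and $N\in\mathbb{N}$ $$\mathbb{E}\big[\mathcal{AW}_1^{(\sigma)}(\mu,\mu^N)\big]\le C_KC_{\sigma,p,M_p}N^{-\frac12},$$ $$\mathbb{P}\Big(\mathcal{AW}_1^{(\sigma)}(\mu,\mu^N)\ge x+C_KC_{\sigma,p,M_p}N^{-\frac12}\Big)\le e^{-\frac{Nx^2}{C_K^2c_{\sigma,K}^2}}.$$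
   Context: $d\ge1$ and $T\ge1$ are integers. Points of $\mathbb{R}^{dT}$ are paths $x=x_{1:T}=(x_1,\dots,x_T)$ with $x_t\in\mathbb{R}^d$; $x_{1:t}=(x_1,\dots,x_t)\in\mathbb{R}^{dt}$, and $\mathbb{R}^{dt}$ carries the norm $\|x_{1:t}\|=\sum_{s=1}^t\|x_s\|_{\mathbb{R}^d}$ (Euclidean norm on $\mathbb{R}^d$). $\mathcal{P}(K)$ is the set of Borel probability measures supported on $K$; $M_p(\mu)=\int\|x\|^p\mu(dx)$. $\mu_{x_{1:t}}\in\mathcal{P}(\mathbb{R}^d)$ is the disintegration kernel of $\mu$ (conditional law of $x_{t+1}$ given $x_{1:t}$); analogously $\pi_{x_{1:t},y_{1:t}}$ is the conditional law of $(x_{t+1},y_{t+1})$ given $(x_{1:t},y_{1:t})$ under $\pi\in\mathcal{P}(\mathbb{R}^{dT}\times\mathbb{R}^{dT})$. $\mathrm{Cpl}(\mu,\nu)$ is the set of couplings of $\mu,\nu$. $\mathrm{Cpl}_{\mathrm{bc}}(\mu,\nu)$, the set of bi-causal couplings, consists of those $\pi\in\mathrm{Cpl}(\mu,\nu)$ with $\pi_{x_{1:t},y_{1:t}}\in\mathrm{Cpl}(\mu_{x_{1:t}},\nu_{y_{1:t}})$ for $\pi$-a.e. $(x,y)$ and all $t=1,\dots,T-1$. The adapted Wasserstein distance is $\mathcal{AW}_1(\mu,\nu)=\inf_{\pi\in\mathrm{Cpl}_{\mathrm{bc}}(\mu,\nu)}\int\|x-y\|\,\pi(dx,dy)$. With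 $\mathcal{N}_\sigma=\mathcal{N}(\mathbf{0},\sigma^2\mathbf{I}_{dT})$ and $\ast$ convolution of measures, $\mathcal{AW}_1^{(\sigma)}(\mu,\nu)=\mathcal{AW}_1(\mu\ast\mathcal{N}_\sigma,\nu\ast\mathcal{N}_\sigma)$. $(X^{(n)})_{n\in\mathbb{N}}$ are i.i.d. samples from $\mu$ on a probability space $(\Omega,\mathcal{F},\mathbb{P})$ and $\mu^N=\frac1N\sum_{n=1}^N\delta_{X^{(n)}}$. The integral over $\mathbb{R}^{dT}$ in $C_{\sigma,p,M_p}$ is that of a nonnegative function and takes values in $(0,\infty]$; if it is $+\infty$ then $C_{\sigma,p,M_p}=+\infty$. *)

theory Defs
  imports "HOL-Probability.Probability"
begin

text \<open>
  The space of paths of length \<open>t\<close> in \<open>real ^ 'd\<close> is the product over the index set \<open>{1..t}\<close>;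
  its elements are the functions that equal \<^const>\<open>undefined\<close> outside \<open>{1..t}\<close>. All operations on
  paths therefore act on the components \<open>1, \<dots>, t\<close> only.
\<close>

type_synonym 'd path = "nat \<Rightarrow> real ^ 'd"

definition path_topology :: "nat \<Rightarrow> ('d::finite) path topology" where
  "path_topology t = product_topology (\<lambda>_. euclidean) {1..t}"

definition path_space :: "nat \<Rightarrow> ('d::finite) path measure" where
  "path_space t = PiM {1..t} (\<lambda>_. borel)"

definition path_lebesgue :: "nat \<Rightarrow> ('d::finite) path measure" where
  "path_lebesgue t = PiM {1..t} (\<lambda>_. lborel)"

definition path_norm :: "nat \<Rightarrow> ('d::finite) path \<Rightarrow> real" where
  "path_norm t x = (\<Sum>s = 1..t. norm (x s))"

definition trunc :: "nat \<Rightarrow> ('d::finite) path \<Rightarrow> 'd path" where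
  "trunc t x = restrict x {1..t}"

definition prob_on :: "nat \<Rightarrow> ('d::finite) path set \<Rightarrow> 'd path measure set" where
  "prob_on T K = {\<mu>. prob_space \<mu> \<and> sets \<mu> = sets (path_space T) \<and> emeasure \<mu> K = 1}"

definition moment :: "nat \<Rightarrow> real \<Rightarrow> ('d::finite) path measure \<Rightarrow> real" where
  "moment T p \<mu> = (\<integral>x. path_norm T x powr p \<partial>\<mu>)"

definition couplings :: "'a measure \<Rightarrow> 'b measure \<Rightarrow> ('a \<times> 'b) measure set" where
  "couplings \<mu> \<nu> =
    {\<pi>. prob_space \<pi> \<and> sets \<pi> = sets (\<mu> \<Otimes>\<^sub>M \<nu>) \<and> distr \<pi> \<mu> fst = \<mu> \<and> distr \<pi> \<nu> snd = \<nu>}"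

text \<open>
  \<open>is_cond_law M S Y N Z \<kappa>\<close>: the probability kernel \<open>\<kappa>\<close> from \<open>S\<close> to \<open>N\<close> is a (regular) conditional
  law of \<open>Z\<close> given \<open>Y\<close> under \<open>M\<close>, that is, \<open>M(Y \<in> A, Z \<in> B) = \<integral>\<^bsub>{Y \<in> A}\<^esub> \<kappa>(Y)(B) dM\<close>.
\<close>

definition is_cond_law ::
  "'m measure \<Rightarrow> 'a measure \<Rightarrow> ('m \<Rightarrow> 'a) \<Rightarrow> 'b measure \<Rightarrow> ('m \<Rightarrow> 'b) \<Rightarrow> ('a \<Rightarrow> 'b measure) \<Rightarrow> bool" where
  "is_cond_law M S Y N Z \<kappa> \<longleftrightarrow>
    \<kappa> \<in> S \<rightarrow>\<^sub>M prob_algebra N \<and>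
    (\<forall>A \<in> sets S. \<forall>B \<in> sets N.
      emeasure M {\<omega> \<in> space M. Y \<omega> \<in> A \<and> Z \<omega> \<in> B} =
      (\<integral>\<^sup>+ \<omega>. emeasure (\<kappa> (Y \<omega>)) B * indicator A (Y \<omega>) \<partial>M))"

definition disintegration :: "nat \<Rightarrow> ('d::finite) path measure \<Rightarrow> ('d path \<Rightarrow> (real ^ 'd) measure) \<Rightarrow> bool" where
  "disintegration t \<mu> \<kappa> \<longleftrightarrow>
    is_cond_law \<mu> (path_space t) (trunc t) borel (\<lambda>x. x (Suc t)) \<kappa>"

definition disintegration2 ::
  "nat \<Rightarrow> (('d::finite) path \<times> 'd path) measure \<Rightarrow>
    ('d path \<times> 'd path \<Rightarrow> ((real ^ 'd) \<times> (real ^ 'd)) measure) \<Rightarrow> bool" where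
  "disintegration2 t \<pi> \<kappa> \<longleftrightarrow>
    is_cond_law \<pi>
      (path_space t \<Otimes>\<^sub>M path_space t) (\<lambda>(x, y). (trunc t x, trunc t y))
      (borel \<Otimes>\<^sub>M borel) (\<lambda>(x, y). (x (Suc t), y (Suc t))) \<kappa>"

text \<open>
  Disintegration kernels exist and are unique up to null sets, so it does not matter which versions
  are used in the following definition.
\<close>

definition bicausal_couplings ::
  "nat \<Rightarrow> ('d::finite) path measure \<Rightarrow> 'd path measure \<Rightarrow> ('d path \<times> 'd path) measure set" where
  "bicausal_couplings T \<mu> \<nu> =
    {\<pi> \<in> couplings \<mu> \<nu>. \<forall>t \<in> {1..<T}. \<exists>\<kappa>\<^sub>\<pi> \<kappa>\<^sub>\<mu> \<kappa>\<^sub>\<nu>.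
      disintegration2 t \<pi> \<kappa>\<^sub>\<pi> \<and> disintegration t \<mu> \<kappa>\<^sub>\<mu> \<and> disintegration t \<nu> \<kappa>\<^sub>\<nu> \<and>
      (AE (x, y) in \<pi>. \<kappa>\<^sub>\<pi> (trunc t x, trunc t y) \<in> couplings (\<kappa>\<^sub>\<mu> (trunc t x)) (\<kappa>\<^sub>\<nu> (trunc t y)))}"

definition adapted_wasserstein :: "nat \<Rightarrow> ('d::finite) path measure \<Rightarrow> 'd path measure \<Rightarrow> ennreal" where
  "adapted_wasserstein T \<mu> \<nu> =
    (INF \<pi> \<in> bicausal_couplings T \<mu> \<nu>. \<integral>\<^sup>+ (x, y). ennreal (path_norm T (\<lambda>t. x t - y t)) \<partial>\<pi>)"

definition path_gaussian :: "nat \<Rightarrow> real \<Rightarrow> ('d::finite) path measure" where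
  "path_gaussian T \<sigma> =
    density (path_lebesgue T)
      (\<lambda>z. ennreal (\<Prod>t \<in> {1..T}. \<Prod>i \<in> UNIV. normal_density 0 \<sigma> (z t $ i)))"

text \<open>The library's \<^const>\<open>convolution\<close> needs a Euclidean space as type, so it does not apply to paths.\<close>

definition path_convolution ::
  "nat \<Rightarrow> ('d::finite) path measure \<Rightarrow> 'd path measure \<Rightarrow> 'd path measure" where
  "path_convolution T \<mu> \<nu> = distr (\<mu> \<Otimes>\<^sub>M \<nu>) (path_space T) (\<lambda>(x, y). \<lambda>t \<in> {1..T}. x t + y t)"

definition smoothed_AW :: "nat \<Rightarrow> real \<Rightarrow> ('d::finite) path measure \<Rightarrow> 'd path measure \<Rightarrow> ennreal" where
  "smoothed_AW T \<sigma> \<mu> \<nu> =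
    adapted_wasserstein T (path_convolution T \<mu> (path_gaussian T \<sigma>))
                          (path_convolution T \<nu> (path_gaussian T \<sigma>))"

text \<open>\<open>1/N\<close> times the sum of the Dirac measures at \<open>x 1, \<dots>, x N\<close>; see \<open>emeasure_empirical_measure\<close>.\<close>

definition empirical_measure :: "nat \<Rightarrow> nat \<Rightarrow> (nat \<Rightarrow> ('d::finite) path) \<Rightarrow> 'd path measure" where
  "empirical_measure T N x = distr (uniform_count_measure {1..N}) (path_space T) x"

lemma emeasure_empirical_measure:
  assumes "N \<ge> 1" "\<And>n. n \<in> {1..N} \<Longrightarrow> x n \<in> space (path_space T)" "A \<in> sets (path_space T)"
  shows "emeasure (empirical_measure T N x) A = ennreal ((\<Sum>n = 1..N. indicator A (x n)) / real N)"
proof -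
  have m: "x \<in> uniform_count_measure {1..N} \<rightarrow>\<^sub>M path_space T"
    using assms(2) by (auto simp: measurable_def sets_uniform_count_measure space_uniform_count_measure)
  have s: "x -` A \<inter> {1..N} = {n \<in> {1..N}. x n \<in> A}" by auto
  have "emeasure (empirical_measure T N x) A = emeasure (uniform_count_measure {1..N}) {n \<in> {1..N}. x n \<in> A}"
    unfolding empirical_measure_def
    by (subst emeasure_distr[OF m assms(3)]) (simp only: space_uniform_count_measure s)
  also have "\<dots> = ennreal (real (card {n \<in> {1..N}. x n \<in> A}) / real N)"
    by (subst emeasure_uniform_count_measure) auto
  also have "real (card {n \<in> {1..N}. x n \<in> A}) = (\<Sum>n = 1..N. indicator A (x n))"
    by (simp add: indicator_def of_bool_def sum.If_cases Int_def)
  finally show ?thesis .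
qed

text \<open>
  The adapted Wasserstein distance of random measures is an infimum over an uncountable family.
  In order not to build its measurability into the claims (and not to let \<^const>\<open>measure\<close> assign
  \<open>0\<close> to a non-measurable event), expectations and probabilities are read as outer expectations
  and outer probabilities (\<^const>\<open>outer_measure_of\<close>). They agree with the ordinary
  ones in the measurable case and dominate them otherwise.
\<close>

definition outer_expectation :: "'w measure \<Rightarrow> ('w \<Rightarrow> ennreal) \<Rightarrow> ennreal" where
  "outer_expectation P f =
    (INF g \<in> {g \<in> borel_measurable P. \<forall>\<omega> \<in> space P. f \<omega> \<le> g \<omega>}. \<integral>\<^sup>+ \<omega>. g \<omega> \<partial>P)"

lemma outer_expectation_eq_nn_integral:
  assumes "f \<in> borel_measurable P"
  shows "outer_expectation P f = (\<integral>\<^sup>+ \<omega>. f \<omega> \<partial>P)"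
  unfolding outer_expectation_def using assms
  by (intro INF_eqI) (auto intro!: nn_integral_mono)

lemma nn_integral_le_outer_expectation: "(\<integral>\<^sup>+ \<omega>. f \<omega> \<partial>P) \<le> outer_expectation P f"
  unfolding outer_expectation_def by (auto intro!: INF_greatest nn_integral_mono)

definition ennreal_sqrt :: "ennreal \<Rightarrow> ennreal" where
  "ennreal_sqrt a = (if a = \<infinity> then \<infinity> else ennreal (sqrt (enn2real a)))"

text \<open>The dimension of the path space is \<open>CARD('d) * T\<close>.\<close>

definition C_const :: "nat \<Rightarrow> real \<Rightarrow> real \<Rightarrow> ('d::finite) path measure \<Rightarrow> real \<Rightarrow> real \<Rightarrow> ennreal" where
  "C_const T \<sigma> p \<mu> C\<^sub>1 C\<^sub>2 =
    ennreal_sqrt (\<integral>\<^sup>+ (x :: 'd path).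
      ennreal ((path_norm T x + 1 / 2)\<^sup>2 / (1 + path_norm T x powr p)) \<partial>path_lebesgue T) *
    ennreal (sqrt ((C\<^sub>1 * (2 powr p * moment T p \<mu> + 1) + C\<^sub>2 * 2 powr p * \<sigma> powr p) *
      (1 / (2 * pi * \<sigma>) ^ (CARD('d) * T))))"

definition c_const :: "nat \<Rightarrow> real \<Rightarrow> ('d::finite) path set \<Rightarrow> real \<Rightarrow> real" where
  "c_const T \<sigma> K c\<^sub>1 = c\<^sub>1 * ((SUP x \<in> K. (1 + 2 * path_norm T x) / (2 * \<sigma>)) + 1)"

end

theory Submission
  imports Defs
begin

text \<open>
After smoothing with Gaussian noise, the law of a path has positive densities \<open>p\<^sub>t\<close> for its initial
segments of every length \<open>t\<close>, and so has a smoothed competitor, with densities \<open>q\<^sub>t\<close>. The adapted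
distance of two such laws is controlled by the densities alone. Build the coupling step by step:
while the two paths have agreed so far, draw the next pair from a maximal coupling of the two
conditional laws; once they differ, draw the next points independently. This coupling is bicausal,
and it costs something only from the time on at which the two paths separate. With the weight
\<open>W\<^sub>t(x) = (1 + |x\<^sub>1|) \<cdots> (1 + |x\<^sub>t|)\<close>, which dominates the norm of a path and is multiplicative in
time, the expected weight of the separated paths satisfies a linear recursion in \<open>t\<close>, whose solution is
\[ AW \le (3 M)^T \sum_{t \le T} \int |p_t - q_t| W_t \, dx, \]
where \<open>M\<close> bounds the conditional means of \<open>1 + |x\<^sub>t|\<close> (\<open>adapted_wasserstein_le_l1_gap\<close>).

If the measures live on a ball of radius \<open>R\<close>, their smoothed densities are mixtures of Gaussian
densities with centres of norm at most \<open>R\<close> at each time. All of these lie below one envelope, a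
multiple of the Gaussian density of variance \<open>2 \<sigma>\<^sup>2\<close>, so \<open>M\<close> can be taken as the integral of the envelope
times \<open>1 + |x|\<close>, uniformly over all such measures.

For \<open>q\<^sub>t\<close> coming from the empirical measure, \<open>q\<^sub>t(x)\<close> is an average of \<open>N\<close> independent bounded
variables with mean \<open>p\<^sub>t(x)\<close>. Its mean absolute deviation is at most the envelope times \<open>N\<^sup>-\<^sup>1\<^sup>/\<^sup>2\<close>, and
integration over \<open>x\<close> gives the rate for the mean. Replacing one sample moves the right-hand side by at
most a constant over \<open>N\<close>, so the bounded differences (McDiarmid) inequality gives the Gaussian tail
(\<open>empirical_smoothed_AW\<close>).

This yields both estimates with one constant \<open>B\<close> depending on \<open>T\<close>, the dimension, \<open>\<sigma>\<close> and \<open>R\<close>. The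
constants of the theorem are chosen after \<open>\<sigma>\<close>, and the given expressions in them are positive, so
it suffices to take \<open>C\<^sub>K\<close> large. If the integral in \<open>C_const\<close> diverges, the bound on the mean is
trivial, and the event in the second estimate is contained in a null set.
\<close>

section \<open>Probability kernels and conditional laws\<close>

lemma measurable_density_kernel:
  assumes "sigma_finite_measure L"
    and [measurable]: "case_prod f \<in> borel_measurable (S \<Otimes>\<^sub>M L)"
    and one: "\<And>s. s \<in> space S \<Longrightarrow> (\<integral>\<^sup>+u. f s u \<partial>L) = 1"
  shows "(\<lambda>s. density L (f s)) \<in> S \<rightarrow>\<^sub>M prob_algebra L"
proof -
  interpret L: sigma_finite_measure L by fact
  have fs[measurable]: "f s \<in> borel_measurable L" if "s \<in> space S" for s
    using that by measurable
  have prob: "prob_space (density L (f s))" if "s \<in> space S" for s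
    by (rule prob_spaceI) (use that one in \<open>simp add: emeasure_density cong: nn_integral_cong_simp\<close>)
  have "(\<lambda>s. density L (f s)) \<in> S \<rightarrow>\<^sub>M subprob_algebra L"
  proof (rule measurable_subprob_algebra)
    fix a assume "a \<in> space S"
    then show "subprob_space (density L (f a))"
      by (intro prob_space_imp_subprob_space prob)
  next
    fix A assume A[measurable]: "A \<in> sets L"
    have "(\<lambda>a. \<integral>\<^sup>+u. f a u * indicator A u \<partial>L) \<in> borel_measurable S"
      by measurable
    then show "(\<lambda>a. emeasure (density L (f a)) A) \<in> borel_measurable S"
      by (subst measurable_cong[where g="\<lambda>a. \<integral>\<^sup>+u. f a u * indicator A u \<partial>L"])
         (auto simp: emeasure_density)
  qed simp
  then show ?thesis
    using prob by (auto simp: prob_algebra_def intro!: measurable_restrict_space2)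
qed

lemma measurable_distr_prob_algebra:
  assumes "g \<in> M \<rightarrow>\<^sub>M N" "\<kappa> \<in> S \<rightarrow>\<^sub>M prob_algebra M"
  shows "(\<lambda>s. distr (\<kappa> s) N g) \<in> S \<rightarrow>\<^sub>M prob_algebra N"
  using measurable_compose[OF assms(2) measurable_distr_prob_space[OF assms(1)]] by simp

lemma distr_eqI:
  assumes f: "f \<in> M \<rightarrow>\<^sub>M N"
    and eq: "\<And>A. A \<in> sets N \<Longrightarrow> (\<integral>\<^sup>+w. indicator A (f w) \<partial>M) = emeasure N A"
  shows "distr M N f = N"
proof (rule measure_eqI)
  fix A assume "A \<in> sets (distr M N f)"
  then have A: "A \<in> sets N" by simp
  then have "emeasure (distr M N f) A = (\<integral>\<^sup>+x. indicator A x \<partial>distr M N f)" by simp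
  also have "\<dots> = (\<integral>\<^sup>+w. indicator A (f w) \<partial>M)"
    using A by (intro nn_integral_distr[OF f]) simp
  finally show "emeasure (distr M N f) A = emeasure N A" using eq[OF A] by simp
qed simp

text \<open>
A process is built step by step: \<open>m t\<close> is its law up to time \<open>t\<close>, a state \<open>x\<close> at time \<open>t\<close> is extended
to \<open>e t x a\<close> with \<open>a\<close> drawn from \<open>\<kappa> t x\<close>, and \<open>r t\<close>, \<open>c t\<close> recover from a later state the state at
time \<open>t\<close> and the increment added to it. Then the building kernels are the conditional laws under
the final law. The lemma is applied to single paths and to pairs of paths.
\<close>

lemma is_cond_law_chain:
  fixes m S :: "nat \<Rightarrow> 's measure" and e :: "nat \<Rightarrow> 's \<Rightarrow> 'a \<Rightarrow> 's"
    and r :: "nat \<Rightarrow> 's \<Rightarrow> 's" and c :: "nat \<Rightarrow> 's \<Rightarrow> 'a"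
  assumes sets_m: "\<And>t. t \<le> T \<Longrightarrow> sets (m t) = sets (S t)"
    and \<kappa>: "\<And>t. t < T \<Longrightarrow> \<kappa> t \<in> S t \<rightarrow>\<^sub>M prob_algebra N"
    and e: "\<And>t. t < T \<Longrightarrow> (\<lambda>(x, a). e t x a) \<in> S t \<Otimes>\<^sub>M N \<rightarrow>\<^sub>M S (Suc t)"
    and step: "\<And>t h. t < T \<Longrightarrow> h \<in> borel_measurable (S (Suc t)) \<Longrightarrow>
      (\<integral>\<^sup>+x. h x \<partial>m (Suc t)) = (\<integral>\<^sup>+x. \<integral>\<^sup>+a. h (e t x a) \<partial>\<kappa> t x \<partial>m t)"
    and r: "\<And>t s. t \<le> s \<Longrightarrow> s \<le> T \<Longrightarrow> r t \<in> S s \<rightarrow>\<^sub>M S t"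
    and c: "\<And>t s. t < s \<Longrightarrow> s \<le> T \<Longrightarrow> c t \<in> S s \<rightarrow>\<^sub>M N"
    and r_id: "\<And>t x. t \<le> T \<Longrightarrow> x \<in> space (S t) \<Longrightarrow> r t x = x"
    and r_e: "\<And>t s x a. t \<le> s \<Longrightarrow> s < T \<Longrightarrow> r t (e s x a) = r t x"
    and c_e: "\<And>t x a. t < T \<Longrightarrow> c t (e t x a) = a"
    and r_r: "\<And>t x. r t (r (Suc t) x) = r t x"
    and c_r: "\<And>t x. c t (r (Suc t) x) = c t x"
    and t: "t < T"
  shows "is_cond_law (m T) (S t) (r t) N (c t) (\<kappa> t)"
proof -
  have marg: "(\<integral>\<^sup>+x. h (r t x) \<partial>m s) = (\<integral>\<^sup>+x. h x \<partial>m t)"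
    if "t \<le> s" "s \<le> T" and h: "h \<in> borel_measurable (S t)" for t s h
    using that(1,2)
  proof (induction rule: dec_induct)
    case base
    then show ?case
      by (intro nn_integral_cong) (simp add: r_id sets_eq_imp_space_eq[OF sets_m])
  next
    case (step n)
    have "(\<integral>\<^sup>+x. h (r t x) \<partial>m (Suc n)) = (\<integral>\<^sup>+x. \<integral>\<^sup>+a. h (r t (e n x a)) \<partial>\<kappa> n x \<partial>m n)"
      using step.prems step.hyps
      by (intro assms(4) measurable_compose[OF r h]) auto
    also have "\<dots> = (\<integral>\<^sup>+x. h (r t x) \<partial>m n)"
    proof (intro nn_integral_cong)
      fix x assume "x \<in> space (m n)"
      then have "x \<in> space (S n)" using step.prems sets_eq_imp_space_eq[OF sets_m, of n] by simp
      then have "prob_space (\<kappa> n x)"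
        using measurable_space[OF \<kappa>, of n x] step.prems by (simp add: space_prob_algebra)
      then show "(\<integral>\<^sup>+a. h (r t (e n x a)) \<partial>\<kappa> n x) = h (r t x)"
        using step.prems step.hyps by (simp add: r_e prob_space.emeasure_space_1)
    qed
    finally show ?case using step by simp
  qed
  show ?thesis
    unfolding is_cond_law_def
  proof (intro conjI ballI)
    show "\<kappa> t \<in> S t \<rightarrow>\<^sub>M prob_algebra N" using \<kappa> t .
    fix A B assume A[measurable]: "A \<in> sets (S t)" and B[measurable]: "B \<in> sets N"
    have [measurable]: "\<kappa> t \<in> S t \<rightarrow>\<^sub>M subprob_algebra N"
      using \<kappa>[OF t] by (rule measurable_prob_algebraD)
    have sp: "space (m T) = space (S T)" using sets_eq_imp_space_eq[OF sets_m] by simp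
    have [measurable]: "r t \<in> m T \<rightarrow>\<^sub>M S t" "c t \<in> m T \<rightarrow>\<^sub>M N"
      "r t \<in> S (Suc t) \<rightarrow>\<^sub>M S t" "c t \<in> S (Suc t) \<rightarrow>\<^sub>M N"
      using r[of t T] c[of t T] r[of t "Suc t"] c[of t "Suc t"] t
      by (auto simp: measurable_cong_sets[OF sets_m refl])
    let ?H = "\<lambda>x. indicator A (r t x) * indicator B (c t x) :: ennreal"
    have "emeasure (m T) {\<omega> \<in> space (m T). r t \<omega> \<in> A \<and> c t \<omega> \<in> B} = (\<integral>\<^sup>+x. ?H x \<partial>m T)"
    proof -
      have "{\<omega> \<in> space (m T). r t \<omega> \<in> A \<and> c t \<omega> \<in> B} \<in> sets (m T)" by measurable
      then have "emeasure (m T) {\<omega> \<in> space (m T). r t \<omega> \<in> A \<and> c t \<omega> \<in> B} =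
          (\<integral>\<^sup>+x. indicator {\<omega> \<in> space (m T). r t \<omega> \<in> A \<and> c t \<omega> \<in> B} x \<partial>m T)"
        by (rule nn_integral_indicator[symmetric])
      also have "\<dots> = (\<integral>\<^sup>+x. ?H x \<partial>m T)"
        by (intro nn_integral_cong) (simp split: split_indicator)
      finally show ?thesis .
    qed
    also have "\<dots> = (\<integral>\<^sup>+x. ?H (r (Suc t) x) \<partial>m T)"
      by (simp add: r_r c_r)
    also have "\<dots> = (\<integral>\<^sup>+x. ?H x \<partial>m (Suc t))"
      using t by (intro marg) auto
    also have "\<dots> = (\<integral>\<^sup>+x. \<integral>\<^sup>+a. ?H (e t x a) \<partial>\<kappa> t x \<partial>m t)"
      using t by (intro step) auto
    also have "\<dots> = (\<integral>\<^sup>+x. emeasure (\<kappa> t x) B * indicator A x \<partial>m t)"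
    proof (intro nn_integral_cong)
      fix x assume "x \<in> space (m t)"
      then have x: "x \<in> space (S t)" using t sets_eq_imp_space_eq[OF sets_m, of t] by simp
      then have k: "sets (\<kappa> t x) = sets N"
        using measurable_space[OF \<kappa>, of t x] t by (simp add: space_prob_algebra)
      then have "B \<in> sets (\<kappa> t x)" by simp
      then have "(\<integral>\<^sup>+a. indicator B a \<partial>\<kappa> t x) = emeasure (\<kappa> t x) B" by simp
      moreover have "(\<lambda>a. indicator B a) \<in> borel_measurable (\<kappa> t x)"
        by (intro borel_measurable_indicator) (simp add: k)
      then have "(\<integral>\<^sup>+a. indicator A x * indicator B a \<partial>\<kappa> t x) = indicator A x * (\<integral>\<^sup>+a. indicator B a \<partial>\<kappa> t x)"
        by (rule nn_integral_cmult)
      ultimately show "(\<integral>\<^sup>+a. ?H (e t x a) \<partial>\<kappa> t x) = emeasure (\<kappa> t x) B * indicator A x"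
        using t x by (simp add: r_e c_e r_id mult.commute)
    qed
    also have "\<dots> = (\<integral>\<^sup>+x. emeasure (\<kappa> t (r t x)) B * indicator A (r t x) \<partial>m T)"
      using t by (intro marg[symmetric]) auto
    finally show "emeasure (m T) {\<omega> \<in> space (m T). r t \<omega> \<in> A \<and> c t \<omega> \<in> B} =
       (\<integral>\<^sup>+ \<omega>. emeasure (\<kappa> t (r t \<omega>)) B * indicator A (r t \<omega>) \<partial>m T)" .
  qed
qed

section \<open>Couplings with a prescribed common part\<close>

text \<open>
The next three definitions couple the laws with densities \<open>f\<close> and \<open>g\<close> so that the part with density
\<open>m \<le> min f g\<close> is put on the diagonal. A triple \<open>(z, b, w)\<close> is drawn: \<open>z\<close> has density \<open>f\<close>, the flag \<open>b\<close>
is true with conditional probability \<open>m z / f z\<close>, and \<open>w\<close> is drawn independently from the normalised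
rest \<open>g - m\<close>. The coupled pair is \<open>(z, z)\<close> if the flag is set and \<open>(z, w)\<close> otherwise. Thus
\<open>m = min f g\<close> gives the maximal coupling and \<open>m = 0\<close> the independent one. If \<open>g - m\<close> vanishes almost
everywhere, \<open>w\<close> is irrelevant, and \<open>g\<close> itself serves as its density.
\<close>

definition residual_density :: "'a measure \<Rightarrow> ('a \<Rightarrow> real) \<Rightarrow> ('a \<Rightarrow> real) \<Rightarrow> 'a \<Rightarrow> ennreal" where
  "residual_density L g m w =
    (if (\<integral>\<^sup>+u. ennreal (g u - m u) \<partial>L) = 0 then ennreal (g w)
     else ennreal (g w - m w) / (\<integral>\<^sup>+u. ennreal (g u - m u) \<partial>L))"

definition common_density ::
  "'a measure \<Rightarrow> ('a \<Rightarrow> real) \<Rightarrow> ('a \<Rightarrow> real) \<Rightarrow> ('a \<Rightarrow> real) \<Rightarrow> 'a \<times> bool \<times> 'a \<Rightarrow> ennreal" where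
  "common_density L f g m = (\<lambda>(z, b, w). ennreal (if b then m z else f z - m z) * residual_density L g m w)"

definition common_coupling ::
  "'a measure \<Rightarrow> ('a \<Rightarrow> real) \<Rightarrow> ('a \<Rightarrow> real) \<Rightarrow> ('a \<Rightarrow> real) \<Rightarrow> ('a \<times> 'a) measure" where
  "common_coupling L f g m =
    distr (density (L \<Otimes>\<^sub>M (count_space UNIV \<Otimes>\<^sub>M L)) (common_density L f g m)) (L \<Otimes>\<^sub>M L)
      (\<lambda>(z, b, w). (z, if b then z else w))"

locale common_part =
  fixes L :: "'a measure" and f g m :: "'a \<Rightarrow> real"
  assumes sigma_finite_L: "sigma_finite_measure L"
    and f_meas[measurable]: "f \<in> borel_measurable L"
    and g_meas[measurable]: "g \<in> borel_measurable L"
    and m_meas[measurable]: "m \<in> borel_measurable L"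
    and m_nonneg: "\<And>z. 0 \<le> m z"
    and m_le_f: "\<And>z. m z \<le> f z"
    and m_le_g: "\<And>z. m z \<le> g z"
    and f_one: "(\<integral>\<^sup>+z. ennreal (f z) \<partial>L) = 1"
    and g_one: "(\<integral>\<^sup>+z. ennreal (g z) \<partial>L) = 1"
begin

sublocale L: sigma_finite_measure L by (rule sigma_finite_L)

lemma residual_measurable[measurable]: "residual_density L g m \<in> borel_measurable L"
  unfolding residual_density_def by measurable

lemma common_density_measurable[measurable]:
  "common_density L f g m \<in> borel_measurable (L \<Otimes>\<^sub>M (count_space UNIV \<Otimes>\<^sub>M L))"
  unfolding common_density_def by measurable

text \<open>
The unmatched masses of both marginals agree; this is what makes the second marginal of the
coupling the law with density \<open>g\<close>.
\<close>

lemma excess_f: "(\<integral>\<^sup>+z. ennreal (f z - m z) \<partial>L) = (\<integral>\<^sup>+z. ennreal (g z - m z) \<partial>L)"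
proof -
  have 1: "(\<integral>\<^sup>+z. ennreal (m z) \<partial>L) + (\<integral>\<^sup>+z. ennreal (f z - m z) \<partial>L) = 1"
    unfolding f_one[symmetric]
    by (subst nn_integral_add[symmetric]) (auto simp: m_nonneg m_le_f simp flip: ennreal_plus)
  have 2: "(\<integral>\<^sup>+z. ennreal (m z) \<partial>L) + (\<integral>\<^sup>+z. ennreal (g z - m z) \<partial>L) = 1"
    unfolding g_one[symmetric]
    by (subst nn_integral_add[symmetric]) (auto simp: m_nonneg m_le_g simp flip: ennreal_plus)
  have "(\<integral>\<^sup>+z. ennreal (m z) \<partial>L) \<noteq> \<top>"
    using 1 by auto
  then show ?thesis
    using 1 2 by (metis ennreal_add_diff_cancel_left)
qed

lemma excess_finite: "(\<integral>\<^sup>+z. ennreal (g z - m z) \<partial>L) \<noteq> \<top>"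
proof -
  have "(\<integral>\<^sup>+z. ennreal (g z - m z) \<partial>L) \<le> (\<integral>\<^sup>+z. ennreal (g z) \<partial>L)"
    by (intro nn_integral_mono ennreal_leI) (simp add: m_nonneg)
  then show ?thesis using g_one by (auto simp: top_unique)
qed

lemma nn_integral_residual:
  assumes [measurable]: "h \<in> borel_measurable L"
  shows "(\<integral>\<^sup>+z. ennreal (f z - m z) \<partial>L) * (\<integral>\<^sup>+w. residual_density L g m w * h w \<partial>L)
    = (\<integral>\<^sup>+w. ennreal (g w - m w) * h w \<partial>L)"
proof (cases "(\<integral>\<^sup>+u. ennreal (g u - m u) \<partial>L) = 0")
  case True
  then have "AE u in L. ennreal (g u - m u) = 0"
    by (subst (asm) nn_integral_0_iff_AE) auto
  then have "(\<integral>\<^sup>+w. ennreal (g w - m w) * h w \<partial>L) = (\<integral>\<^sup>+w. 0 \<partial>L)"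
    by (intro nn_integral_cong_AE) (auto elim!: eventually_mono)
  then show ?thesis using True by (simp add: excess_f)
next
  case False
  let ?E = "\<integral>\<^sup>+u. ennreal (g u - m u) \<partial>L"
  have "?E * (\<integral>\<^sup>+w. residual_density L g m w * h w \<partial>L)
      = (\<integral>\<^sup>+w. ?E * (residual_density L g m w * h w) \<partial>L)"
    by (subst nn_integral_cmult) auto
  also have "\<dots> = (\<integral>\<^sup>+w. ennreal (g w - m w) * h w \<partial>L)"
    using False excess_finite
    by (intro nn_integral_cong)
       (simp add: residual_density_def mult.assoc[symmetric] ennreal_times_divide mult.commute[of ?E]
          ennreal_mult_divide_eq)
  finally show ?thesis by (simp add: excess_f)
qed

lemma residual_one: "(\<integral>\<^sup>+w. residual_density L g m w \<partial>L) = 1"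
proof (cases "(\<integral>\<^sup>+u. ennreal (g u - m u) \<partial>L) = 0")
  case True
  then show ?thesis by (simp add: residual_density_def g_one)
next
  case False
  then show ?thesis using excess_finite
    by (simp add: residual_density_def nn_integral_divide ennreal_divide_self less_top[symmetric])
qed

lemma nn_integral_common_density:
  assumes [measurable]: "h \<in> borel_measurable (L \<Otimes>\<^sub>M L)"
  shows "(\<integral>\<^sup>+x. common_density L f g m x * h (case x of (z, b, w) \<Rightarrow> (z, if b then z else w))
      \<partial>(L \<Otimes>\<^sub>M (count_space UNIV \<Otimes>\<^sub>M L))) =
    (\<integral>\<^sup>+z. ennreal (m z) * h (z, z) \<partial>L) +
    (\<integral>\<^sup>+z. ennreal (f z - m z) * (\<integral>\<^sup>+w. residual_density L g m w * h (z, w) \<partial>L) \<partial>L)"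
proof -
  let ?B = "count_space (UNIV :: bool set)"
  interpret B: sigma_finite_measure ?B
    by (rule sigma_finite_measure_count_space_finite) simp
  interpret BL: pair_sigma_finite ?B L ..
  let ?F = "\<lambda>x. common_density L f g m x * h (case x of (z, b, w) \<Rightarrow> (z, if b then z else w))"
  have [measurable]: "?F \<in> borel_measurable (L \<Otimes>\<^sub>M (?B \<Otimes>\<^sub>M L))"
    by measurable
  have "(\<integral>\<^sup>+x. ?F x \<partial>(L \<Otimes>\<^sub>M (?B \<Otimes>\<^sub>M L))) = (\<integral>\<^sup>+z. \<integral>\<^sup>+b. \<integral>\<^sup>+w. ?F (z, b, w) \<partial>L \<partial>?B \<partial>L)"
    by (subst BL.nn_integral_fst[symmetric], simp, intro nn_integral_cong,
        subst L.nn_integral_fst[symmetric]) auto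
  also have "\<dots> = (\<integral>\<^sup>+z. ennreal (m z) * h (z, z) +
      ennreal (f z - m z) * (\<integral>\<^sup>+w. residual_density L g m w * h (z, w) \<partial>L) \<partial>L)"
    by (intro nn_integral_cong)
       (simp add: nn_integral_count_space_finite UNIV_bool common_density_def nn_integral_cmult
          mult.assoc nn_integral_multc residual_one add.commute)
  also have "\<dots> = (\<integral>\<^sup>+z. ennreal (m z) * h (z, z) \<partial>L) +
    (\<integral>\<^sup>+z. ennreal (f z - m z) * (\<integral>\<^sup>+w. residual_density L g m w * h (z, w) \<partial>L) \<partial>L)"
    by (subst nn_integral_add) auto
  finally show ?thesis .
qed

lemma nn_integral_common_coupling:
  assumes [measurable]: "h \<in> borel_measurable (L \<Otimes>\<^sub>M L)"
  shows "(\<integral>\<^sup>+x. h x \<partial>common_coupling L f g m) =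
    (\<integral>\<^sup>+z. ennreal (m z) * h (z, z) \<partial>L) +
    (\<integral>\<^sup>+z. ennreal (f z - m z) * (\<integral>\<^sup>+w. residual_density L g m w * h (z, w) \<partial>L) \<partial>L)"
  unfolding common_coupling_def
  by (subst nn_integral_distr) (auto simp: nn_integral_density nn_integral_common_density)

lemma nn_integral_common_coupling_fst:
  assumes [measurable]: "h \<in> borel_measurable L"
  shows "(\<integral>\<^sup>+x. h (fst x) \<partial>common_coupling L f g m) = (\<integral>\<^sup>+z. ennreal (f z) * h z \<partial>L)"
proof -
  have "(\<integral>\<^sup>+x. h (fst x) \<partial>common_coupling L f g m) =
     (\<integral>\<^sup>+z. ennreal (m z) * h z \<partial>L) + (\<integral>\<^sup>+z. ennreal (f z - m z) * h z \<partial>L)"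
    by (subst nn_integral_common_coupling) (auto simp: nn_integral_multc residual_one)
  also have "\<dots> = (\<integral>\<^sup>+z. ennreal (f z) * h z \<partial>L)"
    by (subst nn_integral_add[symmetric])
       (auto simp: m_nonneg m_le_f simp flip: ennreal_plus distrib_right)
  finally show ?thesis .
qed

lemma nn_integral_common_coupling_snd:
  assumes [measurable]: "h \<in> borel_measurable L"
  shows "(\<integral>\<^sup>+x. h (snd x) \<partial>common_coupling L f g m) = (\<integral>\<^sup>+z. ennreal (g z) * h z \<partial>L)"
proof -
  have "(\<integral>\<^sup>+x. h (snd x) \<partial>common_coupling L f g m) =
     (\<integral>\<^sup>+z. ennreal (m z) * h z \<partial>L) + (\<integral>\<^sup>+z. ennreal (g z - m z) * h z \<partial>L)"
    by (subst nn_integral_common_coupling) (auto simp: nn_integral_multc nn_integral_residual)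
  also have "\<dots> = (\<integral>\<^sup>+z. ennreal (g z) * h z \<partial>L)"
    by (subst nn_integral_add[symmetric])
       (auto simp: m_nonneg m_le_g simp flip: ennreal_plus distrib_right)
  finally show ?thesis .
qed

text \<open>
Off the diagonal the first component has the density \<open>f - m\<close> at most, and the second one \<open>g - m\<close>. For
\<open>m = min f g\<close> the two bounds add up to the integral of \<open>|f - g| u\<close>.
\<close>

lemma common_coupling_off_diagonal:
  fixes u :: "'a \<Rightarrow> ennreal"
  assumes [measurable]: "u \<in> borel_measurable L" "{x \<in> space (L \<Otimes>\<^sub>M L). fst x = snd x} \<in> sets (L \<Otimes>\<^sub>M L)"
  shows "(\<integral>\<^sup>+x. of_bool (fst x \<noteq> snd x) * (u (fst x) + u (snd x)) \<partial>common_coupling L f g m)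
    \<le> (\<integral>\<^sup>+z. ennreal (f z - m z) * u z \<partial>L) + (\<integral>\<^sup>+z. ennreal (g z - m z) * u z \<partial>L)"
proof -
  let ?d = "\<lambda>x :: 'a \<times> 'a. indicator {x \<in> space (L \<Otimes>\<^sub>M L). fst x \<noteq> snd x} x * (u (fst x) + u (snd x))"
  have [measurable]: "{x \<in> space (L \<Otimes>\<^sub>M L). fst x \<noteq> snd x} \<in> sets (L \<Otimes>\<^sub>M L)"
    using sets.sets_Collect_neg[OF assms(2)] by simp
  have sp: "space (common_coupling L f g m) = space (L \<Otimes>\<^sub>M L)"
    by (simp add: common_coupling_def)
  have "(\<integral>\<^sup>+x. of_bool (fst x \<noteq> snd x) * (u (fst x) + u (snd x)) \<partial>common_coupling L f g m)
      = (\<integral>\<^sup>+x. ?d x \<partial>common_coupling L f g m)"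
    by (intro nn_integral_cong) (auto simp: sp)
  also have "\<dots> = (\<integral>\<^sup>+z. ennreal (m z) * ?d (z, z) \<partial>L) +
      (\<integral>\<^sup>+z. ennreal (f z - m z) * (\<integral>\<^sup>+w. residual_density L g m w * ?d (z, w) \<partial>L) \<partial>L)"
    by (rule nn_integral_common_coupling) measurable
  also have "\<dots> \<le> 0 + (\<integral>\<^sup>+z. ennreal (f z - m z) *
      (\<integral>\<^sup>+w. residual_density L g m w * (u z + u w) \<partial>L) \<partial>L)"
    by (intro add_mono nn_integral_mono mult_left_mono) (auto split: split_indicator)
  also have "\<dots> = (\<integral>\<^sup>+z. ennreal (f z - m z) * u z \<partial>L) +
      (\<integral>\<^sup>+z. ennreal (f z - m z) * (\<integral>\<^sup>+w. residual_density L g m w * u w \<partial>L) \<partial>L)"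
    by (simp add: distrib_left nn_integral_add nn_integral_multc residual_one)
  also have "(\<integral>\<^sup>+z. ennreal (f z - m z) * (\<integral>\<^sup>+w. residual_density L g m w * u w \<partial>L) \<partial>L)
      = (\<integral>\<^sup>+z. ennreal (g z - m z) * u z \<partial>L)"
    by (subst nn_integral_multc) (auto simp: nn_integral_residual)
  finally show ?thesis .
qed

lemma prob_space_common_coupling: "prob_space (common_coupling L f g m)"
proof (rule prob_spaceI)
  have "emeasure (common_coupling L f g m) (space (common_coupling L f g m)) =
      (\<integral>\<^sup>+x. (\<lambda>_. 1) (fst x) \<partial>common_coupling L f g m)"
    by simp
  also have "\<dots> = 1"
    by (subst nn_integral_common_coupling_fst) (auto simp: f_one)
  finally show "emeasure (common_coupling L f g m) (space (common_coupling L f g m)) = 1" .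
qed

lemma sets_common_coupling[simp, measurable_cong]: "sets (common_coupling L f g m) = sets (L \<Otimes>\<^sub>M L)"
  by (simp add: common_coupling_def)

lemma common_coupling_in_couplings:
  "common_coupling L f g m \<in> couplings (density L f) (density L g)"
  unfolding couplings_def
proof (intro CollectI conjI)
  show "sets (common_coupling L f g m) = sets (density L f \<Otimes>\<^sub>M density L g)"
    by (auto intro!: sets_pair_measure_cong)
  show "distr (common_coupling L f g m) (density L f) fst = density L f"
    by (rule distr_eqI) (auto simp: nn_integral_common_coupling_fst emeasure_density)
  show "distr (common_coupling L f g m) (density L g) snd = density L g"
    by (rule distr_eqI) (auto simp: nn_integral_common_coupling_snd emeasure_density)
qed (rule prob_space_common_coupling)

end

lemma measurable_common_coupling:
  fixes f g m :: "'s \<Rightarrow> 'a \<Rightarrow> real"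
  assumes cp: "\<And>s. s \<in> space S \<Longrightarrow> common_part L (f s) (g s) (m s)"
    and L: "sigma_finite_measure L"
    and [measurable]: "case_prod f \<in> borel_measurable (S \<Otimes>\<^sub>M L)"
      "case_prod g \<in> borel_measurable (S \<Otimes>\<^sub>M L)" "case_prod m \<in> borel_measurable (S \<Otimes>\<^sub>M L)"
  shows "(\<lambda>s. common_coupling L (f s) (g s) (m s)) \<in> S \<rightarrow>\<^sub>M prob_algebra (L \<Otimes>\<^sub>M L)"
proof -
  interpret L: sigma_finite_measure L by fact
  let ?B = "count_space (UNIV :: bool set)"
  interpret B: sigma_finite_measure ?B
    by (rule sigma_finite_measure_count_space_finite) simp
  interpret BL: pair_sigma_finite ?B L ..
  interpret LBL: pair_sigma_finite L "?B \<Otimes>\<^sub>M L" ..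
  have "(\<lambda>s. density (L \<Otimes>\<^sub>M (?B \<Otimes>\<^sub>M L)) (common_density L (f s) (g s) (m s)))
      \<in> S \<rightarrow>\<^sub>M prob_algebra (L \<Otimes>\<^sub>M (?B \<Otimes>\<^sub>M L))"
  proof (rule measurable_density_kernel)
    show "sigma_finite_measure (L \<Otimes>\<^sub>M (?B \<Otimes>\<^sub>M L))" ..
    show "(\<lambda>(s, x). common_density L (f s) (g s) (m s) x) \<in> borel_measurable (S \<Otimes>\<^sub>M (L \<Otimes>\<^sub>M ?B \<Otimes>\<^sub>M L))"
      unfolding common_density_def residual_density_def by measurable
    fix s assume "s \<in> space S"
    then interpret common_part L "f s" "g s" "m s" by (rule cp)
    have "(\<integral>\<^sup>+x. common_density L (f s) (g s) (m s) x \<partial>(L \<Otimes>\<^sub>M ?B \<Otimes>\<^sub>M L))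
      = (\<integral>\<^sup>+x. 1 \<partial>common_coupling L (f s) (g s) (m s))"
      by (subst nn_integral_common_coupling)
         (use nn_integral_common_density[of "\<lambda>_. 1"] in simp_all)
    then show "(\<integral>\<^sup>+x. common_density L (f s) (g s) (m s) x \<partial>(L \<Otimes>\<^sub>M ?B \<Otimes>\<^sub>M L)) = 1"
      using prob_space_common_coupling by (simp add: prob_space.emeasure_space_1)
  qed
  then show ?thesis
    unfolding common_coupling_def by (rule measurable_distr_prob_algebra[rotated]) measurable
qed

section \<open>Path spaces and their product measures\<close>

lemma sets_path_lebesgue[simp, measurable_cong]: "sets (path_lebesgue t) = sets (path_space t)"
  unfolding path_lebesgue_def path_space_def by (intro sets_PiM_cong) auto

lemma space_path_lebesgue[simp]: "space (path_lebesgue t) = space (path_space t)"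
  by (rule sets_eq_imp_space_eq) simp

lemma space_path_space: "space (path_space t) = extensional {1..t}"
  by (auto simp: path_space_def space_PiM PiE_def)

lemma sigma_finite_path_lebesgue: "sigma_finite_measure (path_lebesgue t :: ('d::finite) path measure)"
proof -
  interpret product_sigma_finite "\<lambda>_::nat. lborel :: (real ^ 'd) measure" by standard
  interpret finite_product_sigma_finite "\<lambda>_::nat. lborel :: (real ^ 'd) measure" "{1..t}"
    by standard simp
  show ?thesis unfolding path_lebesgue_def by (rule sigma_finite_measure_axioms)
qed

lemma fun_upd_path_measurable[measurable]:
  "(\<lambda>(x, a). x(Suc t := a)) \<in> path_space t \<Otimes>\<^sub>M borel \<rightarrow>\<^sub>M (path_space (Suc t) :: ('d::finite) path measure)"
  unfolding path_space_def using measurable_add_dim[of "Suc t" "{1..t}" "\<lambda>_. borel"]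
  by (simp add: atLeastAtMostSuc_conv)

lemma fun_upd_path_space: "x \<in> space (path_space t) \<Longrightarrow> x(Suc t := a) \<in> space (path_space (Suc t))"
  by (auto simp: space_path_space extensional_def)

lemma component_path_measurable:
  "s \<in> {1..t} \<Longrightarrow> (\<lambda>x. x s) \<in> path_space t \<rightarrow>\<^sub>M (borel :: (real ^ 'd::finite) measure)"
  unfolding path_space_def by (rule measurable_component_singleton)

lemma trunc_measurable: "t \<le> s \<Longrightarrow> trunc t \<in> path_space s \<rightarrow>\<^sub>M path_space t"
  unfolding trunc_def path_space_def by (rule measurable_restrict_subset) auto

lemma trunc_id: "x \<in> space (path_space t) \<Longrightarrow> trunc t x = x"
  by (auto simp: trunc_def space_path_space extensional_restrict)

lemma trunc_fun_upd: "t \<le> s \<Longrightarrow> trunc t (x(Suc s := a)) = trunc t x"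
  by (auto simp: trunc_def restrict_def)

lemma trunc_trunc: "trunc t (trunc (Suc t) x) = trunc t x"
  by (auto simp: trunc_def restrict_def)

lemma trunc_last: "trunc (Suc t) x (Suc t) = x (Suc t)"
  by (auto simp: trunc_def)

lemma pred_path_eq[measurable]:
  "Measurable.pred (path_space t \<Otimes>\<^sub>M path_space t) (\<lambda>w. fst w = (snd w :: ('d::finite) path))"
proof -
  have "{w \<in> space (path_space t \<Otimes>\<^sub>M path_space t). fst w = (snd w :: 'd path)} =
     {w \<in> space (path_space t \<Otimes>\<^sub>M path_space t). \<forall>s\<in>{1..t}. fst w s = snd w s}"
    by (auto simp: space_pair_measure space_path_space intro: extensionalityI)
  also have "\<dots> \<in> sets (path_space t \<Otimes>\<^sub>M path_space t)"
  proof (rule sets.sets_Collect_finite_All)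
    fix s assume "s \<in> {1..t}"
    then have [measurable]: "(\<lambda>x. x s) \<in> path_space t \<rightarrow>\<^sub>M (borel :: (real ^ 'd) measure)"
      by (rule component_path_measurable)
    show "{w \<in> space (path_space t \<Otimes>\<^sub>M path_space t). fst w s = (snd w s :: real ^ 'd)}
        \<in> sets (path_space t \<Otimes>\<^sub>M path_space t)"
      by measurable
  qed simp
  finally show ?thesis by (simp add: pred_def)
qed

lemma nn_integral_path_lebesgue_Suc:
  fixes h :: "('d::finite) path \<Rightarrow> ennreal"
  assumes "h \<in> borel_measurable (path_space (Suc t))"
  shows "(\<integral>\<^sup>+x. h x \<partial>path_lebesgue (Suc t)) = (\<integral>\<^sup>+x. \<integral>\<^sup>+a. h (x(Suc t := a)) \<partial>lborel \<partial>path_lebesgue t)"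
proof -
  interpret product_sigma_finite "\<lambda>_::nat. lborel :: (real ^ 'd) measure" by standard
  have "h \<in> borel_measurable (PiM (insert (Suc t) {1..t}) (\<lambda>_. lborel))"
  proof -
    have "sets (PiM (insert (Suc t) {1..t}) (\<lambda>_. lborel :: (real ^ 'd) measure)) = sets (path_space (Suc t))"
      unfolding path_space_def by (simp add: atLeastAtMostSuc_conv cong: sets_PiM_cong)
    then show ?thesis using assms by (simp cong: measurable_cong_sets)
  qed
  then show ?thesis
    unfolding path_lebesgue_def using product_nn_integral_insert[of "{1..t}" "Suc t" h]
    by (simp add: atLeastAtMostSuc_conv)
qed

lemma nn_integral_path_lebesgue_0: "(\<integral>\<^sup>+x. h x \<partial>path_lebesgue 0) = h (\<lambda>_. undefined)"
  by (simp add: path_lebesgue_def PiM_empty nn_integral_count_space_finite)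

text \<open>
A weight that dominates the norm of a path. Unlike the norm it is multiplicative in the
time steps, so that its conditional expectation is again a multiple of the weight.
\<close>

definition path_weight :: "nat \<Rightarrow> ('d::finite) path \<Rightarrow> real" where
  "path_weight t x = (\<Prod>s = 1..t. 1 + norm (x s))"

lemma path_weight_ge_1: "1 \<le> path_weight t x"
  unfolding path_weight_def by (intro prod_ge_1) auto

lemma path_weight_nonneg[simp]: "0 \<le> path_weight t x"
  using path_weight_ge_1[of t x] by linarith

lemma path_weight_Suc: "path_weight (Suc t) (x(Suc t := a)) = path_weight t x * (1 + norm a)"
  unfolding path_weight_def by (simp add: atLeastAtMostSuc_conv mult.commute)

lemma path_weight_measurable[measurable]: "path_weight t \<in> borel_measurable (path_space t)"
  unfolding path_weight_def[abs_def]
  by (intro borel_measurable_prod borel_measurable_add borel_measurable_const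
      measurable_compose[OF component_path_measurable borel_measurable_norm])

lemma path_norm_le_weight: "path_norm t x \<le> path_weight t x"
proof -
  have "path_norm t x + 1 \<le> path_weight t x"
    unfolding path_norm_def path_weight_def
  proof (induction t)
    case (Suc t)
    have "(\<Sum>s = 1..t. norm (x s)) + norm (x (Suc t)) + 1
        \<le> ((\<Sum>s = 1..t. norm (x s)) + 1) * (1 + norm (x (Suc t)))"
      by (simp add: algebra_simps sum_nonneg)
    also have "\<dots> \<le> (\<Prod>s = 1..t. 1 + norm (x s)) * (1 + norm (x (Suc t)))"
      by (intro mult_right_mono Suc) simp
    finally show ?case by (simp add: algebra_simps)
  qed simp
  then show ?thesis by simp
qed

section \<open>Path laws given by their marginal densities\<close>

text \<open>
\<open>p t\<close> is the density of the initial segment of length \<open>t \<le> T\<close>; the densities are consistent, and the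
conditional mean of \<open>1 + |x\<^sub>t\<^sub>+\<^sub>1|\<close> given the past is at most \<open>M\<close>. Only paths in the path space matter,
so positivity is required there only. The empty path is the constant function \<^const>\<open>undefined\<close>.
\<close>

locale density_process =
  fixes T :: nat and M :: real and p :: "nat \<Rightarrow> ('d::finite) path \<Rightarrow> real"
  assumes p_meas: "\<And>t. t \<le> T \<Longrightarrow> p t \<in> borel_measurable (path_space t)"
    and p_pos: "\<And>t x. t \<le> T \<Longrightarrow> x \<in> space (path_space t) \<Longrightarrow> 0 < p t x"
    and p_0: "p 0 (\<lambda>_. undefined) = 1"
    and p_step: "\<And>t x. t < T \<Longrightarrow> x \<in> space (path_space t) \<Longrightarrow>
      (\<integral>\<^sup>+a. ennreal (p (Suc t) (x(Suc t := a))) \<partial>lborel) = ennreal (p t x)"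
    and p_moment: "\<And>t x. t < T \<Longrightarrow> x \<in> space (path_space t) \<Longrightarrow>
      (\<integral>\<^sup>+a. ennreal (p (Suc t) (x(Suc t := a)) * (1 + norm a)) \<partial>lborel) \<le> ennreal (M * p t x)"
    and M_ge_1: "1 \<le> M"
begin

text \<open>
The conditional density of the next point given the segment \<open>x\<close>, the law of the segment of length \<open>t\<close>,
and the conditional law with this density.
\<close>

definition cond_density :: "nat \<Rightarrow> 'd path \<Rightarrow> real ^ 'd \<Rightarrow> real" where
  "cond_density t x a = p (Suc t) (x(Suc t := a)) / p t x"

definition law :: "nat \<Rightarrow> 'd path measure" where
  "law t = density (path_lebesgue t) (\<lambda>x. ennreal (p t x))"

definition cond_law :: "nat \<Rightarrow> 'd path \<Rightarrow> (real ^ 'd) measure" where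
  "cond_law t x = density lborel (\<lambda>a. ennreal (cond_density t x a))"

lemma sets_law[simp, measurable_cong]: "sets (law t) = sets (path_space t)"
  by (simp add: law_def)

lemma space_law[simp]: "space (law t) = space (path_space t)"
  by (simp add: law_def)

lemma p_upd_meas: "t < T \<Longrightarrow> (\<lambda>(x, a). p (Suc t) (x(Suc t := a))) \<in> borel_measurable (path_space t \<Otimes>\<^sub>M borel)"
  using measurable_compose[OF fun_upd_path_measurable p_meas[of "Suc t"]]
  by (simp add: case_prod_unfold Suc_le_eq)

lemma cond_density_meas: "t < T \<Longrightarrow> (\<lambda>(x, a). cond_density t x a) \<in> borel_measurable (path_space t \<Otimes>\<^sub>M borel)"
  unfolding cond_density_def using p_upd_meas[of t] p_meas[of t] by (simp add: case_prod_unfold)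

lemma cond_density_meas2: "t < T \<Longrightarrow> x \<in> space (path_space t) \<Longrightarrow> cond_density t x \<in> borel_measurable borel"
  by (drule cond_density_meas, drule (1) measurable_Pair2) simp

lemma cond_density_pos: "t < T \<Longrightarrow> x \<in> space (path_space t) \<Longrightarrow> 0 < cond_density t x a"
  unfolding cond_density_def by (intro divide_pos_pos p_pos fun_upd_path_space) auto

lemma p_cond_density: "t < T \<Longrightarrow> x \<in> space (path_space t) \<Longrightarrow> p t x * cond_density t x a = p (Suc t) (x(Suc t := a))"
  unfolding cond_density_def using p_pos[of t x] by simp

lemma cond_density_one:
  assumes "t < T" "x \<in> space (path_space t)"
  shows "(\<integral>\<^sup>+a. ennreal (cond_density t x a) \<partial>lborel) = 1"
proof -
  have pos: "0 < p t x" using p_pos[of t x] assms by simp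
  have "(\<integral>\<^sup>+a. ennreal (cond_density t x a) \<partial>lborel) =
      (\<integral>\<^sup>+a. ennreal (p (Suc t) (x(Suc t := a))) / ennreal (p t x) \<partial>lborel)"
    unfolding cond_density_def using pos p_pos[OF Suc_leI fun_upd_path_space] assms
    by (intro nn_integral_cong) (simp add: divide_ennreal less_imp_le)
  also have "\<dots> = 1"
    using p_upd_meas[OF assms(1)] assms pos
    by (subst nn_integral_divide) (auto simp: p_step divide_ennreal)
  finally show ?thesis .
qed

lemma cond_density_moment:
  assumes "t < T" "x \<in> space (path_space t)"
  shows "(\<integral>\<^sup>+a. ennreal (cond_density t x a) * ennreal (1 + norm a) \<partial>lborel) \<le> ennreal M"
proof -
  have pos: "0 < p t x" using p_pos[of t x] assms by simp
  have "(\<integral>\<^sup>+a. ennreal (cond_density t x a) * ennreal (1 + norm a) \<partial>lborel) =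
      (\<integral>\<^sup>+a. ennreal (p (Suc t) (x(Suc t := a)) * (1 + norm a)) / ennreal (p t x) \<partial>lborel)"
    unfolding cond_density_def using pos p_pos[OF Suc_leI fun_upd_path_space] assms
    by (intro nn_integral_cong) (simp add: divide_ennreal less_imp_le ennreal_mult[symmetric] del: ennreal_plus)
  also have "\<dots> = (\<integral>\<^sup>+a. ennreal (p (Suc t) (x(Suc t := a)) * (1 + norm a)) \<partial>lborel) / ennreal (p t x)"
    using p_upd_meas[OF assms(1)] assms
    by (subst nn_integral_divide) auto
  also have "\<dots> \<le> ennreal (M * p t x) / ennreal (p t x)"
    by (intro divide_right_mono_ennreal p_moment assms)
  also have "\<dots> = ennreal M"
    using pos M_ge_1 by (simp add: divide_ennreal)
  finally show ?thesis .
qed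

lemma law_step:
  assumes "t < T" and h[measurable]: "h \<in> borel_measurable (path_space (Suc t))"
  shows "(\<integral>\<^sup>+x. h x \<partial>law (Suc t)) = (\<integral>\<^sup>+x. \<integral>\<^sup>+a. h (x(Suc t := a)) \<partial>cond_law t x \<partial>law t)"
proof -
  note [measurable] = p_meas[of "Suc t"] p_meas[of t] cond_density_meas[of t] cond_density_meas2[of t]
  have T: "Suc t \<le> T" "t \<le> T" "t < T" using assms by auto
  have [measurable]: "p (Suc t) \<in> borel_measurable (path_space (Suc t))"
    "p t \<in> borel_measurable (path_space t)"
    "(\<lambda>(x, a). cond_density t x a) \<in> borel_measurable (path_space t \<Otimes>\<^sub>M borel)"
    using T by measurable
  have hu[measurable]: "(\<lambda>(x, a). h (x(Suc t := a))) \<in> borel_measurable (path_space t \<Otimes>\<^sub>M borel)"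
    using measurable_compose[OF fun_upd_path_measurable h] by (simp add: case_prod_unfold)
  have hu2[measurable]: "(\<lambda>a. h (x(Suc t := a))) \<in> borel_measurable borel" if "x \<in> space (path_space t)" for x
    using measurable_compose[OF measurable_Pair1'[OF that] hu] by simp
  have "(\<integral>\<^sup>+x. h x \<partial>law (Suc t)) =
      (\<integral>\<^sup>+x. \<integral>\<^sup>+a. ennreal (p (Suc t) (x(Suc t := a))) * h (x(Suc t := a)) \<partial>lborel \<partial>path_lebesgue t)"
    unfolding law_def by (subst nn_integral_density) (auto simp: nn_integral_path_lebesgue_Suc)
  also have "\<dots> = (\<integral>\<^sup>+x. ennreal (p t x) * (\<integral>\<^sup>+a. h (x(Suc t := a)) \<partial>cond_law t x) \<partial>path_lebesgue t)"
  proof (rule nn_integral_cong)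
    fix x :: "'d path" assume "x \<in> space (path_lebesgue t)"
    then have x: "x \<in> space (path_space t)" by simp
    have [measurable]: "cond_density t x \<in> borel_measurable borel" using T x by measurable
    have "(\<integral>\<^sup>+a. ennreal (p (Suc t) (x(Suc t := a))) * h (x(Suc t := a)) \<partial>lborel) =
        (\<integral>\<^sup>+a. ennreal (p t x) * (ennreal (cond_density t x a) * h (x(Suc t := a))) \<partial>lborel)"
      using p_pos[OF T(2) x] cond_density_pos[OF T(3) x]
      by (intro nn_integral_cong)
         (simp add: p_cond_density[OF T(3) x, symmetric] ennreal_mult less_imp_le mult.assoc)
    also have "\<dots> = ennreal (p t x) * (\<integral>\<^sup>+a. ennreal (cond_density t x a) * h (x(Suc t := a)) \<partial>lborel)"
      using x by (subst nn_integral_cmult) auto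
    also have "(\<integral>\<^sup>+a. ennreal (cond_density t x a) * h (x(Suc t := a)) \<partial>lborel) =
        (\<integral>\<^sup>+a. h (x(Suc t := a)) \<partial>cond_law t x)"
      unfolding cond_law_def using x by (subst nn_integral_density) auto
    finally show "(\<integral>\<^sup>+a. ennreal (p (Suc t) (x(Suc t := a))) * h (x(Suc t := a)) \<partial>lborel) =
       ennreal (p t x) * (\<integral>\<^sup>+a. h (x(Suc t := a)) \<partial>cond_law t x)" .
  qed
  also have "\<dots> = (\<integral>\<^sup>+x. \<integral>\<^sup>+a. h (x(Suc t := a)) \<partial>cond_law t x \<partial>law t)"
  proof -
    have "(\<lambda>x. \<integral>\<^sup>+a. ennreal (cond_density t x a) * h (x(Suc t := a)) \<partial>lborel) \<in> borel_measurable (path_space t)"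
      by measurable
    then have "(\<lambda>x. \<integral>\<^sup>+a. h (x(Suc t := a)) \<partial>cond_law t x) \<in> borel_measurable (path_space t)"
      by (rule measurable_cong[THEN iffD1, rotated])
         (simp add: cond_law_def nn_integral_density cond_density_meas2[OF T(3)])
    then show ?thesis
      unfolding law_def by (subst nn_integral_density) auto
  qed
  finally show ?thesis .
qed

lemma cond_law_kernel:
  assumes "t < T"
  shows "cond_law t \<in> path_space t \<rightarrow>\<^sub>M prob_algebra borel"
proof -
  note [measurable] = cond_density_meas[OF assms]
  have "(\<lambda>x. density lborel (\<lambda>a. ennreal (cond_density t x a))) \<in> path_space t \<rightarrow>\<^sub>M prob_algebra lborel"
    by (rule measurable_density_kernel) (auto simp: cond_density_one[OF assms] intro: sigma_finite_lborel)
  moreover have "prob_algebra (lborel :: (real ^ 'd) measure) = prob_algebra borel"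
    unfolding prob_algebra_def by (subst subprob_algebra_cong[of lborel borel]) auto
  ultimately show ?thesis
    by (simp add: cond_law_def[abs_def])
qed

text \<open>
A process \<open>f\<close> whose increments \<open>g\<close> follow the kernels \<open>cond_law\<close>, as functions of the past of \<open>f\<close> only,
has the laws \<open>law t\<close>, even if it is built inside a larger process.
\<close>

lemma marginal_law:
  fixes m :: "nat \<Rightarrow> 'w measure" and \<kappa> :: "nat \<Rightarrow> 'w \<Rightarrow> 'e measure"
    and f :: "'w \<Rightarrow> 'd path" and g :: "'e \<Rightarrow> real ^ 'd"
  assumes base: "\<And>h. h \<in> borel_measurable (path_space 0) \<Longrightarrow>
      (\<integral>\<^sup>+w. h (f w) \<partial>m 0) = h (\<lambda>_. undefined)"
    and step: "\<And>t h. t < T \<Longrightarrow> h \<in> borel_measurable (path_space (Suc t)) \<Longrightarrow>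
      (\<integral>\<^sup>+w. h (f w) \<partial>m (Suc t)) = (\<integral>\<^sup>+w. \<integral>\<^sup>+e. h ((f w)(Suc t := g e)) \<partial>\<kappa> t w \<partial>m t)"
    and kernel: "\<And>t w h. t < T \<Longrightarrow> w \<in> space (m t) \<Longrightarrow> h \<in> borel_measurable borel \<Longrightarrow>
      (\<integral>\<^sup>+e. h (g e) \<partial>\<kappa> t w) = (\<integral>\<^sup>+a. h a \<partial>cond_law t (f w))"
    and space: "\<And>t w. t \<le> T \<Longrightarrow> w \<in> space (m t) \<Longrightarrow> f w \<in> space (path_space t)"
    and "t \<le> T" "h \<in> borel_measurable (path_space t)"
  shows "(\<integral>\<^sup>+w. h (f w) \<partial>m t) = (\<integral>\<^sup>+x. h x \<partial>law t)"
  using assms(5,6)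
proof (induction t arbitrary: h)
  case 0
  have "(\<integral>\<^sup>+x. h x \<partial>law 0) = h (\<lambda>_. undefined)"
    unfolding law_def using 0 p_meas[of 0]
    by (subst nn_integral_density) (auto simp: nn_integral_path_lebesgue_0 p_0)
  then show ?case using base[OF 0(2)] by simp
next
  case (Suc t)
  then have t: "t < T" by simp
  note h = Suc.prems(2)
  have m2: "(\<lambda>(x, a). h (x(Suc t := a))) \<in> borel_measurable (path_space t \<Otimes>\<^sub>M borel)"
    using measurable_compose[OF fun_upd_path_measurable h] by (simp add: case_prod_unfold del: fun_upd_apply)
  have "(\<integral>\<^sup>+w. h (f w) \<partial>m (Suc t)) = (\<integral>\<^sup>+w. \<integral>\<^sup>+e. h ((f w)(Suc t := g e)) \<partial>\<kappa> t w \<partial>m t)"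
    by (rule step[OF t h])
  also have "\<dots> = (\<integral>\<^sup>+w. (\<lambda>x. \<integral>\<^sup>+a. h (x(Suc t := a)) \<partial>cond_law t x) (f w) \<partial>m t)"
  proof (rule nn_integral_cong)
    fix w assume w: "w \<in> space (m t)"
    have "f w \<in> space (path_space t)" using space w t by simp
    from measurable_Pair2[OF m2 this]
    have "(\<lambda>a. h ((f w)(Suc t := a))) \<in> borel_measurable borel" by (simp del: fun_upd_apply)
    from kernel[OF t w this]
    show "(\<integral>\<^sup>+e. h ((f w)(Suc t := g e)) \<partial>\<kappa> t w) =
        (\<lambda>x. \<integral>\<^sup>+a. h (x(Suc t := a)) \<partial>cond_law t x) (f w)" by simp
  qed
  also have "\<dots> = (\<integral>\<^sup>+x. \<integral>\<^sup>+a. h (x(Suc t := a)) \<partial>cond_law t x \<partial>law t)"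
    by (rule Suc.IH) (use t in \<open>auto intro!: nn_integral_measurable_subprob_algebra2[OF m2]
        measurable_prob_algebraD[OF cond_law_kernel] simp del: fun_upd_apply\<close>)
  also have "\<dots> = (\<integral>\<^sup>+x. h x \<partial>law (Suc t))"
    by (rule law_step[OF t h, symmetric])
  finally show ?case .
qed

lemma disintegration_law:
  assumes "t < T"
  shows "disintegration t (law T) (cond_law t)"
  unfolding disintegration_def
  by (rule is_cond_law_chain[where m=law and e="\<lambda>t x a. x(Suc t := a)" and T=T])
     (use assms in \<open>auto simp: cond_law_kernel law_step trunc_measurable trunc_id trunc_fun_upd trunc_trunc trunc_last
       simp del: fun_upd_apply intro!: fun_upd_path_measurable component_path_measurable\<close>, auto)

end

section \<open>The bicausal coupling that stays together as long as possible\<close>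

locale density_process_pair =
  P: density_process T M p + Q: density_process T M q
  for T :: nat and M :: real and p q :: "nat \<Rightarrow> ('d::finite) path \<Rightarrow> real"
begin

abbreviation pair_space :: "nat \<Rightarrow> ('d path \<times> 'd path) measure" where
  "pair_space t \<equiv> path_space t \<Otimes>\<^sub>M path_space t"

text \<open>
The part of the two conditional densities at time \<open>t\<close> that is coupled on the diagonal: as much as
possible while the two paths agree, and nothing after they have separated.
\<close>

definition overlap :: "nat \<Rightarrow> 'd path \<times> 'd path \<Rightarrow> real ^ 'd \<Rightarrow> real" where
  "overlap t w a = (if fst w = snd w then min (P.cond_density t (fst w) a) (Q.cond_density t (snd w) a) else 0)"

text \<open>
The joint conditional law of the next two points, given a pair of segments, and the operation that
appends two points to a pair of segments.
\<close>

definition step_kernel :: "nat \<Rightarrow> 'd path \<times> 'd path \<Rightarrow> ((real ^ 'd) \<times> (real ^ 'd)) measure" where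
  "step_kernel t w = common_coupling lborel (P.cond_density t (fst w)) (Q.cond_density t (snd w)) (overlap t w)"

definition extend :: "nat \<Rightarrow> 'd path \<times> 'd path \<Rightarrow> (real ^ 'd) \<times> (real ^ 'd) \<Rightarrow> 'd path \<times> 'd path" where
  "extend t w ab = ((fst w)(Suc t := fst ab), (snd w)(Suc t := snd ab))"

text \<open>
The law of the pair of initial segments of length \<open>t\<close>.
\<close>

primrec joint_law :: "nat \<Rightarrow> ('d path \<times> 'd path) measure" where
  "joint_law 0 = return (pair_space 0) (\<lambda>_. undefined, \<lambda>_. undefined)"
| "joint_law (Suc t) = joint_law t \<bind> (\<lambda>w. distr (step_kernel t w) (pair_space (Suc t)) (extend t w))"

lemma common_part_step:
  assumes t: "t < T" and w: "w \<in> space (pair_space t)"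
  shows "common_part lborel (P.cond_density t (fst w)) (Q.cond_density t (snd w)) (overlap t w)"
proof
  have w': "fst w \<in> space (path_space t)" "snd w \<in> space (path_space t)"
    using w by (auto simp: space_pair_measure)
  note pos = P.cond_density_pos[OF t w'(1)] Q.cond_density_pos[OF t w'(2)]
  have P[measurable]: "P.cond_density t (fst w) \<in> borel_measurable borel"
    by (rule P.cond_density_meas2[OF t w'(1)])
  have Q[measurable]: "Q.cond_density t (snd w) \<in> borel_measurable borel"
    by (rule Q.cond_density_meas2[OF t w'(2)])
  show "P.cond_density t (fst w) \<in> borel_measurable lborel" "Q.cond_density t (snd w) \<in> borel_measurable lborel"
    by simp_all
  show "overlap t w \<in> borel_measurable lborel"
    unfolding overlap_def[abs_def] using P Q
    by (cases "fst w = snd w") (auto intro!: borel_measurable_min)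
  show "0 \<le> overlap t w z" "overlap t w z \<le> P.cond_density t (fst w) z"
    "overlap t w z \<le> Q.cond_density t (snd w) z" for z
    using pos[of z] by (auto simp: overlap_def min_def less_imp_le)
qed (use assms in \<open>auto simp: space_pair_measure P.cond_density_one Q.cond_density_one
      intro: lborel.sigma_finite_countable\<close>)

lemma extend_measurable[measurable]:
  "(\<lambda>(w, ab). extend t w ab) \<in> pair_space t \<Otimes>\<^sub>M (borel \<Otimes>\<^sub>M borel) \<rightarrow>\<^sub>M pair_space (Suc t)"
proof -
  have "(\<lambda>x. (fst (fst x))(Suc t := fst (snd x))) \<in> pair_space t \<Otimes>\<^sub>M (borel \<Otimes>\<^sub>M borel) \<rightarrow>\<^sub>M path_space (Suc t)"
    using measurable_compose[OF _ fun_upd_path_measurable,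
      of "\<lambda>x. (fst (fst x), fst (snd x))" "pair_space t \<Otimes>\<^sub>M (borel \<Otimes>\<^sub>M borel)" t] by simp
  moreover have "(\<lambda>x. (snd (fst x))(Suc t := snd (snd x))) \<in> pair_space t \<Otimes>\<^sub>M (borel \<Otimes>\<^sub>M borel) \<rightarrow>\<^sub>M path_space (Suc t)"
    using measurable_compose[OF _ fun_upd_path_measurable,
      of "\<lambda>x. (snd (fst x), snd (snd x))" "pair_space t \<Otimes>\<^sub>M (borel \<Otimes>\<^sub>M borel)" t] by simp
  ultimately show ?thesis
    unfolding extend_def case_prod_unfold by (rule measurable_Pair)
qed

lemma step_kernel_measurable:
  assumes t: "t < T"
  shows "step_kernel t \<in> pair_space t \<rightarrow>\<^sub>M prob_algebra (borel \<Otimes>\<^sub>M borel)"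
proof -
  have P[measurable]: "(\<lambda>(w, a). P.cond_density t (fst w) a) \<in> borel_measurable (pair_space t \<Otimes>\<^sub>M lborel)"
    using measurable_compose[OF _ P.cond_density_meas[OF t],
        of "\<lambda>x. (fst (fst x), snd x)" "pair_space t \<Otimes>\<^sub>M lborel"] by (simp add: case_prod_unfold)
  have Q[measurable]: "(\<lambda>(w, a). Q.cond_density t (snd w) a) \<in> borel_measurable (pair_space t \<Otimes>\<^sub>M lborel)"
    using measurable_compose[OF _ Q.cond_density_meas[OF t],
        of "\<lambda>x. (snd (fst x), snd x)" "pair_space t \<Otimes>\<^sub>M lborel"] by (simp add: case_prod_unfold)
  have "(\<lambda>(w, a). overlap t w a) \<in> borel_measurable (pair_space t \<Otimes>\<^sub>M lborel)"
    unfolding overlap_def by measurable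
  then have "(\<lambda>w. common_coupling lborel (P.cond_density t (fst w)) (Q.cond_density t (snd w)) (overlap t w))
      \<in> pair_space t \<rightarrow>\<^sub>M prob_algebra (lborel \<Otimes>\<^sub>M lborel)"
    by (intro measurable_common_coupling common_part_step[OF t] lborel.sigma_finite_measure_axioms P Q)
  moreover have "prob_algebra (lborel \<Otimes>\<^sub>M lborel :: ((real ^ 'd) \<times> (real ^ 'd)) measure) = prob_algebra (borel \<Otimes>\<^sub>M borel)"
    unfolding prob_algebra_def
    by (subst subprob_algebra_cong[of "lborel \<Otimes>\<^sub>M lborel" "borel \<Otimes>\<^sub>M borel"]) (auto intro!: sets_pair_measure_cong)
  ultimately show ?thesis by (simp add: step_kernel_def[abs_def])
qed

lemma step_kernel_subprob:
  "t < T \<Longrightarrow> step_kernel t \<in> pair_space t \<rightarrow>\<^sub>M subprob_algebra (borel \<Otimes>\<^sub>M borel)"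
  by (rule measurable_prob_algebraD[OF step_kernel_measurable])

lemma sets_step_kernel: "t < T \<Longrightarrow> w \<in> space (pair_space t) \<Longrightarrow> sets (step_kernel t w) = sets (borel \<Otimes>\<^sub>M borel)"
  using measurable_space[OF step_kernel_measurable, of t w] by (simp add: space_prob_algebra)

lemma prob_space_step_kernel: "t < T \<Longrightarrow> w \<in> space (pair_space t) \<Longrightarrow> prob_space (step_kernel t w)"
  using measurable_space[OF step_kernel_measurable, of t w] by (simp add: space_prob_algebra)

lemma extend_kernel_measurable:
  assumes "t < T"
  shows "(\<lambda>w. distr (step_kernel t w) (pair_space (Suc t)) (extend t w)) \<in> pair_space t \<rightarrow>\<^sub>M subprob_algebra (pair_space (Suc t))"
  by (rule measurable_distr2[OF extend_measurable step_kernel_subprob[OF assms]])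

lemma joint_law_prob_algebra: "t \<le> T \<Longrightarrow> joint_law t \<in> space (prob_algebra (pair_space t))"
proof (induction t)
  case 0
  have "(\<lambda>_. undefined, \<lambda>_. undefined) \<in> space (pair_space 0)"
    by (simp add: space_pair_measure space_path_space)
  then show ?case by (auto simp: space_prob_algebra intro!: prob_space_return)
next
  case (Suc t)
  then have t: "t < T" and J: "sets (joint_law t) = sets (pair_space t)" "prob_space (joint_law t)"
    by (auto simp: space_prob_algebra)
  let ?K = "\<lambda>w. distr (step_kernel t w) (pair_space (Suc t)) (extend t w)"
  have sp: "space (joint_law t) = space (pair_space t)" using J(1) by (rule sets_eq_imp_space_eq)
  have K: "?K \<in> joint_law t \<rightarrow>\<^sub>M subprob_algebra (pair_space (Suc t))"
    using extend_kernel_measurable[OF t] by (simp add: measurable_cong_sets[OF J(1) refl])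
  have "prob_space (?K w)" if w: "w \<in> space (joint_law t)" for w
  proof (rule prob_space.prob_space_distr)
    show "prob_space (step_kernel t w)" using prob_space_step_kernel[OF t] w sp by simp
    have "extend t w \<in> borel \<Otimes>\<^sub>M borel \<rightarrow>\<^sub>M pair_space (Suc t)"
      using measurable_Pair2[OF extend_measurable] w sp by simp
    then show "extend t w \<in> step_kernel t w \<rightarrow>\<^sub>M pair_space (Suc t)"
      using sets_step_kernel[OF t] w sp by (simp cong: measurable_cong_sets)
  qed
  then have "prob_space (joint_law (Suc t))"
    using prob_space.prob_space_bind[OF J(2) _ K] by (auto intro!: AE_I2)
  moreover have "sets (joint_law (Suc t)) = sets (pair_space (Suc t))"
    using prob_space.not_empty[OF J(2)] by (simp add: sets_bind)
  ultimately show ?case by (simp add: space_prob_algebra)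
qed

lemma sets_joint_law: "t \<le> T \<Longrightarrow> sets (joint_law t) = sets (pair_space t)"
  using joint_law_prob_algebra[of t] by (simp add: space_prob_algebra)

lemma space_joint_law: "t \<le> T \<Longrightarrow> space (joint_law t) = space (pair_space t)"
  by (rule sets_eq_imp_space_eq[OF sets_joint_law])

lemma prob_space_joint_law: "t \<le> T \<Longrightarrow> prob_space (joint_law t)"
  using joint_law_prob_algebra[of t] by (simp add: space_prob_algebra)

lemma joint_law_step:
  assumes t: "t < T" and h: "h \<in> borel_measurable (pair_space (Suc t))"
  shows "(\<integral>\<^sup>+w. h w \<partial>joint_law (Suc t)) = (\<integral>\<^sup>+w. \<integral>\<^sup>+ab. h (extend t w ab) \<partial>step_kernel t w \<partial>joint_law t)"
proof -
  let ?K = "\<lambda>w. distr (step_kernel t w) (pair_space (Suc t)) (extend t w)"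
  have K: "?K \<in> joint_law t \<rightarrow>\<^sub>M subprob_algebra (pair_space (Suc t))"
    using extend_kernel_measurable[OF t] sets_joint_law[of t] t by (simp cong: measurable_cong_sets)
  have "(\<integral>\<^sup>+w. h w \<partial>joint_law (Suc t)) = (\<integral>\<^sup>+w. \<integral>\<^sup>+v. h v \<partial>?K w \<partial>joint_law t)"
    using nn_integral_bind[OF h K] by simp
  also have "\<dots> = (\<integral>\<^sup>+w. \<integral>\<^sup>+ab. h (extend t w ab) \<partial>step_kernel t w \<partial>joint_law t)"
  proof (rule nn_integral_cong)
    fix w assume "w \<in> space (joint_law t)"
    then have w: "w \<in> space (pair_space t)" using space_joint_law[of t] t by simp
    have "extend t w \<in> borel \<Otimes>\<^sub>M borel \<rightarrow>\<^sub>M pair_space (Suc t)"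
      using measurable_Pair2[OF extend_measurable] w by simp
    then have "extend t w \<in> step_kernel t w \<rightarrow>\<^sub>M pair_space (Suc t)"
      using sets_step_kernel[OF t w] by (simp cong: measurable_cong_sets)
    then show "(\<integral>\<^sup>+v. h v \<partial>?K w) = (\<integral>\<^sup>+ab. h (extend t w ab) \<partial>step_kernel t w)"
      using h by (intro nn_integral_distr) auto
  qed
  finally show ?thesis .
qed

lemma step_kernel_fst:
  assumes "t < T" "w \<in> space (pair_space t)" and h: "h \<in> borel_measurable borel"
  shows "(\<integral>\<^sup>+ab. h (fst ab) \<partial>step_kernel t w) = (\<integral>\<^sup>+a. h a \<partial>P.cond_law t (fst w))"
proof -
  interpret common_part lborel "P.cond_density t (fst w)" "Q.cond_density t (snd w)" "overlap t w"
    by (rule common_part_step) fact+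
  show ?thesis
    unfolding step_kernel_def P.cond_law_def
    using h f_meas by (subst nn_integral_common_coupling_fst) (auto simp: nn_integral_density)
qed

lemma step_kernel_snd:
  assumes "t < T" "w \<in> space (pair_space t)" and h: "h \<in> borel_measurable borel"
  shows "(\<integral>\<^sup>+ab. h (snd ab) \<partial>step_kernel t w) = (\<integral>\<^sup>+a. h a \<partial>Q.cond_law t (snd w))"
proof -
  interpret common_part lborel "P.cond_density t (fst w)" "Q.cond_density t (snd w)" "overlap t w"
    by (rule common_part_step) fact+
  show ?thesis
    unfolding step_kernel_def Q.cond_law_def
    using h g_meas by (subst nn_integral_common_coupling_snd) (auto simp: nn_integral_density)
qed

lemma cond_laws_coupled:
  assumes "t < T" "w \<in> space (pair_space t)"
  shows "step_kernel t w \<in> couplings (P.cond_law t (fst w)) (Q.cond_law t (snd w))"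
proof -
  interpret common_part lborel "P.cond_density t (fst w)" "Q.cond_density t (snd w)" "overlap t w"
    by (rule common_part_step) fact+
  show ?thesis
    unfolding step_kernel_def P.cond_law_def Q.cond_law_def by (rule common_coupling_in_couplings)
qed

lemma joint_law_fst:
  assumes "t \<le> T" and "h \<in> borel_measurable (path_space t)"
  shows "(\<integral>\<^sup>+w. h (fst w) \<partial>joint_law t) = (\<integral>\<^sup>+x. h x \<partial>P.law t)"
proof (rule P.marginal_law[where m=joint_law and \<kappa>=step_kernel and f=fst and g=fst])
  fix h :: "'d path \<Rightarrow> ennreal" assume "h \<in> borel_measurable (path_space 0)"
  then show "(\<integral>\<^sup>+w. h (fst w) \<partial>joint_law 0) = h (\<lambda>_. undefined)"
    by (simp, subst nn_integral_return) (auto simp: space_pair_measure space_path_space)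
next
  fix t and h :: "'d path \<Rightarrow> ennreal"
  assume "t < T" "h \<in> borel_measurable (path_space (Suc t))"
  then show "(\<integral>\<^sup>+w. h (fst w) \<partial>joint_law (Suc t)) =
      (\<integral>\<^sup>+w. \<integral>\<^sup>+e. h ((fst w)(Suc t := fst e)) \<partial>step_kernel t w \<partial>joint_law t)"
    using joint_law_step[of t "\<lambda>w. h (fst w)"] by (simp add: extend_def)
next
  fix t w and h :: "real ^ 'd \<Rightarrow> ennreal"
  assume "t < T" "w \<in> space (joint_law t)" "h \<in> borel_measurable borel"
  then show "(\<integral>\<^sup>+e. h (fst e) \<partial>step_kernel t w) = (\<integral>\<^sup>+a. h a \<partial>P.cond_law t (fst w))"
    by (intro step_kernel_fst) (simp_all add: space_joint_law)
qed (use assms in \<open>auto simp: space_joint_law space_pair_measure\<close>)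

lemma joint_law_snd:
  assumes "t \<le> T" and "h \<in> borel_measurable (path_space t)"
  shows "(\<integral>\<^sup>+w. h (snd w) \<partial>joint_law t) = (\<integral>\<^sup>+x. h x \<partial>Q.law t)"
proof (rule Q.marginal_law[where m=joint_law and \<kappa>=step_kernel and f=snd and g=snd])
  fix h :: "'d path \<Rightarrow> ennreal" assume "h \<in> borel_measurable (path_space 0)"
  then show "(\<integral>\<^sup>+w. h (snd w) \<partial>joint_law 0) = h (\<lambda>_. undefined)"
    by (simp, subst nn_integral_return) (auto simp: space_pair_measure space_path_space)
next
  fix t and h :: "'d path \<Rightarrow> ennreal"
  assume "t < T" "h \<in> borel_measurable (path_space (Suc t))"
  then show "(\<integral>\<^sup>+w. h (snd w) \<partial>joint_law (Suc t)) =
      (\<integral>\<^sup>+w. \<integral>\<^sup>+e. h ((snd w)(Suc t := snd e)) \<partial>step_kernel t w \<partial>joint_law t)"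
    using joint_law_step[of t "\<lambda>w. h (snd w)"] by (simp add: extend_def)
next
  fix t w and h :: "real ^ 'd \<Rightarrow> ennreal"
  assume "t < T" "w \<in> space (joint_law t)" "h \<in> borel_measurable borel"
  then show "(\<integral>\<^sup>+e. h (snd e) \<partial>step_kernel t w) = (\<integral>\<^sup>+a. h a \<partial>Q.cond_law t (snd w))"
    by (intro step_kernel_snd) (simp_all add: space_joint_law)
qed (use assms in \<open>auto simp: space_joint_law space_pair_measure\<close>)

lemma joint_law_coupling: "joint_law T \<in> couplings (P.law T) (Q.law T)"
  unfolding couplings_def
proof (intro CollectI conjI)
  have S: "sets (joint_law T) = sets (pair_space T)" by (rule sets_joint_law) simp
  then show "sets (joint_law T) = sets (P.law T \<Otimes>\<^sub>M Q.law T)"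
    using sets_pair_measure_cong[OF P.sets_law Q.sets_law] by simp
  have [measurable]: "fst \<in> joint_law T \<rightarrow>\<^sub>M P.law T" "snd \<in> joint_law T \<rightarrow>\<^sub>M Q.law T"
    by (simp_all add: measurable_cong_sets[OF S P.sets_law] measurable_cong_sets[OF S Q.sets_law])
  show "distr (joint_law T) (P.law T) fst = P.law T"
    by (rule distr_eqI) (auto simp: joint_law_fst)
  show "distr (joint_law T) (Q.law T) snd = Q.law T"
    by (rule distr_eqI) (auto simp: joint_law_snd)
qed (rule prob_space_joint_law, simp)

lemma disintegration2_joint_law:
  assumes "t < T"
  shows "disintegration2 t (joint_law T) (step_kernel t)"
  unfolding disintegration2_def
proof (rule is_cond_law_chain[where m=joint_law and e=extend and T=T and S="pair_space"
      and r="\<lambda>t (x, y). (trunc t x, trunc t y)" and c="\<lambda>t (x, y). (x (Suc t), y (Suc t))"])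
  fix t s :: nat assume ts: "t \<le> s"
  have tr: "trunc t \<in> path_space s \<rightarrow>\<^sub>M (path_space t :: 'd path measure)"
    using ts by (rule trunc_measurable)
  show "(\<lambda>(x, y). (trunc t x, trunc t y)) \<in> pair_space s \<rightarrow>\<^sub>M pair_space t"
    unfolding case_prod_unfold
    using measurable_compose[OF measurable_fst tr, of "path_space s :: 'd path measure"]
      measurable_compose[OF measurable_snd tr, of "path_space s :: 'd path measure"]
    by (intro measurable_Pair) auto
next
  fix t s :: nat assume "t < s"
  then have c: "(\<lambda>x. x (Suc t)) \<in> path_space s \<rightarrow>\<^sub>M (borel :: (real ^ 'd) measure)"
    by (intro component_path_measurable) auto
  show "(\<lambda>(x, y). (x (Suc t), y (Suc t))) \<in> pair_space s \<rightarrow>\<^sub>M borel \<Otimes>\<^sub>M (borel :: (real ^ 'd) measure)"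
    unfolding case_prod_unfold
    using measurable_compose[OF measurable_fst c, of "path_space s :: 'd path measure"]
      measurable_compose[OF measurable_snd c, of "path_space s :: 'd path measure"]
    by (intro measurable_Pair) auto
next
  fix t and h :: "'d path \<times> 'd path \<Rightarrow> ennreal"
  assume "t < T" "h \<in> borel_measurable (pair_space (Suc t))"
  then show "(\<integral>\<^sup>+x. h x \<partial>joint_law (Suc t)) = (\<integral>\<^sup>+x. \<integral>\<^sup>+a. h (extend t x a) \<partial>step_kernel t x \<partial>joint_law t)"
    by (rule joint_law_step)
qed (use assms in \<open>auto simp: sets_joint_law step_kernel_measurable extend_def trunc_fun_upd
      trunc_id trunc_trunc trunc_last space_pair_measure case_prod_unfold
      simp del: fun_upd_apply joint_law.simps intro: extend_measurable[unfolded case_prod_unfold extend_def]\<close>, auto)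

lemma joint_law_bicausal: "joint_law T \<in> bicausal_couplings T (P.law T) (Q.law T)"
  unfolding bicausal_couplings_def
proof (intro CollectI conjI ballI joint_law_coupling)
  fix t assume "t \<in> {1..<T}"
  then have t: "t < T" by simp
  have "AE (x, y) in joint_law T. step_kernel t (trunc t x, trunc t y)
      \<in> couplings (P.cond_law t (trunc t x)) (Q.cond_law t (trunc t y))"
  proof (rule AE_I2, clarify)
    fix x y assume "(x, y) \<in> space (joint_law T)"
    then have "x \<in> space (path_space T)" "y \<in> space (path_space T)"
      by (auto simp: space_joint_law space_pair_measure)
    then have "(trunc t x, trunc t y) \<in> space (pair_space t)"
      using measurable_space[OF trunc_measurable, of t T] t by (auto simp: space_pair_measure)
    from cond_laws_coupled[OF t this]
    show "step_kernel t (trunc t x, trunc t y) \<in> couplings (P.cond_law t (trunc t x)) (Q.cond_law t (trunc t y))"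
      by simp
  qed
  then show "\<exists>\<kappa>\<^sub>\<pi> \<kappa>\<^sub>\<mu> \<kappa>\<^sub>\<nu>. disintegration2 t (joint_law T) \<kappa>\<^sub>\<pi> \<and> disintegration t (P.law T) \<kappa>\<^sub>\<mu> \<and>
      disintegration t (Q.law T) \<kappa>\<^sub>\<nu> \<and>
      (AE (x, y) in joint_law T. \<kappa>\<^sub>\<pi> (trunc t x, trunc t y) \<in> couplings (\<kappa>\<^sub>\<mu> (trunc t x)) (\<kappa>\<^sub>\<nu> (trunc t y)))"
    using disintegration2_joint_law[OF t] P.disintegration_law[OF t] Q.disintegration_law[OF t] by blast
qed

end

section \<open>The transport cost of the coupling\<close>

lemma min_mult_abs_diff_le:
  fixes p q a b :: real
  assumes "0 \<le> p" "0 \<le> q" "0 \<le> a" "0 \<le> b"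
  shows "min p q * \<bar>a - b\<bar> \<le> \<bar>p * a - q * b\<bar> + \<bar>p - q\<bar> * (a + b)"
proof -
  have le: "p * \<bar>a - b\<bar> \<le> \<bar>p * a - q * b\<bar> + \<bar>p - q\<bar> * (a + b)"
    if "0 \<le> p" "0 \<le> a" "0 \<le> b" for p q a b :: real
  proof -
    have "p * \<bar>a - b\<bar> = \<bar>p * (a - b)\<bar>" using that by (simp add: abs_mult)
    also have "p * (a - b) = (p * a - q * b) + (q - p) * b" by (simp add: algebra_simps)
    also have "\<bar>\<dots>\<bar> \<le> \<bar>p * a - q * b\<bar> + \<bar>p - q\<bar> * b"
      using that by (intro abs_triangle_ineq[THEN order_trans]) (simp add: abs_mult abs_minus_commute)
    also have "\<dots> \<le> \<bar>p * a - q * b\<bar> + \<bar>p - q\<bar> * (a + b)"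
      using that by (intro add_left_mono mult_left_mono) auto
    finally show ?thesis .
  qed
  have "q * \<bar>a - b\<bar> \<le> \<bar>p * a - q * b\<bar> + \<bar>p - q\<bar> * (a + b)"
    using le[of q b a p] assms by (simp add: abs_minus_commute add.commute)
  then show ?thesis
    using le[of p a b q] assms by (cases "p \<le> q") (simp_all only: min_def if_True if_False)
qed

context density_process_pair
begin

text \<open>
\<open>l1_gap t\<close> is the weighted distance of the densities of the segments of length \<open>t\<close>, \<open>split_weight t\<close>
is the total weight of two segments that differ, and \<open>split_cost t\<close> is its mean under the coupling.
\<close>

definition l1_gap :: "nat \<Rightarrow> ennreal" where
  "l1_gap t = (\<integral>\<^sup>+x. ennreal (\<bar>p t x - q t x\<bar> * path_weight t x) \<partial>path_lebesgue t)"

definition split_weight :: "nat \<Rightarrow> 'd path \<times> 'd path \<Rightarrow> ennreal" where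
  "split_weight t w = of_bool (fst w \<noteq> snd w) * (ennreal (path_weight t (fst w)) + ennreal (path_weight t (snd w)))"

definition split_cost :: "nat \<Rightarrow> ennreal" where
  "split_cost t = (\<integral>\<^sup>+w. split_weight t w \<partial>joint_law t)"

lemma split_weight_measurable[measurable]: "split_weight t \<in> borel_measurable (pair_space t)"
  unfolding split_weight_def[abs_def] by measurable

text \<open>
On the event that the two segments agree, their common value has density at most \<open>p t\<close>, by the first
marginal, and at most \<open>q t\<close>, by the second. Using the smaller of the two at each point bounds
it by \<open>min (p t) (q t)\<close>.
\<close>

lemma diagonal_law_le:
  assumes t: "t \<le> T" and h: "h \<in> borel_measurable (path_space t)"
  shows "(\<integral>\<^sup>+w. of_bool (fst w = snd w) * h (fst w) \<partial>joint_law t)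
    \<le> (\<integral>\<^sup>+x. ennreal (min (p t x) (q t x)) * h x \<partial>path_lebesgue t)"
proof -
  note [measurable] = P.p_meas[OF t] Q.p_meas[OF t] h sets_joint_law[OF t, measurable_cong]
  let ?D = "{x \<in> space (path_space t). p t x \<le> q t x}"
  let ?E = "{x \<in> space (path_space t). q t x < p t x}"
  have "(\<integral>\<^sup>+w. of_bool (fst w = snd w) * h (fst w) \<partial>joint_law t)
      \<le> (\<integral>\<^sup>+w. indicator ?D (fst w) * h (fst w) + indicator ?E (snd w) * h (snd w) \<partial>joint_law t)"
    by (intro nn_integral_mono) (auto simp: space_joint_law[OF t] space_pair_measure split: split_indicator)
  also have "\<dots> = (\<integral>\<^sup>+w. indicator ?D (fst w) * h (fst w) \<partial>joint_law t) +
      (\<integral>\<^sup>+w. indicator ?E (snd w) * h (snd w) \<partial>joint_law t)"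
    by (rule nn_integral_add) measurable
  also have "(\<integral>\<^sup>+w. indicator ?D (fst w) * h (fst w) \<partial>joint_law t) = (\<integral>\<^sup>+x. indicator ?D x * h x \<partial>P.law t)"
    by (rule joint_law_fst[OF t, of "\<lambda>x. indicator ?D x * h x"]) measurable
  also have "(\<integral>\<^sup>+w. indicator ?E (snd w) * h (snd w) \<partial>joint_law t) = (\<integral>\<^sup>+x. indicator ?E x * h x \<partial>Q.law t)"
    by (rule joint_law_snd[OF t, of "\<lambda>x. indicator ?E x * h x"]) measurable
  also have "(\<integral>\<^sup>+x. indicator ?D x * h x \<partial>P.law t) =
      (\<integral>\<^sup>+x. ennreal (p t x) * (indicator ?D x * h x) \<partial>path_lebesgue t)"
    unfolding P.law_def by (rule nn_integral_density) measurable
  also have "(\<integral>\<^sup>+x. indicator ?E x * h x \<partial>Q.law t) =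
      (\<integral>\<^sup>+x. ennreal (q t x) * (indicator ?E x * h x) \<partial>path_lebesgue t)"
    unfolding Q.law_def by (rule nn_integral_density) measurable
  also have "(\<integral>\<^sup>+x. ennreal (p t x) * (indicator ?D x * h x) \<partial>path_lebesgue t) +
      (\<integral>\<^sup>+x. ennreal (q t x) * (indicator ?E x * h x) \<partial>path_lebesgue t) =
    (\<integral>\<^sup>+x. ennreal (p t x) * (indicator ?D x * h x) + ennreal (q t x) * (indicator ?E x * h x) \<partial>path_lebesgue t)"
    by (rule nn_integral_add[symmetric]) measurable
  also have "\<dots> = (\<integral>\<^sup>+x. ennreal (min (p t x) (q t x)) * h x \<partial>path_lebesgue t)"
    by (intro nn_integral_cong) (auto split: split_indicator simp: min_def)
  finally show ?thesis .
qed

text \<open>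
The weighted distance of the two conditional densities, given a common past \<open>x\<close>.
\<close>

definition cond_gap :: "nat \<Rightarrow> 'd path \<Rightarrow> ennreal" where
  "cond_gap t x = (\<integral>\<^sup>+a. ennreal (\<bar>P.cond_density t x a - Q.cond_density t x a\<bar> * path_weight (Suc t) (x(Suc t := a))) \<partial>lborel)"

lemma cond_gap_measurable:
  assumes t: "t < T"
  shows "cond_gap t \<in> borel_measurable (path_space t)"
proof -
  have *: "(\<lambda>(x, a). path_weight (Suc t) (x(Suc t := a))) \<in> borel_measurable (path_space t \<Otimes>\<^sub>M (borel :: (real ^ 'd) measure))"
    using measurable_compose[OF fun_upd_path_measurable path_weight_measurable]
    by (simp add: case_prod_unfold del: fun_upd_apply)
  note [measurable] = * P.cond_density_meas[OF t] Q.cond_density_meas[OF t]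
  show ?thesis unfolding cond_gap_def[abs_def] by measurable
qed

text \<open>
One step of the coupling: separated paths stay separated, and their weight grows at most by the factor
\<open>M\<close> in the mean; paths that agree separate at the price \<open>cond_gap\<close>.
\<close>

lemma step_kernel_split:
  assumes t: "t < T" and w: "w \<in> space (pair_space t)"
  shows "(\<integral>\<^sup>+ab. split_weight (Suc t) (extend t w ab) \<partial>step_kernel t w)
    \<le> ennreal M * split_weight t w + of_bool (fst w = snd w) * cond_gap t (fst w)"
proof -
  have x: "fst w \<in> space (path_space t)" and y: "snd w \<in> space (path_space t)"
    using w by (auto simp: space_pair_measure)
  note [measurable] = P.cond_density_meas2[OF t x] Q.cond_density_meas2[OF t y]
  note [measurable_cong] = sets_step_kernel[OF t w]
  show ?thesis
  proof (cases "fst w = snd w")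
    case False
    have "(\<integral>\<^sup>+ab. ennreal (1 + norm (fst ab)) \<partial>step_kernel t w) =
        (\<integral>\<^sup>+a. ennreal (1 + norm a) \<partial>P.cond_law t (fst w))"
      by (rule step_kernel_fst[OF t w]) measurable
    also have "\<dots> \<le> ennreal M"
      using P.cond_density_moment[OF t x] unfolding P.cond_law_def
      by (subst nn_integral_density) (auto simp del: ennreal_plus)
    finally have mP: "(\<integral>\<^sup>+ab. ennreal (1 + norm (fst ab)) \<partial>step_kernel t w) \<le> ennreal M" .
    have "(\<integral>\<^sup>+ab. ennreal (1 + norm (snd ab)) \<partial>step_kernel t w) =
        (\<integral>\<^sup>+a. ennreal (1 + norm a) \<partial>Q.cond_law t (snd w))"
      by (rule step_kernel_snd[OF t w]) measurable
    also have "\<dots> \<le> ennreal M"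
      using Q.cond_density_moment[OF t y] unfolding Q.cond_law_def
      by (subst nn_integral_density) (auto simp del: ennreal_plus)
    finally have mQ: "(\<integral>\<^sup>+ab. ennreal (1 + norm (snd ab)) \<partial>step_kernel t w) \<le> ennreal M" .
    have "(\<integral>\<^sup>+ab. split_weight (Suc t) (extend t w ab) \<partial>step_kernel t w) \<le>
      (\<integral>\<^sup>+ab. ennreal (path_weight t (fst w)) * ennreal (1 + norm (fst ab)) +
          ennreal (path_weight t (snd w)) * ennreal (1 + norm (snd ab)) \<partial>step_kernel t w)"
      by (intro nn_integral_mono)
         (auto simp: split_weight_def extend_def path_weight_Suc ennreal_mult[symmetric]
           simp del: ennreal_plus fun_upd_apply split: split_of_bool)
    also have "\<dots> = ennreal (path_weight t (fst w)) * (\<integral>\<^sup>+ab. ennreal (1 + norm (fst ab)) \<partial>step_kernel t w) +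
        ennreal (path_weight t (snd w)) * (\<integral>\<^sup>+ab. ennreal (1 + norm (snd ab)) \<partial>step_kernel t w)"
      by (simp add: nn_integral_add nn_integral_cmult del: ennreal_plus)
    also have "\<dots> \<le> ennreal (path_weight t (fst w)) * ennreal M + ennreal (path_weight t (snd w)) * ennreal M"
      by (intro add_mono mult_left_mono mP mQ) simp_all
    also have "\<dots> = ennreal M * split_weight t w + of_bool (fst w = snd w) * cond_gap t (fst w)"
      using False by (simp add: split_weight_def distrib_left mult.commute)
    finally show ?thesis .
  next
    case True
    interpret C: common_part lborel "P.cond_density t (fst w)" "Q.cond_density t (snd w)" "overlap t w"
      by (rule common_part_step[OF t w])
    let ?u = "\<lambda>a. ennreal (path_weight (Suc t) ((fst w)(Suc t := a)))"
    have u: "?u = (\<lambda>a. ennreal (path_weight t (fst w) * (1 + norm a)))"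
      by (simp add: path_weight_Suc del: fun_upd_apply)
    have [measurable]: "?u \<in> borel_measurable lborel"
    proof -
      have "(\<lambda>a. ennreal (c * (1 + norm a))) \<in> borel_measurable (lborel :: (real ^ 'd) measure)" for c
        by measurable
      then show ?thesis unfolding u .
    qed
    have inj: "(fst w)(Suc t := a) = (fst w)(Suc t := b) \<longleftrightarrow> a = b" for a b
      by (metis fun_upd_same)
    have d: "{x \<in> space (lborel \<Otimes>\<^sub>M (lborel :: (real ^ 'd) measure)). fst x = snd x} \<in> sets (lborel \<Otimes>\<^sub>M lborel)"
      by measurable
    have "(\<integral>\<^sup>+ab. split_weight (Suc t) (extend t w ab) \<partial>step_kernel t w) =
        (\<integral>\<^sup>+ab. of_bool (fst ab \<noteq> snd ab) * (?u (fst ab) + ?u (snd ab)) \<partial>step_kernel t w)"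
      unfolding split_weight_def extend_def True[symmetric] fst_conv snd_conv inj ..
    also have "\<dots> \<le> (\<integral>\<^sup>+a. ennreal (P.cond_density t (fst w) a - overlap t w a) * ?u a \<partial>lborel) +
        (\<integral>\<^sup>+a. ennreal (Q.cond_density t (snd w) a - overlap t w a) * ?u a \<partial>lborel)"
      unfolding step_kernel_def by (rule C.common_coupling_off_diagonal[OF _ d]) measurable
    also have "\<dots> = (\<integral>\<^sup>+a. ennreal (P.cond_density t (fst w) a - overlap t w a) * ?u a +
        ennreal (Q.cond_density t (snd w) a - overlap t w a) * ?u a \<partial>lborel)"
      using C.f_meas C.g_meas C.m_meas by (intro nn_integral_add[symmetric]) auto
    also have "\<dots> = cond_gap t (fst w)"
      unfolding cond_gap_def
    proof (rule nn_integral_cong)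
      fix a
      let ?P = "P.cond_density t (fst w) a" and ?Q = "Q.cond_density t (fst w) a"
      have "ennreal (?P - min ?P ?Q) * ?u a + ennreal (?Q - min ?P ?Q) * ?u a =
          ennreal (?P - min ?P ?Q + (?Q - min ?P ?Q)) * ?u a"
        by (subst ennreal_plus) (auto simp: distrib_right)
      also have "?P - min ?P ?Q + (?Q - min ?P ?Q) = \<bar>?P - ?Q\<bar>" by auto
      finally show "ennreal (P.cond_density t (fst w) a - overlap t w a) * ?u a +
          ennreal (Q.cond_density t (snd w) a - overlap t w a) * ?u a =
          ennreal (\<bar>?P - ?Q\<bar> * path_weight (Suc t) ((fst w)(Suc t := a)))"
        using True by (simp add: overlap_def ennreal_mult del: fun_upd_apply)
    qed
    finally show ?thesis using True by (simp add: split_weight_def[of t w])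
  qed
qed

text \<open>
With \<open>a = p'/p\<close> and \<open>b = q'/q\<close> the conditional densities, \<open>min p q * |a - b|\<close> is at most
\<open>|p' - q'| + |p - q| * (a + b)\<close>. This trades conditional densities for joint ones.
\<close>

lemma common_cond_gap_le:
  assumes t: "t < T"
  shows "(\<integral>\<^sup>+x. ennreal (min (p t x) (q t x)) * cond_gap t x \<partial>path_lebesgue t)
    \<le> l1_gap (Suc t) + ennreal (2 * M) * l1_gap t"
proof -
  have T: "t \<le> T" "Suc t \<le> T" using t by auto
  have m: "(\<lambda>(x, a). f (x(Suc t := a))) \<in> borel_measurable (path_space t \<Otimes>\<^sub>M (borel :: (real ^ 'd) measure))"
    if "f \<in> borel_measurable (path_space (Suc t))" for f :: "'d path \<Rightarrow> real"
    using measurable_compose[OF fun_upd_path_measurable that]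
    by (simp add: case_prod_unfold del: fun_upd_apply)
  note [measurable] = P.cond_density_meas[OF t] Q.cond_density_meas[OF t] P.p_meas[OF T(1)] Q.p_meas[OF T(1)]
    P.p_meas[OF T(2)] Q.p_meas[OF T(2)]
  let ?W = "\<lambda>x a. path_weight (Suc t) (x(Suc t := a))"
  let ?D = "\<lambda>x a. \<bar>p (Suc t) (x(Suc t := a)) - q (Suc t) (x(Suc t := a))\<bar> * ?W x a"
  let ?V = "\<lambda>x. \<bar>p t x - q t x\<bar> * path_weight t x"
  let ?G = "\<lambda>x. \<integral>\<^sup>+a. ennreal (?D x a) \<partial>lborel"
  have gap_meas: "(\<lambda>x. \<bar>p (Suc t) x - q (Suc t) x\<bar> * path_weight (Suc t) x) \<in> borel_measurable (path_space (Suc t))"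
    by measurable
  note m[OF gap_meas, measurable]
  have G_meas[measurable]: "?G \<in> borel_measurable (path_space t)" by measurable
  have pointwise: "ennreal (min (p t x) (q t x)) * cond_gap t x \<le>
      ?G x + ennreal (2 * M) * ennreal (?V x)"
    if x: "x \<in> space (path_space t)" for x
  proof -
    note [measurable] = P.cond_density_meas2[OF t x] Q.cond_density_meas2[OF t x]
    have pos: "0 < p t x" "0 < q t x" using P.p_pos[OF T(1) x] Q.p_pos[OF T(1) x] by auto
    have g_meas: "(\<lambda>a. ?D x a) \<in> borel_measurable borel"
      using measurable_Pair2[OF m[OF gap_meas] x] by (simp del: fun_upd_apply)
    have w_meas[measurable]: "?W x \<in> borel_measurable borel"
      unfolding path_weight_Suc by measurable
    let ?a = "P.cond_density t x" and ?b = "Q.cond_density t x"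
    have ab_meas: "(\<lambda>z. ennreal (\<bar>?a z - ?b z\<bar> * ?W x z)) \<in> borel_measurable lborel"
      using P.cond_density_meas2[OF t x] Q.cond_density_meas2[OF t x] w_meas
      by (auto intro!: borel_measurable_times borel_measurable_abs borel_measurable_diff measurable_compose[OF _ measurable_ennreal] simp del: fun_upd_apply)
    have real: "min (p t x) (q t x) * (\<bar>?a z - ?b z\<bar> * ?W x z) \<le>
        ?D x z +
        ?V x * (?a z * (1 + norm z) + ?b z * (1 + norm z))" for z
    proof -
      have ab: "0 < ?a z" "0 < ?b z"
        using P.cond_density_pos[OF t x] Q.cond_density_pos[OF t x] by auto
      have "min (p t x) (q t x) * \<bar>?a z - ?b z\<bar> \<le>
          \<bar>p t x * ?a z - q t x * ?b z\<bar> + \<bar>p t x - q t x\<bar> * (?a z + ?b z)"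
        using pos ab by (intro min_mult_abs_diff_le) auto
      from mult_right_mono[OF this, of "?W x z"] show ?thesis
        by (simp add: P.p_cond_density[OF t x] Q.p_cond_density[OF t x] path_weight_Suc algebra_simps
            del: fun_upd_apply)
    qed
    have "ennreal (min (p t x) (q t x)) * cond_gap t x =
        (\<integral>\<^sup>+z. ennreal (min (p t x) (q t x)) * ennreal (\<bar>?a z - ?b z\<bar> * ?W x z) \<partial>lborel)"
      unfolding cond_gap_def by (rule nn_integral_cmult[OF ab_meas, symmetric])
    also have "\<dots> \<le> (\<integral>\<^sup>+z. ennreal (?D x z) +
        ennreal (?V x) *
          (ennreal (?a z) * ennreal (1 + norm z) + ennreal (?b z) * ennreal (1 + norm z)) \<partial>lborel)"
    proof (rule nn_integral_mono)
      fix z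
      have ab: "0 < ?a z" "0 < ?b z"
        using P.cond_density_pos[OF t x] Q.cond_density_pos[OF t x] by auto
      have "ennreal (min (p t x) (q t x)) * ennreal (\<bar>?a z - ?b z\<bar> * ?W x z) =
          ennreal (min (p t x) (q t x) * (\<bar>?a z - ?b z\<bar> * ?W x z))"
        using pos by (subst ennreal_mult) auto
      also have "\<dots> \<le> ennreal (?D x z +
        ?V x * (?a z * (1 + norm z) + ?b z * (1 + norm z)))"
        by (rule ennreal_leI[OF real])
      also have "\<dots> = ennreal (?D x z) +
        ennreal (?V x) *
          (ennreal (?a z) * ennreal (1 + norm z) + ennreal (?b z) * ennreal (1 + norm z))"
        using ab by (simp add: ennreal_mult[symmetric] ennreal_plus[symmetric] add_nonneg_nonneg
            del: ennreal_plus fun_upd_apply)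
      finally show "ennreal (min (p t x) (q t x)) * ennreal (\<bar>?a z - ?b z\<bar> * ?W x z) \<le> \<dots>" .
    qed
    also have "\<dots> = ?G x + ennreal (?V x) *
        ((\<integral>\<^sup>+z. ennreal (?a z) * ennreal (1 + norm z) \<partial>lborel) +
         (\<integral>\<^sup>+z. ennreal (?b z) * ennreal (1 + norm z) \<partial>lborel))"
      using g_meas by (simp add: nn_integral_add nn_integral_cmult del: ennreal_plus fun_upd_apply)
    also have "\<dots> \<le> ?G x + ennreal (?V x) * (ennreal M + ennreal M)"
      by (intro add_left_mono mult_left_mono add_mono P.cond_density_moment[OF t x] Q.cond_density_moment[OF t x]) simp
    also have "ennreal M + ennreal M = ennreal (2 * M)"
      using P.M_ge_1 by (simp add: ennreal_plus[symmetric] del: ennreal_plus)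
    finally show ?thesis by (simp add: mult.commute del: fun_upd_apply)
  qed
  have "(\<integral>\<^sup>+x. ennreal (min (p t x) (q t x)) * cond_gap t x \<partial>path_lebesgue t) \<le>
      (\<integral>\<^sup>+x. ?G x + ennreal (2 * M) * ennreal (?V x) \<partial>path_lebesgue t)"
    by (intro nn_integral_mono pointwise) simp
  also have "\<dots> = (\<integral>\<^sup>+x. ?G x \<partial>path_lebesgue t) + ennreal (2 * M) * l1_gap t"
    unfolding l1_gap_def using G_meas by (simp add: nn_integral_add nn_integral_cmult del: fun_upd_apply)
  also have "(\<integral>\<^sup>+x. ?G x \<partial>path_lebesgue t) = l1_gap (Suc t)"
    unfolding l1_gap_def using gap_meas
    by (subst nn_integral_path_lebesgue_Suc) auto
  finally show ?thesis .
qed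

lemma split_cost_Suc:
  assumes t: "t < T"
  shows "split_cost (Suc t) \<le> ennreal M * split_cost t + (l1_gap (Suc t) + ennreal (2 * M) * l1_gap t)"
proof -
  have T: "t \<le> T" using t by simp
  note [measurable_cong] = sets_joint_law[OF T]
  note [measurable] = cond_gap_measurable[OF t]
  have "split_cost (Suc t) = (\<integral>\<^sup>+w. \<integral>\<^sup>+ab. split_weight (Suc t) (extend t w ab) \<partial>step_kernel t w \<partial>joint_law t)"
    unfolding split_cost_def by (rule joint_law_step[OF t]) measurable
  also have "\<dots> \<le> (\<integral>\<^sup>+w. ennreal M * split_weight t w + of_bool (fst w = snd w) * cond_gap t (fst w) \<partial>joint_law t)"
    using space_joint_law[OF T] by (intro nn_integral_mono step_kernel_split[OF t]) auto
  also have "\<dots> = ennreal M * split_cost t + (\<integral>\<^sup>+w. of_bool (fst w = snd w) * cond_gap t (fst w) \<partial>joint_law t)"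
    unfolding split_cost_def by (simp add: nn_integral_add nn_integral_cmult)
  also have "(\<integral>\<^sup>+w. of_bool (fst w = snd w) * cond_gap t (fst w) \<partial>joint_law t) \<le>
      l1_gap (Suc t) + ennreal (2 * M) * l1_gap t"
    by (rule order_trans[OF diagonal_law_le[OF T cond_gap_measurable[OF t]] common_cond_gap_le[OF t]])
  finally show ?thesis by (simp add: add_left_mono)
qed

lemma split_cost_le: "t \<le> T \<Longrightarrow> split_cost t \<le> ennreal ((3 * M) ^ t) * (\<Sum>s\<le>t. l1_gap s)"
proof (induction t)
  case 0
  have "split_cost 0 = 0"
    unfolding split_cost_def
    by (simp, subst nn_integral_return) (auto simp: space_pair_measure space_path_space split_weight_def)
  then show ?case by simp
next
  case (Suc t)
  have M: "1 \<le> M" by (rule P.M_ge_1)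
  let ?S = "\<Sum>s\<le>t. l1_gap s" and ?c = "(3 * M) ^ t"
  have c: "1 \<le> ?c" using M by (intro one_le_power) simp
  have gap: "l1_gap t \<le> ?S" by (rule member_le_sum) auto
  have "split_cost (Suc t) \<le> ennreal M * split_cost t + (l1_gap (Suc t) + ennreal (2 * M) * l1_gap t)"
    using Suc.prems by (intro split_cost_Suc) simp
  also have "\<dots> \<le> ennreal M * (ennreal ?c * ?S) + (l1_gap (Suc t) + ennreal (2 * M) * ?S)"
    using Suc gap by (intro add_mono mult_left_mono) auto
  also have "\<dots> = ennreal (M * ?c + 2 * M) * ?S + l1_gap (Suc t)"
    using M c by (simp add: ennreal_mult distrib_right mult.assoc add_ac)
  also have "\<dots> \<le> ennreal ((3 * M) ^ Suc t) * ?S + ennreal ((3 * M) ^ Suc t) * l1_gap (Suc t)"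
  proof (intro add_mono mult_right_mono ennreal_leI)
    have "2 * M * 1 \<le> 2 * M * ?c" using M c by (intro mult_left_mono) auto
    then show "M * ?c + 2 * M \<le> (3 * M) ^ Suc t" by (simp add: mult_ac)
    have "1 \<le> (3 * M) ^ Suc t" using M by (intro one_le_power) simp
    then have "1 \<le> ennreal ((3 * M) ^ Suc t)" by (simp only: ennreal_ge_1)
    from mult_right_mono[OF this, of "l1_gap (Suc t)"]
    show "l1_gap (Suc t) \<le> ennreal ((3 * M) ^ Suc t) * l1_gap (Suc t)" by simp
  qed auto
  finally show ?case by (simp add: distrib_left)
qed

theorem adapted_wasserstein_le_l1_gap:
  "adapted_wasserstein T (P.law T) (Q.law T) \<le> ennreal ((3 * M) ^ T) * (\<Sum>s\<le>T. l1_gap s)"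
proof -
  have "adapted_wasserstein T (P.law T) (Q.law T) \<le>
      (\<integral>\<^sup>+(x, y). ennreal (path_norm T (\<lambda>t. x t - y t)) \<partial>joint_law T)"
    unfolding adapted_wasserstein_def by (rule INF_lower[OF joint_law_bicausal])
  also have "\<dots> \<le> split_cost T"
    unfolding split_cost_def
  proof (intro nn_integral_mono, clarify)
    fix x y :: "'d path"
    have "path_norm T (\<lambda>t. x t - y t) \<le> path_norm T x + path_norm T y"
      unfolding path_norm_def sum.distrib[symmetric] by (intro sum_mono norm_triangle_ineq4)
    also have "\<dots> \<le> path_weight T x + path_weight T y"
      by (intro add_mono path_norm_le_weight)
    finally show "ennreal (path_norm T (\<lambda>t. x t - y t)) \<le> split_weight T (x, y)"
      by (cases "x = y")
         (auto simp: split_weight_def path_norm_def ennreal_plus[symmetric] simp del: ennreal_plus intro: ennreal_leI)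
  qed
  also have "\<dots> \<le> ennreal ((3 * M) ^ T) * (\<Sum>s\<le>T. l1_gap s)"
    by (rule split_cost_le) simp
  finally show ?thesis .
qed

end

section \<open>Bounded differences\<close>

text \<open>
Integrating out one coordinate leaves a function of the others with the same bounded differences. Given
the other coordinates, the function stays within \<open>c\<close> of its conditional mean, so Hoeffding's lemma on an
interval of length \<open>2 * c\<close> yields the factor \<open>exp (l\<^sup>2 * c\<^sup>2 / 2)\<close> for each coordinate.
\<close>

lemma (in product_prob_space) nn_integral_exp_bounded_differences:
  fixes f :: "('i \<Rightarrow> 'a) \<Rightarrow> real"
  assumes "finite J" and "f \<in> borel_measurable (PiM J M)"
    and "\<And>x. x \<in> space (PiM J M) \<Longrightarrow> \<bar>f x\<bar> \<le> B"
    and "\<And>x i a. x \<in> space (PiM J M) \<Longrightarrow> i \<in> J \<Longrightarrow> a \<in> space (M i) \<Longrightarrow> \<bar>f (x(i := a)) - f x\<bar> \<le> c"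
    and "l > 0"
  shows "(\<integral>\<^sup>+x. exp (l * (f x - (\<integral>x. f x \<partial>PiM J M))) \<partial>PiM J M)
    \<le> ennreal (exp (l\<^sup>2 * c\<^sup>2 * card J / 2))"
  using assms(1-4)
proof (induction J arbitrary: f rule: finite_induct)
  case empty
  then show ?case
    by (simp add: PiM_empty lebesgue_integral_count_space_finite nn_integral_count_space_finite)
next
  case (insert i J)
  interpret J: finite_product_prob_space M J by standard (rule insert)
  interpret iJ: finite_product_prob_space M "insert i J" by standard (use insert in simp)
  have [measurable]: "f \<in> borel_measurable (PiM (insert i J) M)" by fact
  have upd: "x(i := y) \<in> space (PiM (insert i J) M)" if "x \<in> space (PiM J M)" "y \<in> space (M i)" for x y
    using that by (auto simp: space_PiM PiE_def extensional_def)
  define g where "g x = (\<integral>y. f (x(i := y)) \<partial>M i)" for x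
  have f_int: "integrable (PiM (insert i J) M) f"
    by (rule iJ.integrable_const_bound[where B=B]) (use insert.prems in auto)
  have fi_meas[measurable]: "(\<lambda>y. f (x(i := y))) \<in> borel_measurable (M i)" if "x \<in> space (PiM J M)" for x
    using that by measurable
  have fi_int: "integrable (M i) (\<lambda>y. f (x(i := y)))" if x: "x \<in> space (PiM J M)" for x
    by (rule M.integrable_const_bound[where B=B])
       (use insert.prems upd x in \<open>auto intro!: AE_I2\<close>)
  have g_meas[measurable]: "g \<in> borel_measurable (PiM J M)"
    unfolding g_def by measurable
  have g_bound: "\<bar>g x\<bar> \<le> B" if x: "x \<in> space (PiM J M)" for x
  proof -
    have "\<bar>g x\<bar> \<le> (\<integral>y. \<bar>f (x(i := y))\<bar> \<partial>M i)"
      unfolding g_def by (rule integral_abs_bound)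
    also have "\<dots> \<le> (\<integral>y. B \<partial>M i)"
      using insert.prems(2) upd x fi_int[OF x] by (intro integral_mono) auto
    finally show ?thesis by (simp add: M.prob_space)
  qed
  have g_diff: "\<bar>g (x(j := a)) - g x\<bar> \<le> c" if x: "x \<in> space (PiM J M)" "j \<in> J" "a \<in> space (M j)" for x j a
  proof -
    have ij: "i \<noteq> j" using that insert by auto
    have x': "x(j := a) \<in> space (PiM J M)"
      using that by (auto simp: space_PiM PiE_def extensional_def)
    have "g (x(j := a)) - g x = (\<integral>y. f (x(j := a, i := y)) - f (x(i := y)) \<partial>M i)"
      unfolding g_def using fi_int x' x by (subst Bochner_Integration.integral_diff) auto
    also have "\<bar>\<dots>\<bar> \<le> (\<integral>y. \<bar>f (x(j := a, i := y)) - f (x(i := y))\<bar> \<partial>M i)"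
      by (rule integral_abs_bound)
    also have "\<dots> \<le> (\<integral>y. c \<partial>M i)"
    proof (rule integral_mono)
      fix y assume y: "y \<in> space (M i)"
      show "\<bar>f (x(j := a, i := y)) - f (x(i := y))\<bar> \<le> c"
        unfolding fun_upd_twist[OF ij[symmetric]]
        by (rule insert.prems(3)[OF upd[OF x(1) y]]) (use x in auto)
    qed (use fi_int x' x in auto)
    finally show ?thesis by (simp add: M.prob_space)
  qed
  have inner: "(\<integral>\<^sup>+y. ennreal (exp (l * (f (x(i := y)) - g x))) \<partial>M i) \<le> ennreal (exp (l\<^sup>2 * c\<^sup>2 / 2))"
    if x: "x \<in> space (PiM J M)" for x
  proof -
    have near: "\<bar>f (x(i := y)) - g x\<bar> \<le> c" if y: "y \<in> space (M i)" for y
    proof -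
      have "f (x(i := y)) - g x = (\<integral>z. f (x(i := y)) - f (x(i := z)) \<partial>M i)"
        unfolding g_def using fi_int x by (subst Bochner_Integration.integral_diff) (auto simp: M.prob_space)
      also have "\<bar>\<dots>\<bar> \<le> (\<integral>z. \<bar>f (x(i := y)) - f (x(i := z))\<bar> \<partial>M i)"
        by (rule integral_abs_bound)
      also have "\<dots> \<le> (\<integral>z. c \<partial>M i)"
      proof (rule integral_mono)
        fix z assume z: "z \<in> space (M i)"
        show "\<bar>f (x(i := y)) - f (x(i := z))\<bar> \<le> c"
          using insert.prems(3)[OF upd[OF x z] insertI1 y] by (simp only: fun_upd_upd)
      qed (use fi_int x in auto)
      finally show ?thesis by (simp add: M.prob_space)
    qed
    interpret H: interval_bounded_random_variable "M i" "\<lambda>y. f (x(i := y))" "g x - c" "g x + c"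
      by unfold_locales (use x near in \<open>auto intro!: AE_I2 simp: abs_le_iff\<close>, force+)
    show ?thesis
      using H.Hoeffdings_lemma_nn_integral[OF assms(5)]
      by (simp add: g_def power2_eq_square algebra_simps)
  qed
  have E: "(\<integral>x. f x \<partial>PiM (insert i J) M) = (\<integral>x. g x \<partial>PiM J M)"
    unfolding g_def using insert.hyps f_int by (rule product_integral_insert)
  have "(\<integral>\<^sup>+x. exp (l * (f x - (\<integral>x. f x \<partial>PiM (insert i J) M))) \<partial>PiM (insert i J) M) =
    (\<integral>\<^sup>+x. \<integral>\<^sup>+y. exp (l * (f (x(i := y)) - (\<integral>x. g x \<partial>PiM J M))) \<partial>M i \<partial>PiM J M)"
    unfolding E by (rule product_nn_integral_insert) (use insert.hyps in auto)
  also have "\<dots> = (\<integral>\<^sup>+x. exp (l * (g x - (\<integral>x. g x \<partial>PiM J M))) *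
      (\<integral>\<^sup>+y. exp (l * (f (x(i := y)) - g x)) \<partial>M i) \<partial>PiM J M)"
    by (intro nn_integral_cong, subst nn_integral_cmult[symmetric])
       (auto simp: ennreal_mult[symmetric] exp_add[symmetric] algebra_simps)
  also have "\<dots> \<le> (\<integral>\<^sup>+x. exp (l * (g x - (\<integral>x. g x \<partial>PiM J M))) *
      ennreal (exp (l\<^sup>2 * c\<^sup>2 / 2)) \<partial>PiM J M)"
    by (intro nn_integral_mono mult_left_mono inner) auto
  also have "\<dots> = (\<integral>\<^sup>+x. exp (l * (g x - (\<integral>x. g x \<partial>PiM J M))) \<partial>PiM J M) *
      ennreal (exp (l\<^sup>2 * c\<^sup>2 / 2))"
    by (subst nn_integral_multc) auto
  also have "\<dots> \<le> ennreal (exp (l\<^sup>2 * c\<^sup>2 * card J / 2)) * ennreal (exp (l\<^sup>2 * c\<^sup>2 / 2))"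
    by (intro mult_right_mono insert.IH g_bound g_diff) auto
  also have "\<dots> = ennreal (exp (l\<^sup>2 * c\<^sup>2 * card (insert i J) / 2))"
    using insert.hyps by (simp add: ennreal_mult[symmetric] exp_add[symmetric] algebra_simps add_divide_distrib)
  finally show ?case .
qed

text \<open>
McDiarmid's inequality, with a constant in the exponent that is not optimal.
\<close>

lemma (in product_prob_space) bounded_differences_inequality:
  fixes f :: "('i \<Rightarrow> 'a) \<Rightarrow> real"
  assumes J: "finite J" "J \<noteq> {}" and f[measurable]: "f \<in> borel_measurable (PiM J M)"
    and bdd: "\<And>x. x \<in> space (PiM J M) \<Longrightarrow> \<bar>f x\<bar> \<le> B"
    and diff: "\<And>x i a. x \<in> space (PiM J M) \<Longrightarrow> i \<in> J \<Longrightarrow> a \<in> space (M i) \<Longrightarrow> \<bar>f (x(i := a)) - f x\<bar> \<le> c"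
    and pos: "c > 0" "\<epsilon> > 0"
  shows "emeasure (PiM J M) {x \<in> space (PiM J M). f x - (\<integral>x. f x \<partial>PiM J M) \<ge> \<epsilon>}
    \<le> ennreal (exp (- \<epsilon>\<^sup>2 / (2 * c\<^sup>2 * card J)))"
proof -
  interpret J: finite_product_prob_space M J by standard (rule J)
  define n where "n = real (card J)"
  have n: "n > 0" using J by (simp add: n_def card_gt_0_iff)
  \<comment> \<open>the minimiser of \<open>l\<^sup>2 * c\<^sup>2 * n / 2 - l * \<epsilon>\<close> in the exponential Markov bound\<close>
  define l where "l = \<epsilon> / (c\<^sup>2 * n)"
  have l: "l > 0" using pos n by (simp add: l_def)
  let ?g = "\<lambda>x. f x - (\<integral>x. f x \<partial>PiM J M)"
  have "emeasure (PiM J M) {x \<in> space (PiM J M). ?g x \<ge> \<epsilon>}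
      = (\<integral>\<^sup>+x. indicator {x \<in> space (PiM J M). ?g x \<ge> \<epsilon>} x \<partial>PiM J M)"
    by (rule nn_integral_indicator[symmetric]) measurable
  also have "\<dots> \<le> (\<integral>\<^sup>+x. ennreal (exp (- (l * \<epsilon>))) * ennreal (exp (l * ?g x)) \<partial>PiM J M)"
  proof (rule nn_integral_mono)
    fix x assume "x \<in> space (PiM J M)"
    show "indicator {x \<in> space (PiM J M). ?g x \<ge> \<epsilon>} x \<le> ennreal (exp (- (l * \<epsilon>))) * ennreal (exp (l * ?g x))"
    proof (cases "?g x \<ge> \<epsilon>")
      case True
      then have "0 \<le> - (l * \<epsilon>) + l * ?g x" using l by (simp add: mult_left_mono)
      then have "1 \<le> exp (- (l * \<epsilon>)) * exp (l * ?g x)"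
        unfolding exp_add[symmetric] by simp
      then show ?thesis by (auto simp: ennreal_mult[symmetric] split: split_indicator)
    qed simp
  qed
  also have "\<dots> = ennreal (exp (- (l * \<epsilon>))) * (\<integral>\<^sup>+x. ennreal (exp (l * ?g x)) \<partial>PiM J M)"
    by (rule nn_integral_cmult) measurable
  also have "\<dots> \<le> ennreal (exp (- (l * \<epsilon>))) * ennreal (exp (l\<^sup>2 * c\<^sup>2 * card J / 2))"
    by (intro mult_left_mono nn_integral_exp_bounded_differences[where B=B] J f bdd diff l) auto
  also have "\<dots> = ennreal (exp (- \<epsilon>\<^sup>2 / (2 * c\<^sup>2 * card J)))"
  proof -
    have "- (l * \<epsilon>) + l\<^sup>2 * c\<^sup>2 * n / 2 = - \<epsilon>\<^sup>2 / (2 * c\<^sup>2 * n)"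
      using pos n by (simp add: l_def field_simps power2_eq_square)
    then show ?thesis by (simp add: ennreal_mult[symmetric] exp_add[symmetric] n_def)
  qed
  finally show ?thesis .
qed

section \<open>Empirical averages in L1\<close>

lemma abs_sum_le_card:
  fixes f :: "'i \<Rightarrow> real" and b :: real
  assumes "\<And>n. n \<in> I \<Longrightarrow> \<bar>f n\<bar> \<le> b"
  shows "\<bar>sum f I\<bar> \<le> card I * b"
  by (rule order_trans[OF sum_abs sum_bounded_above]) (rule assms)

lemma (in prob_space) second_moment_iid_sum:
  fixes h :: "'a \<Rightarrow> real"
  assumes "finite J" and h[measurable]: "h \<in> borel_measurable M"
    and bdd: "\<And>a. a \<in> space M \<Longrightarrow> \<bar>h a\<bar> \<le> b"
    and zero: "(\<integral>a. h a \<partial>M) = 0"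
  shows "(\<integral>k. (\<Sum>n\<in>J. h (k n))\<^sup>2 \<partial>PiM J (\<lambda>_. M)) = card J * (\<integral>a. (h a)\<^sup>2 \<partial>M)"
  using assms(1)
proof (induction J rule: finite_induct)
  case empty
  then show ?case by (simp add: PiM_empty)
next
  case (insert i J)
  interpret P: product_prob_space "\<lambda>_. M" UNIV by standard
  interpret J: finite_product_prob_space "\<lambda>_. M" J by standard (rule insert)
  interpret iJ: finite_product_prob_space "\<lambda>_. M" "insert i J" by standard (use insert in simp)
  have sum_bound: "\<bar>\<Sum>n\<in>I. h (k n)\<bar> \<le> card I * b" if "k \<in> space (PiM I (\<lambda>_. M))" for k I
    using that by (intro abs_sum_le_card bdd) (auto simp: space_PiM)
  have sq_bound: "norm ((\<Sum>n\<in>I. h (k n))\<^sup>2) \<le> (card I * b)\<^sup>2" if "k \<in> space (PiM I (\<lambda>_. M))" for k I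
    using power_mono[OF sum_bound[OF that], of 2] by simp
  have int: "integrable (PiM (insert i J) (\<lambda>_. M)) (\<lambda>k. (\<Sum>n\<in>insert i J. h (k n))\<^sup>2)"
    by (rule iJ.integrable_const_bound) (use sq_bound in auto)
  have intJ: "integrable (PiM J (\<lambda>_. M)) (\<lambda>k. (\<Sum>n\<in>J. h (k n))\<^sup>2)"
    by (rule J.integrable_const_bound) (use sq_bound in auto)
  have h_int: "integrable M h"
    by (rule integrable_const_bound[where B=b]) (use bdd in auto)
  have h2_int: "integrable M (\<lambda>a. (h a)\<^sup>2)"
  proof (rule integrable_const_bound[where B="b\<^sup>2"])
    show "AE a in M. norm ((h a)\<^sup>2) \<le> b\<^sup>2"
      using power_mono[OF bdd, of _ 2] by (intro AE_I2) simp
  qed simp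
  have "(\<integral>k. (\<Sum>n\<in>insert i J. h (k n))\<^sup>2 \<partial>PiM (insert i J) (\<lambda>_. M)) =
      (\<integral>k. \<integral>y. (\<Sum>n\<in>insert i J. h ((k(i := y)) n))\<^sup>2 \<partial>M \<partial>PiM J (\<lambda>_. M))"
    by (rule P.product_integral_insert) (use insert.hyps int in auto)
  also have "\<dots> = (\<integral>k. \<integral>y. (h y)\<^sup>2 + 2 * (\<Sum>n\<in>J. h (k n)) * h y + (\<Sum>n\<in>J. h (k n))\<^sup>2 \<partial>M \<partial>PiM J (\<lambda>_. M))"
  proof (intro Bochner_Integration.integral_cong refl)
    fix k y
    have "(\<Sum>n\<in>J. h ((k(i := y)) n)) = (\<Sum>n\<in>J. h (k n))"
      using insert.hyps by (intro sum.cong) auto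
    then show "(\<Sum>n\<in>insert i J. h ((k(i := y)) n))\<^sup>2 =
        (h y)\<^sup>2 + 2 * (\<Sum>n\<in>J. h (k n)) * h y + (\<Sum>n\<in>J. h (k n))\<^sup>2"
      using insert.hyps by (simp add: power2_sum algebra_simps)
  qed
  also have "\<dots> = (\<integral>k. (\<integral>y. (h y)\<^sup>2 \<partial>M) + (\<Sum>n\<in>J. h (k n))\<^sup>2 \<partial>PiM J (\<lambda>_. M))"
    using h_int h2_int by (simp add: zero prob_space)
  also have "\<dots> = card (insert i J) * (\<integral>a. (h a)\<^sup>2 \<partial>M)"
    using intJ insert prob_space.prob_space[OF prob_space_PiM, of J "\<lambda>_. M"]
    by (simp add: prob_space_axioms algebra_simps)
  finally show ?case .
qed

lemma (in prob_space) mean_abs_iid_sum: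
  fixes h :: "'a \<Rightarrow> real"
  assumes J: "finite J" "J \<noteq> {}" and h[measurable]: "h \<in> borel_measurable M"
    and bdd: "\<And>a. a \<in> space M \<Longrightarrow> \<bar>h a\<bar> \<le> b"
    and zero: "(\<integral>a. h a \<partial>M) = 0"
  shows "(\<integral>\<^sup>+k. ennreal \<bar>\<Sum>n\<in>J. h (k n)\<bar> \<partial>PiM J (\<lambda>_. M)) \<le> ennreal (sqrt (card J) * b)"
proof -
  interpret P: product_prob_space "\<lambda>_. M" UNIV by standard
  interpret J: finite_product_prob_space "\<lambda>_. M" J by standard (rule J)
  have b: "b \<ge> 0" using bdd not_empty by fastforce
  let ?S = "\<lambda>k. \<Sum>n\<in>J. h (k n)"
  have S_bound: "\<bar>?S k\<bar> \<le> card J * b" if "k \<in> space (PiM J (\<lambda>_. M))" for k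
    using that by (intro abs_sum_le_card bdd) (auto simp: space_PiM)
  have int: "integrable (PiM J (\<lambda>_. M)) (\<lambda>k. \<bar>?S k\<bar>)"
    by (rule J.integrable_const_bound) (use S_bound in auto)
  have "norm ((?S k)\<^sup>2) \<le> (card J * b)\<^sup>2" if "k \<in> space (PiM J (\<lambda>_. M))" for k
    using power_mono[OF S_bound[OF that], of 2] by simp
  then have int2: "integrable (PiM J (\<lambda>_. M)) (\<lambda>k. (?S k)\<^sup>2)"
    by (intro J.integrable_const_bound) auto
  have "(\<integral>k. \<bar>?S k\<bar> \<partial>PiM J (\<lambda>_. M)) \<le> sqrt (\<integral>k. (?S k)\<^sup>2 \<partial>PiM J (\<lambda>_. M))"
  proof (rule real_le_rsqrt)
    show "(\<integral>k. \<bar>?S k\<bar> \<partial>PiM J (\<lambda>_. M))\<^sup>2 \<le> (\<integral>k. (?S k)\<^sup>2 \<partial>PiM J (\<lambda>_. M))"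
      using J.variance_eq[of "\<lambda>k. \<bar>?S k\<bar>"]
        J.variance_positive[of "\<lambda>k. \<bar>?S k\<bar>"] int int2 by simp
  qed
  also have "(\<integral>k. (?S k)\<^sup>2 \<partial>PiM J (\<lambda>_. M)) = card J * (\<integral>a. (h a)\<^sup>2 \<partial>M)"
    by (rule second_moment_iid_sum) (use assms in auto)
  also have "sqrt \<dots> \<le> sqrt (card J * b\<^sup>2)"
  proof -
    have sq: "(h a)\<^sup>2 \<le> b\<^sup>2" if "a \<in> space M" for a
      using power_mono[OF bdd[OF that], of 2] by simp
    have "(\<integral>a. (h a)\<^sup>2 \<partial>M) \<le> (\<integral>a. b\<^sup>2 \<partial>M)"
      by (intro integral_mono integrable_const_bound[where B="b\<^sup>2"]) (use sq in auto)
    then show ?thesis by (simp add: prob_space mult_left_mono)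
  qed
  also have "\<dots> = sqrt (card J) * b"
    using b by (simp add: real_sqrt_mult)
  finally have "(\<integral>k. \<bar>?S k\<bar> \<partial>PiM J (\<lambda>_. M)) \<le> sqrt (card J) * b" .
  then show ?thesis
    by (subst nn_integral_eq_integral) (use int in \<open>auto intro: ennreal_leI\<close>)
qed


text \<open>
A family of random variables \<open>\<psi> x\<close>, indexed by the points \<open>x\<close> of a measure space \<open>L\<close> and dominated by
an integrable function \<open>\<Phi>\<close> of the index. \<open>deviation J k\<close> is the \<open>L\<close>-integral of the distance between
the mean of \<open>\<psi> x\<close> and its average over the samples \<open>k n\<close>, \<open>n \<in> J\<close>.
\<close>

locale l1_deviation = prob_space M for M :: "'a measure" +
  fixes L :: "'x measure" and \<psi> :: "'x \<Rightarrow> 'a \<Rightarrow> real" and \<Phi> :: "'x \<Rightarrow> real"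
  assumes sigma_finite_L: "sigma_finite_measure L"
    and \<psi>_meas[measurable]: "case_prod \<psi> \<in> borel_measurable (L \<Otimes>\<^sub>M M)"
    and \<psi>_nonneg: "\<And>x a. 0 \<le> \<psi> x a"
    and \<psi>_le: "\<And>x a. \<psi> x a \<le> \<Phi> x"
    and \<Phi>_int: "integrable L \<Phi>"
begin

sublocale L: sigma_finite_measure L by (rule sigma_finite_L)

definition deviation :: "'i set \<Rightarrow> ('i \<Rightarrow> 'a) \<Rightarrow> real" where
  "deviation J k = (\<integral>x. \<bar>(\<integral>a. \<psi> x a \<partial>M) - (\<Sum>n\<in>J. \<psi> x (k n)) / card J\<bar> \<partial>L)"

lemma \<Phi>_nonneg: "0 \<le> \<Phi> x"
  using \<psi>_nonneg[of x] \<psi>_le[of x] order_trans by blast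

lemma \<psi>_int: "x \<in> space L \<Longrightarrow> integrable M (\<psi> x)"
  by (rule integrable_const_bound[where B="\<Phi> x"]) (auto simp: \<psi>_nonneg \<psi>_le)

lemma mean_bounds: "x \<in> space L \<Longrightarrow> 0 \<le> (\<integral>a. \<psi> x a \<partial>M)" "x \<in> space L \<Longrightarrow> (\<integral>a. \<psi> x a \<partial>M) \<le> \<Phi> x"
  using integral_mono[OF \<psi>_int integrable_const[of "\<Phi> x"], of x] \<psi>_le[of x]
  by (auto simp: \<psi>_nonneg prob_space intro!: integral_nonneg_AE)

lemma average_bounds:
  assumes "finite J" "J \<noteq> {}"
  shows "0 \<le> (\<Sum>n\<in>J. \<psi> x (k n)) / card J" "(\<Sum>n\<in>J. \<psi> x (k n)) / card J \<le> \<Phi> x"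
proof -
  have "(\<Sum>n\<in>J. \<psi> x (k n)) \<le> (\<Sum>n\<in>J. \<Phi> x)" by (intro sum_mono \<psi>_le)
  then show "(\<Sum>n\<in>J. \<psi> x (k n)) / card J \<le> \<Phi> x"
    using assms by (simp add: divide_le_eq card_gt_0_iff mult.commute)
qed (simp add: sum_nonneg \<psi>_nonneg)

context
  fixes J :: "'i set"
  assumes J: "finite J" "J \<noteq> {}"
begin

abbreviation absolute_error :: "('i \<Rightarrow> 'a) \<Rightarrow> 'x \<Rightarrow> real" where
  "absolute_error k x \<equiv> \<bar>(\<integral>a. \<psi> x a \<partial>M) - (\<Sum>n\<in>J. \<psi> x (k n)) / card J\<bar>"

lemma integrand_bound:
  "x \<in> space L \<Longrightarrow> absolute_error k x \<le> \<Phi> x"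
  using mean_bounds[of x] average_bounds[OF J, of x k] by (simp add: abs_le_iff)

lemma integrand_measurable[measurable]:
  assumes "k \<in> space (PiM J (\<lambda>_. M))"
  shows "(absolute_error k) \<in> borel_measurable L"
proof -
  have [measurable]: "(\<lambda>x. \<psi> x (k n)) \<in> borel_measurable L" if "n \<in> J" for n
  proof -
    have "k n \<in> space M" using assms that by (auto simp: space_PiM)
    then show ?thesis by measurable
  qed
  show ?thesis by measurable
qed

lemma integrand_integrable:
  assumes "k \<in> space (PiM J (\<lambda>_. M))"
  shows "integrable L (absolute_error k)"
  by (rule Bochner_Integration.integrable_bound[OF \<Phi>_int])
     (use integrand_bound[of _ k] integrand_measurable[OF assms] in \<open>auto simp: \<Phi>_nonneg\<close>)

lemma deviation_nonneg: "0 \<le> deviation J k"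
  by (simp add: deviation_def)

lemma deviation_bound:
  assumes "k \<in> space (PiM J (\<lambda>_. M))"
  shows "\<bar>deviation J k\<bar> \<le> (\<integral>x. \<Phi> x \<partial>L)"
  unfolding abs_of_nonneg[OF deviation_nonneg] unfolding deviation_def
  by (rule integral_mono[OF integrand_integrable[OF assms] \<Phi>_int integrand_bound])

lemma deviation_measurable[measurable]: "deviation J \<in> borel_measurable (PiM J (\<lambda>_. M))"
proof -
  have *: "(\<lambda>y. \<psi> (snd y) (fst y n)) \<in> borel_measurable (PiM J (\<lambda>_. M) \<Otimes>\<^sub>M L)" if "n \<in> J" for n
    using that by measurable
  note [measurable] = *
  show ?thesis unfolding deviation_def by measurable
qed

lemma deviation_diff:
  assumes k: "k \<in> space (PiM J (\<lambda>_. M))" and i: "i \<in> J" and a: "a \<in> space M"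
  shows "\<bar>deviation J (k(i := a)) - deviation J k\<bar> \<le> (\<integral>x. \<Phi> x \<partial>L) / card J"
proof -
  have k': "k(i := a) \<in> space (PiM J (\<lambda>_. M))"
    using k i a by (auto simp: space_PiM PiE_def extensional_def)
  let ?A = "\<lambda>k x. (\<integral>a. \<psi> x a \<partial>M) - (\<Sum>n\<in>J. \<psi> x (k n)) / card J"
  have "deviation J (k(i := a)) - deviation J k = (\<integral>x. \<bar>?A (k(i := a)) x\<bar> - \<bar>?A k x\<bar> \<partial>L)"
    unfolding deviation_def
    by (rule Bochner_Integration.integral_diff[OF integrand_integrable[OF k'] integrand_integrable[OF k], symmetric])
  also have "\<bar>\<dots>\<bar> \<le> (\<integral>x. \<bar>\<bar>?A (k(i := a)) x\<bar> - \<bar>?A k x\<bar>\<bar> \<partial>L)"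
    by (rule integral_abs_bound)
  also have "\<dots> \<le> (\<integral>x. \<Phi> x / card J \<partial>L)"
  proof (rule integral_mono)
    show "integrable L (\<lambda>x. \<bar>\<bar>?A (k(i := a)) x\<bar> - \<bar>?A k x\<bar>\<bar>)"
      by (rule integrable_abs[OF Bochner_Integration.integrable_diff[OF
            integrand_integrable[OF k'] integrand_integrable[OF k]]])
    show "integrable L (\<lambda>x. \<Phi> x / card J)" using \<Phi>_int by simp
    fix x assume x: "x \<in> space L"
    have split: "(\<Sum>n\<in>J. \<psi> x (f n)) = \<psi> x (f i) + (\<Sum>n\<in>J - {i}. \<psi> x (f n))" for f
      using J i by (simp add: sum.remove)
    have rest: "(\<Sum>n\<in>J - {i}. \<psi> x ((k(i := a)) n)) = (\<Sum>n\<in>J - {i}. \<psi> x (k n))"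
      by (intro sum.cong) auto
    have "\<bar>\<bar>?A (k(i := a)) x\<bar> - \<bar>?A k x\<bar>\<bar> \<le> \<bar>?A (k(i := a)) x - ?A k x\<bar>"
      by (rule abs_triangle_ineq3)
    also have "?A (k(i := a)) x - ?A k x = (\<psi> x (k i) - \<psi> x a) / card J"
      unfolding split[of k] split[of "k(i := a)"] rest by (simp add: diff_divide_distrib add_divide_distrib)
    also have "\<bar>\<dots>\<bar> \<le> \<Phi> x / card J"
      using \<psi>_nonneg[of x a] \<psi>_nonneg[of x "k i"] \<psi>_le[of x a] \<psi>_le[of x "k i"]
      by (simp add: abs_le_iff divide_right_mono)
    finally show "\<bar>\<bar>?A (k(i := a)) x\<bar> - \<bar>?A k x\<bar>\<bar> \<le> \<Phi> x / card J" .
  qed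
  finally show ?thesis by simp
qed

lemma deviation_mean:
  "(\<integral>\<^sup>+k. ennreal (deviation J k) \<partial>PiM J (\<lambda>_. M)) \<le> ennreal ((\<integral>x. \<Phi> x \<partial>L) / sqrt (card J))"
proof -
  interpret P: product_prob_space "\<lambda>_. M" UNIV by standard
  interpret J: finite_product_prob_space "\<lambda>_. M" J by standard (rule J)
  interpret PL: pair_sigma_finite "PiM J (\<lambda>_. M)" L ..
  have card: "real (card J) > 0" using J by (simp add: card_gt_0_iff)
  let ?A = absolute_error
  have *: "(\<lambda>y. \<psi> (snd y) (fst y n)) \<in> borel_measurable (PiM J (\<lambda>_. M) \<Otimes>\<^sub>M L)" if "n \<in> J" for n
    using that by measurable
  note [measurable] = *
  have [measurable]: "(\<lambda>(k, x). ennreal (?A k x)) \<in> borel_measurable (PiM J (\<lambda>_. M) \<Otimes>\<^sub>M L)"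
    by measurable
  have "(\<integral>\<^sup>+k. ennreal (deviation J k) \<partial>PiM J (\<lambda>_. M)) = (\<integral>\<^sup>+k. \<integral>\<^sup>+x. ennreal (?A k x) \<partial>L \<partial>PiM J (\<lambda>_. M))"
    unfolding deviation_def
    by (intro nn_integral_cong nn_integral_eq_integral[symmetric] integrand_integrable) auto
  also have "\<dots> = (\<integral>\<^sup>+x. \<integral>\<^sup>+k. ennreal (?A k x) \<partial>PiM J (\<lambda>_. M) \<partial>L)"
    by (rule PL.Fubini'[symmetric]) measurable
  also have "\<dots> \<le> (\<integral>\<^sup>+x. ennreal (\<Phi> x / sqrt (card J)) \<partial>L)"
  proof (rule nn_integral_mono)
    fix x assume x: "x \<in> space L"
    define h where "h a = (\<integral>a. \<psi> x a \<partial>M) - \<psi> x a" for a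
    have [measurable]: "h \<in> borel_measurable M" unfolding h_def using x by measurable
    have hb: "\<bar>h a\<bar> \<le> \<Phi> x" for a
      using mean_bounds[OF x] \<psi>_nonneg[of x a] \<psi>_le[of x a] by (simp add: h_def abs_le_iff)
    have h0: "(\<integral>a. h a \<partial>M) = 0"
      unfolding h_def using \<psi>_int[OF x] by (simp add: prob_space)
    have A: "?A k x = \<bar>\<Sum>n\<in>J. h (k n)\<bar> / card J" for k
    proof -
      have "(\<integral>a. \<psi> x a \<partial>M) - (\<Sum>n\<in>J. \<psi> x (k n)) / card J = (\<Sum>n\<in>J. h (k n)) / card J"
        using card by (simp add: h_def sum_subtractf diff_divide_distrib)
      then show ?thesis by simp
    qed
    have "(\<integral>\<^sup>+k. ennreal (?A k x) \<partial>PiM J (\<lambda>_. M)) =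
        (\<integral>\<^sup>+k. ennreal \<bar>\<Sum>n\<in>J. h (k n)\<bar> \<partial>PiM J (\<lambda>_. M)) / ennreal (card J)"
      unfolding A using card
      by (subst nn_integral_divide[symmetric]) (auto simp: divide_ennreal)
    also have "\<dots> \<le> ennreal (sqrt (card J) * \<Phi> x) / ennreal (card J)"
      by (intro divide_right_mono_ennreal mean_abs_iid_sum J hb h0) auto
    also have "\<dots> = ennreal (\<Phi> x / sqrt (card J))"
      using card by (simp add: divide_ennreal \<Phi>_nonneg real_div_sqrt field_simps)
    finally show "(\<integral>\<^sup>+k. ennreal (?A k x) \<partial>PiM J (\<lambda>_. M)) \<le> ennreal (\<Phi> x / sqrt (card J))" .
  qed
  also have "\<dots> = ennreal ((\<integral>x. \<Phi> x \<partial>L) / sqrt (card J))"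
    using \<Phi>_int by (subst nn_integral_eq_integral) (auto simp: \<Phi>_nonneg)
  finally show ?thesis .
qed

end

end

section \<open>Gaussian densities and their envelope\<close>

lemma nn_integral_lborel_vec_prod:
  fixes f :: "real \<Rightarrow> ennreal"
  assumes [measurable]: "f \<in> borel_measurable borel"
  shows "(\<integral>\<^sup>+v. (\<Prod>i\<in>UNIV. f (v $ i)) \<partial>(lborel :: (real ^ 'd::finite) measure)) =
    (\<integral>\<^sup>+a. f a \<partial>lborel) ^ CARD('d)"
proof -
  have bij: "bij_betw (\<lambda>i. axis i (1::real)) UNIV (Basis :: (real ^ 'd) set)"
    by (auto simp: bij_betw_def inj_on_def axis_eq_axis Basis_vec_def)
  have "(\<Prod>i\<in>UNIV. f (v $ i)) = (\<Prod>b\<in>Basis. f (v \<bullet> b))" for v :: "real ^ 'd"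
    using prod.reindex_bij_betw[OF bij, of "\<lambda>b. f (v \<bullet> b)"] by (simp add: inner_axis)
  then have "(\<integral>\<^sup>+v. (\<Prod>i\<in>UNIV. f (v $ i)) \<partial>(lborel :: (real ^ 'd) measure)) =
      (\<integral>\<^sup>+v. (\<Prod>b\<in>Basis. f (v \<bullet> b)) \<partial>(lborel :: (real ^ 'd) measure))"
    by simp
  also have "\<dots> = (\<Prod>b\<in>(Basis :: (real ^ 'd) set). \<integral>\<^sup>+a. f a \<partial>lborel)"
    by (rule nn_integral_lborel_prod) auto
  finally show ?thesis by simp
qed

lemma nn_integral_lborel_translate:
  fixes f :: "'a::euclidean_space \<Rightarrow> ennreal"
  assumes "f \<in> borel_measurable borel"
  shows "(\<integral>\<^sup>+v. f (v - c) \<partial>lborel) = (\<integral>\<^sup>+v. f v \<partial>lborel)"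
proof -
  have "(\<integral>\<^sup>+v. f v \<partial>lborel) = (\<integral>\<^sup>+v. f v \<partial>distr lborel borel ((+) (- c)))"
    by (simp add: lborel_distr_plus)
  also have "\<dots> = (\<integral>\<^sup>+v. f (v - c) \<partial>lborel)"
    using assms by (subst nn_integral_distr) auto
  finally show ?thesis by simp
qed

lemma nn_integral_path_lebesgue_prod:
  fixes f :: "real ^ 'd::finite \<Rightarrow> ennreal"
  assumes "f \<in> borel_measurable borel"
  shows "(\<integral>\<^sup>+x. (\<Prod>s = 1..t. f (x s)) \<partial>path_lebesgue t) = (\<integral>\<^sup>+v. f v \<partial>lborel) ^ t"
proof -
  interpret product_sigma_finite "\<lambda>_::nat. lborel :: (real ^ 'd) measure" by standard
  show ?thesis
    unfolding path_lebesgue_def using assms by (subst product_nn_integral_prod) auto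
qed

lemma distr_path_lebesgue_translate:
  "distr (path_lebesgue t) (path_lebesgue t) (\<lambda>z. \<lambda>s\<in>{1..t}. k s + z s) =
    (path_lebesgue t :: ('d::finite) path measure)"
proof -
  interpret product_sigma_finite "\<lambda>_::nat. lborel :: (real ^ 'd) measure" by standard
  let ?P = "PiM {1..t} (\<lambda>_. lborel :: (real ^ 'd) measure)"
  let ?f = "\<lambda>z. \<lambda>s\<in>{1..t}. k s + z s"
  have f: "?f \<in> ?P \<rightarrow>\<^sub>M ?P"
  proof (rule measurable_restrict)
    fix s assume s: "s \<in> {1..t}"
    have "(\<lambda>z. z s) \<in> ?P \<rightarrow>\<^sub>M borel" using measurable_component_singleton[OF s, of "\<lambda>_. lborel"] by simp
    then show "(\<lambda>z. k s + z s) \<in> ?P \<rightarrow>\<^sub>M lborel" by simp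
  qed
  have "distr ?P ?P ?f = ?P"
  proof (rule PiM_eqI)
    fix A :: "nat \<Rightarrow> (real ^ 'd) set" assume A: "\<And>i. i \<in> {1..t} \<Longrightarrow> A i \<in> sets lborel"
    let ?B = "\<lambda>i. (\<lambda>v. k i + v) -` A i"
    have B: "?B i \<in> sets borel" if "i \<in> {1..t}" for i
      using measurable_sets[of "\<lambda>v. k i + v" borel borel "A i"] A[OF that] by simp
    have "?f -` Pi\<^sub>E {1..t} A \<inter> space ?P = Pi\<^sub>E {1..t} ?B"
      by (auto simp: space_PiM PiE_iff extensional_def)
    then have "emeasure (distr ?P ?P ?f) (Pi\<^sub>E {1..t} A) = emeasure ?P (Pi\<^sub>E {1..t} ?B)"
      using A f by (subst emeasure_distr) (auto intro!: sets_PiM_I_finite)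
    also have "\<dots> = (\<Prod>i\<in>{1..t}. emeasure lborel (?B i))"
      using B by (intro emeasure_PiM) auto
    also have "\<dots> = (\<Prod>i\<in>{1..t}. emeasure lborel (A i))"
    proof (rule prod.cong[OF refl])
      fix i assume "i \<in> {1..t}"
      then have "emeasure lborel (A i) = emeasure (distr lborel borel ((+) (k i))) (A i)"
        by (simp add: lborel_distr_plus)
      also have "\<dots> = emeasure lborel (?B i)"
        using A[OF \<open>i \<in> {1..t}\<close>] by (subst emeasure_distr) auto
      finally show "emeasure lborel (?B i) = emeasure lborel (A i)" by simp
    qed
    finally show "emeasure (distr ?P ?P ?f) (Pi\<^sub>E {1..t} A) = (\<Prod>i\<in>{1..t}. emeasure lborel (A i))" .
  qed simp_all
  then show ?thesis by (simp add: path_lebesgue_def)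
qed

text \<open>
The density of the centred Gaussian law with covariance \<open>\<sigma>\<^sup>2\<close> times the identity.
\<close>

definition gauss :: "real \<Rightarrow> real ^ 'd::finite \<Rightarrow> real" where
  "gauss \<sigma> v = (\<Prod>i\<in>UNIV. normal_density 0 \<sigma> (v $ i))"

lemma gauss_measurable[measurable]: "gauss \<sigma> \<in> borel_measurable borel"
  unfolding gauss_def[abs_def] by measurable

lemma gauss_pos: "0 < \<sigma> \<Longrightarrow> 0 < gauss \<sigma> v"
  unfolding gauss_def by (intro prod_pos ballI normal_density_pos)

lemma gauss_nonneg: "0 \<le> gauss \<sigma> v"
  unfolding gauss_def by (intro prod_nonneg) simp

lemma nn_integral_gauss:
  assumes "0 < \<sigma>"
  shows "(\<integral>\<^sup>+v. ennreal (gauss \<sigma> (v - c)) \<partial>lborel) = 1"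
proof -
  have "(\<integral>\<^sup>+a. ennreal (normal_density 0 \<sigma> a) \<partial>lborel) = 1"
    using assms by (subst nn_integral_eq_integral) auto
  then show ?thesis
    using nn_integral_lborel_vec_prod[of "\<lambda>a. ennreal (normal_density 0 \<sigma> a)"]
    by (subst nn_integral_lborel_translate) (auto simp: gauss_def prod_ennreal)
qed

text \<open>
A multiple of the Gaussian density of variance \<open>2 * \<sigma>\<^sup>2\<close> that dominates all densities
\<open>gauss \<sigma> (v - k)\<close> with \<open>norm k \<le> R\<close>.
\<close>

definition envelope :: "real \<Rightarrow> real \<Rightarrow> real ^ 'd::finite \<Rightarrow> real" where
  "envelope \<sigma> R v = (\<Prod>i\<in>UNIV. sqrt 2 * exp (R\<^sup>2 / (2 * \<sigma>\<^sup>2)) * normal_density 0 (sqrt 2 * \<sigma>) (v $ i))"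

lemma envelope_measurable[measurable]: "envelope \<sigma> R \<in> borel_measurable borel"
  unfolding envelope_def[abs_def] by measurable

lemma envelope_nonneg: "0 \<le> envelope \<sigma> R v"
  unfolding envelope_def by (intro prod_nonneg) simp

lemma normal_density_translate_le:
  assumes \<sigma>: "0 < \<sigma>" and b: "\<bar>b\<bar> \<le> R"
  shows "normal_density 0 \<sigma> (a - b) \<le> sqrt 2 * exp (R\<^sup>2 / (2 * \<sigma>\<^sup>2)) * normal_density 0 (sqrt 2 * \<sigma>) a"
proof -
  have b2: "b\<^sup>2 \<le> R\<^sup>2" using b by (metis abs_ge_zero power2_abs power_mono)
  \<comment> \<open>the square gives \<open>(a - b)\<^sup>2 \<ge> a\<^sup>2 / 2 - b\<^sup>2\<close>, at the price of doubling the variance\<close>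
  have "0 \<le> (a - 2 * b)\<^sup>2" by simp
  then have "a\<^sup>2 \<le> 2 * (a - b)\<^sup>2 + 2 * b\<^sup>2" by (simp add: power2_eq_square algebra_simps)
  then have "- (a - b)\<^sup>2 \<le> R\<^sup>2 - a\<^sup>2 / 2" using b2 by simp
  then have "- (a - b)\<^sup>2 / (2 * \<sigma>\<^sup>2) \<le> (R\<^sup>2 - a\<^sup>2 / 2) / (2 * \<sigma>\<^sup>2)"
    using \<sigma> by (intro divide_right_mono) auto
  also have "\<dots> = R\<^sup>2 / (2 * \<sigma>\<^sup>2) + - a\<^sup>2 / (2 * (sqrt 2 * \<sigma>)\<^sup>2)"
    by (simp add: diff_divide_distrib power_mult_distrib)
  finally have "exp (- (a - b)\<^sup>2 / (2 * \<sigma>\<^sup>2)) \<le>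
      exp (R\<^sup>2 / (2 * \<sigma>\<^sup>2)) * exp (- a\<^sup>2 / (2 * (sqrt 2 * \<sigma>)\<^sup>2))"
    by (simp add: exp_add[symmetric])
  then have "1 / sqrt (2 * pi * \<sigma>\<^sup>2) * exp (- (a - b)\<^sup>2 / (2 * \<sigma>\<^sup>2)) \<le>
      1 / sqrt (2 * pi * \<sigma>\<^sup>2) * (exp (R\<^sup>2 / (2 * \<sigma>\<^sup>2)) * exp (- a\<^sup>2 / (2 * (sqrt 2 * \<sigma>)\<^sup>2)))"
    by (intro mult_left_mono) auto
  also have "\<dots> = sqrt 2 * exp (R\<^sup>2 / (2 * \<sigma>\<^sup>2)) *
        (1 / sqrt (2 * pi * (sqrt 2 * \<sigma>)\<^sup>2) * exp (- a\<^sup>2 / (2 * (sqrt 2 * \<sigma>)\<^sup>2)))"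
  proof -
    have eq: "1 / sqrt (2 * pi * \<sigma>\<^sup>2) = sqrt 2 * (1 / sqrt (2 * pi * (sqrt 2 * \<sigma>)\<^sup>2))"
      using \<sigma> by (simp add: power_mult_distrib real_sqrt_mult field_simps)
    show ?thesis by (subst eq) (simp only: mult_ac)
  qed
  finally show ?thesis by (simp only: normal_density_def diff_zero)
qed

lemma gauss_le_envelope:
  assumes "0 < \<sigma>" "norm k \<le> R"
  shows "gauss \<sigma> (v - k) \<le> envelope \<sigma> R v"
  unfolding gauss_def envelope_def
proof (rule prod_mono, intro conjI)
  fix i
  have "\<bar>k $ i\<bar> \<le> R" using component_le_norm_cart[of k i] assms(2) by linarith
  from normal_density_translate_le[OF assms(1) this, of "v $ i"]
  show "normal_density 0 \<sigma> ((v - k) $ i) \<le>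
      sqrt 2 * exp (R\<^sup>2 / (2 * \<sigma>\<^sup>2)) * normal_density 0 (sqrt 2 * \<sigma>) (v $ i)" by simp
qed simp

lemma one_plus_norm_le_prod:
  fixes v :: "real ^ 'd::finite"
  shows "1 + norm v \<le> (\<Prod>i\<in>UNIV. 1 + \<bar>v $ i\<bar>)"
proof -
  have "1 + (\<Sum>i\<in>I. \<bar>v $ i\<bar>) \<le> (\<Prod>i\<in>I. 1 + \<bar>v $ i\<bar>)" if "finite I" for I
    using that
  proof (induction I rule: finite_induct)
    case (insert i I)
    have "1 + (\<bar>v $ i\<bar> + (\<Sum>i\<in>I. \<bar>v $ i\<bar>)) \<le> (1 + \<bar>v $ i\<bar>) * (1 + (\<Sum>i\<in>I. \<bar>v $ i\<bar>))"
      by (simp add: algebra_simps sum_nonneg)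
    also have "\<dots> \<le> (1 + \<bar>v $ i\<bar>) * (\<Prod>i\<in>I. 1 + \<bar>v $ i\<bar>)"
      by (intro mult_left_mono insert) simp
    finally show ?case using insert by simp
  qed simp
  from this[of UNIV] show ?thesis using norm_le_l1_cart[of v] by simp
qed

text \<open>
The integral of the envelope against \<open>1 + norm v\<close>. The first argument fixes the dimension only.
\<close>

definition envelope_moment :: "'d::finite itself \<Rightarrow> real \<Rightarrow> real \<Rightarrow> ennreal" where
  "envelope_moment _ \<sigma> R = (\<integral>\<^sup>+v. ennreal (envelope \<sigma> R (v :: real ^ 'd) * (1 + norm v)) \<partial>lborel)"

lemma envelope_moment_finite:
  assumes "0 < \<sigma>"
  shows "envelope_moment TYPE('d::finite) \<sigma> R < \<infinity>"
proof -
  let ?c = "sqrt 2 * exp (R\<^sup>2 / (2 * \<sigma>\<^sup>2))" and ?n = "normal_density 0 (sqrt 2 * \<sigma>)"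
  let ?f = "\<lambda>a. ?c * (?n a + ?n a * \<bar>a\<bar>)"
  have s: "0 < sqrt 2 * \<sigma>" using assms by simp
  have "integrable lborel ?f"
    using integrable_normal_moment_abs[OF s, of 0 1] integrable_normal_density[OF s, of 0]
    by (intro integrable_mult_right Bochner_Integration.integrable_add) auto
  then have fin: "(\<integral>\<^sup>+a. ennreal (?f a) \<partial>lborel) < \<infinity>"
    by (subst nn_integral_eq_integral) auto
  have "envelope_moment TYPE('d) \<sigma> R \<le> (\<integral>\<^sup>+v. (\<Prod>i\<in>UNIV. ennreal (?f (v $ i))) \<partial>(lborel :: (real ^ 'd) measure))"
    unfolding envelope_moment_def
  proof (intro nn_integral_mono)
    fix v :: "real ^ 'd"
    have "envelope \<sigma> R v * (1 + norm v) \<le> envelope \<sigma> R v * (\<Prod>i\<in>UNIV. 1 + \<bar>v $ i\<bar>)"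
      by (intro mult_left_mono one_plus_norm_le_prod envelope_nonneg)
    also have "\<dots> = (\<Prod>i\<in>UNIV. ?f (v $ i))"
      unfolding envelope_def prod.distrib[symmetric] by (intro prod.cong) (auto simp: algebra_simps)
    finally have "ennreal (envelope \<sigma> R v * (1 + norm v)) \<le> ennreal (\<Prod>i\<in>UNIV. ?f (v $ i))"
      by (rule ennreal_leI)
    also have "\<dots> = (\<Prod>i\<in>UNIV. ennreal (?f (v $ i)))" by (subst prod_ennreal) auto
    finally show "ennreal (envelope \<sigma> R v * (1 + norm v)) \<le> (\<Prod>i\<in>UNIV. ennreal (?f (v $ i)))" .
  qed
  also have "\<dots> = (\<integral>\<^sup>+a. ennreal (?f a) \<partial>lborel) ^ CARD('d)"
    by (rule nn_integral_lborel_vec_prod) measurable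
  also have "\<dots> < \<infinity>" using fin by (simp add: power_less_top_ennreal)
  finally show ?thesis .
qed

lemma envelope_moment_ge_1:
  assumes "0 < \<sigma>" "0 \<le> R"
  shows "1 \<le> envelope_moment TYPE('d::finite) \<sigma> R"
proof -
  have "(1::ennreal) = (\<integral>\<^sup>+v. ennreal (gauss \<sigma> (v - 0 :: real ^ 'd)) \<partial>lborel)"
    by (rule nn_integral_gauss[OF assms(1), symmetric])
  also have "\<dots> \<le> envelope_moment TYPE('d) \<sigma> R"
    unfolding envelope_moment_def
  proof (intro nn_integral_mono ennreal_leI)
    fix v :: "real ^ 'd"
    have "gauss \<sigma> (v - 0) \<le> envelope \<sigma> R v * 1"
      using gauss_le_envelope[OF assms(1), of 0 R v] assms(2) by simp
    also have "\<dots> \<le> envelope \<sigma> R v * (1 + norm v)"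
      by (intro mult_left_mono envelope_nonneg) simp
    finally show "gauss \<sigma> (v - 0) \<le> envelope \<sigma> R v * (1 + norm v)" .
  qed
  finally show ?thesis .
qed

lemma gauss_moment_le:
  fixes k :: "real ^ 'd::finite"
  assumes "0 < \<sigma>" "norm k \<le> R"
  shows "(\<integral>\<^sup>+v. ennreal (gauss \<sigma> (v - k) * (1 + norm v)) \<partial>lborel) \<le> envelope_moment TYPE('d) \<sigma> R"
  unfolding envelope_moment_def
  by (intro nn_integral_mono ennreal_leI mult_right_mono gauss_le_envelope assms) auto

section \<open>Gaussian smoothing of compactly supported measures\<close>

text \<open>
The paths all of whose points have norm at most \<open>R\<close>.
\<close>

definition path_ball :: "nat \<Rightarrow> real \<Rightarrow> ('d::finite) path set" where
  "path_ball T R = {k \<in> space (path_space T). \<forall>s\<in>{1..T}. norm (k s) \<le> R}"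

lemma path_ball_sets[measurable]: "(path_ball T R :: ('d::finite) path set) \<in> sets (path_space T)"
  unfolding path_ball_def
proof (rule sets.sets_Collect_finite_All)
  fix s assume "s \<in> {1..T}"
  then have [measurable]: "(\<lambda>x. x s) \<in> path_space T \<rightarrow>\<^sub>M (borel :: (real ^ 'd) measure)"
    by (rule component_path_measurable)
  show "{k \<in> space (path_space T). norm (k s :: real ^ 'd) \<le> R} \<in> sets (path_space T)" by measurable
qed simp

text \<open>
The real number \<open>J\<close> is the (finite) value of \<^const>\<open>envelope_moment\<close>. The parameter \<open>d_type\<close> serves
only to fix the dimension.
\<close>

locale gaussian_smoothing =
  fixes T :: nat and \<sigma> R :: real and J :: real and d_type :: "'d::finite itself"
  assumes \<sigma>: "0 < \<sigma>" and R: "0 \<le> R"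
    and J: "ennreal J = envelope_moment TYPE('d) \<sigma> R"
begin

text \<open>
The density of the first \<open>t\<close> points of \<open>k\<close> plus Gaussian noise. It is set to \<open>0\<close> for \<open>k\<close> outside the
ball; this is a null set for the measures considered, and it makes the domination by
\<open>noise_envelope\<close>, the product of the envelopes of the single points, hold without exception.
\<close>

definition noise_density :: "nat \<Rightarrow> 'd path \<Rightarrow> 'd path \<Rightarrow> real" where
  "noise_density t x k = indicator (path_ball T R) k * (\<Prod>s = 1..t. gauss \<sigma> (x s - k s))"

definition noise_envelope :: "nat \<Rightarrow> 'd path \<Rightarrow> real" where
  "noise_envelope t x = (\<Prod>s = 1..t. envelope \<sigma> R (x s))"

lemma J_ge_1: "1 \<le> J"
  using envelope_moment_ge_1[OF \<sigma> R, where 'd='d] J by (metis ennreal_ge_1)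

lemma noise_density_nonneg: "0 \<le> noise_density t x k"
  unfolding noise_density_def by (intro mult_nonneg_nonneg prod_nonneg) (auto simp: gauss_nonneg)

lemma noise_density_pos: "k \<in> path_ball T R \<Longrightarrow> 0 < noise_density t x k"
  unfolding noise_density_def by (simp add: prod_pos gauss_pos \<sigma>)

lemma noise_envelope_nonneg: "0 \<le> noise_envelope t x"
  unfolding noise_envelope_def by (intro prod_nonneg) (auto simp: envelope_nonneg)

lemma noise_density_le: "t \<le> T \<Longrightarrow> noise_density t x k \<le> noise_envelope t x"
proof (cases "k \<in> path_ball T R")
  case True
  assume "t \<le> T"
  with True show ?thesis
    unfolding noise_density_def noise_envelope_def
    by (auto intro!: prod_mono gauss_le_envelope \<sigma> simp: gauss_nonneg path_ball_def)
next
  case False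
  then show ?thesis by (simp add: noise_density_def noise_envelope_nonneg)
qed

lemma noise_density_Suc:
  "noise_density (Suc t) (x(Suc t := a)) k = noise_density t x k * gauss \<sigma> (a - k (Suc t))"
  unfolding noise_density_def by (simp add: atLeastAtMostSuc_conv)

lemma noise_density_measurable:
  assumes t: "t \<le> T"
  shows "(\<lambda>(x, k). noise_density t x k) \<in> borel_measurable (path_space t \<Otimes>\<^sub>M path_space T)"
proof -
  have c: "(\<lambda>y. gauss \<sigma> (fst y s - snd y s)) \<in> borel_measurable (path_space t \<Otimes>\<^sub>M (path_space T :: 'd path measure))"
    if s: "s \<in> {1..t}" for s
  proof -
    have "(\<lambda>x. x s) \<in> path_space t \<rightarrow>\<^sub>M (borel :: (real ^ 'd) measure)"
      "(\<lambda>x. x s) \<in> path_space T \<rightarrow>\<^sub>M (borel :: (real ^ 'd) measure)"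
      using s t by (auto intro!: component_path_measurable)
    note [measurable] = measurable_compose[OF measurable_fst this(1), of "path_space T"]
      measurable_compose[OF measurable_snd this(2), of "path_space t"]
    show ?thesis by measurable
  qed
  show ?thesis
    unfolding noise_density_def case_prod_unfold
    by (intro borel_measurable_times borel_measurable_prod c
        measurable_compose[OF measurable_snd borel_measurable_indicator[OF path_ball_sets]])
qed

lemma noise_envelope_measurable: "noise_envelope t \<in> borel_measurable (path_space t)"
  unfolding noise_envelope_def[abs_def]
  by (intro borel_measurable_prod measurable_compose[OF component_path_measurable envelope_measurable])

lemma nn_integral_noise_envelope:
  "(\<integral>\<^sup>+x. ennreal (noise_envelope t x * path_weight t x) \<partial>path_lebesgue t) = ennreal (J ^ t)"
proof -
  have "(\<integral>\<^sup>+x. ennreal (noise_envelope t x * path_weight t x) \<partial>path_lebesgue t) =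
      (\<integral>\<^sup>+x. (\<Prod>s = 1..t. ennreal (envelope \<sigma> R (x s) * (1 + norm (x s)))) \<partial>(path_lebesgue t :: 'd path measure))"
    by (intro nn_integral_cong)
       (simp add: noise_envelope_def path_weight_def prod.distrib[symmetric] prod_ennreal envelope_nonneg)
  also have "\<dots> = ennreal J ^ t"
    unfolding J envelope_moment_def by (rule nn_integral_path_lebesgue_prod) measurable
  finally show ?thesis using J_ge_1 by (simp add: ennreal_power)
qed

lemma nn_integral_noise_step:
  "(\<integral>\<^sup>+a. ennreal (noise_density (Suc t) (x(Suc t := a)) k) \<partial>lborel) = ennreal (noise_density t x k)"
proof -
  have "(\<integral>\<^sup>+a. ennreal (noise_density (Suc t) (x(Suc t := a)) k) \<partial>lborel) =
      (\<integral>\<^sup>+a. ennreal (noise_density t x k) * ennreal (gauss \<sigma> (a - k (Suc t))) \<partial>lborel)"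
    unfolding noise_density_Suc
    by (intro nn_integral_cong ennreal_mult) (auto simp: noise_density_nonneg gauss_nonneg)
  also have "\<dots> = ennreal (noise_density t x k)"
    by (subst nn_integral_cmult) (auto simp: nn_integral_gauss \<sigma>)
  finally show ?thesis .
qed

lemma nn_integral_noise_moment:
  assumes "t < T"
  shows "(\<integral>\<^sup>+a. ennreal (noise_density (Suc t) (x(Suc t := a)) k * (1 + norm a)) \<partial>lborel)
    \<le> ennreal J * ennreal (noise_density t x k)"
proof (cases "k \<in> path_ball T R")
  case True
  then have k: "norm (k (Suc t)) \<le> R" using assms by (auto simp: path_ball_def)
  have "(\<integral>\<^sup>+a. ennreal (noise_density (Suc t) (x(Suc t := a)) k * (1 + norm a)) \<partial>lborel) =
      (\<integral>\<^sup>+a. ennreal (noise_density t x k) * ennreal (gauss \<sigma> (a - k (Suc t)) * (1 + norm a)) \<partial>lborel)"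
    unfolding noise_density_Suc mult.assoc
    by (intro nn_integral_cong ennreal_mult mult_nonneg_nonneg) (auto simp: noise_density_nonneg gauss_nonneg)
  also have "\<dots> = ennreal (noise_density t x k) * (\<integral>\<^sup>+a. ennreal (gauss \<sigma> (a - k (Suc t)) * (1 + norm a)) \<partial>lborel)"
    by (rule nn_integral_cmult) measurable
  also have "\<dots> \<le> ennreal (noise_density t x k) * ennreal J"
    unfolding J by (intro mult_left_mono gauss_moment_le \<sigma> k) simp
  finally show ?thesis by (simp add: mult.commute)
qed (simp add: noise_density_def)

end

text \<open>
A probability measure \<open>\<nu>\<close> on the ball. Its convolution with the Gaussian noise has the densities
\<open>smooth_density t\<close>, mixtures over \<open>\<nu>\<close> of the densities above.
\<close>

locale smoothed_measure = gaussian_smoothing T \<sigma> R J d_type + \<nu>: prob_space \<nu>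
  for T :: nat and \<sigma> R J :: real and d_type :: "'d::finite itself" and \<nu> :: "'d path measure" +
  assumes sets_\<nu>[measurable_cong]: "sets \<nu> = sets (path_space T)"
    and ball_\<nu>: "AE k in \<nu>. k \<in> path_ball T R"
begin

definition smooth_density :: "nat \<Rightarrow> 'd path \<Rightarrow> real" where
  "smooth_density t x = (\<integral>k. noise_density t x k \<partial>\<nu>)"

lemma noise_meas: "t \<le> T \<Longrightarrow> (\<lambda>(x, k). noise_density t x k) \<in> borel_measurable (path_space t \<Otimes>\<^sub>M \<nu>)"
  using noise_density_measurable[of t] sets_pair_measure_cong[OF refl sets_\<nu>, of "path_space t"]
  by (simp cong: measurable_cong_sets)

lemma noise_integrable:
  assumes "t \<le> T" "x \<in> space (path_space t)"
  shows "integrable \<nu> (noise_density t x)"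
proof (rule \<nu>.integrable_const_bound[where B="noise_envelope t x"])
  show "noise_density t x \<in> borel_measurable \<nu>"
    using measurable_Pair2[OF noise_meas[OF assms(1)] assms(2)] by simp
qed (use assms in \<open>auto simp: noise_density_nonneg noise_density_le\<close>)

lemma ennreal_smooth_density:
  assumes "t \<le> T" "x \<in> space (path_space t)"
  shows "ennreal (smooth_density t x) = (\<integral>\<^sup>+k. ennreal (noise_density t x k) \<partial>\<nu>)"
  unfolding smooth_density_def using noise_integrable[OF assms]
  by (subst nn_integral_eq_integral) (auto simp: noise_density_nonneg)

lemma smooth_density_nonneg: "0 \<le> smooth_density t x"
  unfolding smooth_density_def by (intro integral_nonneg_AE) (auto simp: noise_density_nonneg)

sublocale density_process T J smooth_density
proof
  fix t assume t: "t \<le> T"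
  note [measurable] = noise_meas[OF t]
  show "smooth_density t \<in> borel_measurable (path_space t)"
    unfolding smooth_density_def[abs_def] by measurable
  fix x :: "'d path" assume x: "x \<in> space (path_space t)"
  show "0 < smooth_density t x"
  proof (rule ccontr)
    assume "\<not> ?thesis"
    then have "(\<integral>\<^sup>+k. ennreal (noise_density t x k) \<partial>\<nu>) = 0"
      using ennreal_smooth_density[OF t x] by (simp add: ennreal_neg)
    moreover have "(\<lambda>k. ennreal (noise_density t x k)) \<in> borel_measurable \<nu>"
      using noise_integrable[OF t x] by simp
    ultimately have "AE k in \<nu>. ennreal (noise_density t x k) = 0"
      by (simp add: nn_integral_0_iff_AE)
    with ball_\<nu> have "AE k in \<nu>. False"
    proof eventually_elim
      case (elim k)
      then show ?case using noise_density_pos[of k t x] by (simp add: ennreal_eq_0_iff)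
    qed
    then show False by simp
  qed
next
  have "AE k in \<nu>. noise_density 0 (\<lambda>_. undefined) k = 1"
    using ball_\<nu> by eventually_elim (simp add: noise_density_def)
  then have "smooth_density 0 (\<lambda>_. undefined) = (\<integral>k. 1 \<partial>\<nu>)"
    unfolding smooth_density_def
    using noise_integrable[of 0 "\<lambda>_. undefined"] by (intro integral_cong_AE) (auto simp: space_path_space)
  then show "smooth_density 0 (\<lambda>_. undefined) = 1" by (simp add: \<nu>.prob_space)
next
  fix t and x :: "'d path" assume t: "t < T" and x: "x \<in> space (path_space t)"
  interpret PS: pair_sigma_finite "lborel :: (real ^ 'd) measure" \<nu> ..
  have T: "Suc t \<le> T" "t \<le> T" using t by auto
  have upd: "(\<lambda>a. x(Suc t := a)) \<in> borel \<rightarrow>\<^sub>M path_space (Suc t)"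
    using measurable_Pair2[OF fun_upd_path_measurable x] by simp
  have m: "(\<lambda>(a, k). noise_density (Suc t) (x(Suc t := a)) k) \<in> borel_measurable (lborel \<Otimes>\<^sub>M \<nu>)"
    using measurable_compose[OF _ noise_meas[OF T(1)], of "\<lambda>y. (x(Suc t := fst y), snd y)" "lborel \<Otimes>\<^sub>M \<nu>"]
      measurable_compose[OF measurable_fst, of _ lborel "path_space (Suc t)" \<nu>] upd
    by (simp add: case_prod_unfold del: fun_upd_apply)
  note [measurable] = m
  have "(\<integral>\<^sup>+a. ennreal (smooth_density (Suc t) (x(Suc t := a))) \<partial>lborel) =
      (\<integral>\<^sup>+a. \<integral>\<^sup>+k. ennreal (noise_density (Suc t) (x(Suc t := a)) k) \<partial>\<nu> \<partial>lborel)"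
    using x T by (intro nn_integral_cong ennreal_smooth_density fun_upd_path_space)
  also have "\<dots> = (\<integral>\<^sup>+k. \<integral>\<^sup>+a. ennreal (noise_density (Suc t) (x(Suc t := a)) k) \<partial>lborel \<partial>\<nu>)"
    by (rule PS.Fubini'[symmetric]) measurable
  also have "\<dots> = ennreal (smooth_density t x)"
    unfolding nn_integral_noise_step using ennreal_smooth_density[OF T(2) x] by simp
  finally show "(\<integral>\<^sup>+a. ennreal (smooth_density (Suc t) (x(Suc t := a))) \<partial>lborel) = ennreal (smooth_density t x)" .
  have "(\<integral>\<^sup>+a. ennreal (smooth_density (Suc t) (x(Suc t := a)) * (1 + norm a)) \<partial>lborel) =
      (\<integral>\<^sup>+a. \<integral>\<^sup>+k. ennreal (noise_density (Suc t) (x(Suc t := a)) k * (1 + norm a)) \<partial>\<nu> \<partial>lborel)"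
  proof (rule nn_integral_cong)
    fix a :: "real ^ 'd"
    let ?y = "x(Suc t := a)"
    have y: "?y \<in> space (path_space (Suc t))" by (rule fun_upd_path_space[OF x])
    have "ennreal (smooth_density (Suc t) ?y * (1 + norm a)) =
        (\<integral>\<^sup>+k. ennreal (noise_density (Suc t) ?y k) \<partial>\<nu>) * ennreal (1 + norm a)"
      using ennreal_smooth_density[OF T(1) y] smooth_density_nonneg by (simp add: ennreal_mult del: ennreal_plus fun_upd_apply)
    also have "\<dots> = (\<integral>\<^sup>+k. ennreal (noise_density (Suc t) ?y k) * ennreal (1 + norm a) \<partial>\<nu>)"
      using noise_integrable[OF T(1) y] by (intro nn_integral_multc[symmetric]) simp
    also have "\<dots> = (\<integral>\<^sup>+k. ennreal (noise_density (Suc t) ?y k * (1 + norm a)) \<partial>\<nu>)"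
      by (intro nn_integral_cong ennreal_mult[symmetric]) (auto simp: noise_density_nonneg)
    finally show "ennreal (smooth_density (Suc t) ?y * (1 + norm a)) =
        (\<integral>\<^sup>+k. ennreal (noise_density (Suc t) ?y k * (1 + norm a)) \<partial>\<nu>)" .
  qed
  also have "\<dots> = (\<integral>\<^sup>+k. \<integral>\<^sup>+a. ennreal (noise_density (Suc t) (x(Suc t := a)) k * (1 + norm a)) \<partial>lborel \<partial>\<nu>)"
    by (rule PS.Fubini'[symmetric]) measurable
  also have "\<dots> \<le> (\<integral>\<^sup>+k. ennreal J * ennreal (noise_density t x k) \<partial>\<nu>)"
    by (intro nn_integral_mono nn_integral_noise_moment t)
  also have "\<dots> = ennreal J * ennreal (smooth_density t x)"
    using noise_integrable[OF T(2) x] ennreal_smooth_density[OF T(2) x] by (subst nn_integral_cmult) auto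
  also have "\<dots> = ennreal (J * smooth_density t x)"
    using J_ge_1 by (intro ennreal_mult[symmetric]) (auto simp: smooth_density_nonneg)
  finally show "(\<integral>\<^sup>+a. ennreal (smooth_density (Suc t) (x(Suc t := a)) * (1 + norm a)) \<partial>lborel)
    \<le> ennreal (J * smooth_density t x)" .
qed (rule J_ge_1)

lemma convolution_eq_law: "path_convolution T \<nu> (path_gaussian T \<sigma>) = law T"
proof (rule measure_eqI)
  show "sets (path_convolution T \<nu> (path_gaussian T \<sigma>)) = sets (law T)"
    by (simp add: path_convolution_def)
  fix A assume "A \<in> sets (path_convolution T \<nu> (path_gaussian T \<sigma>))"
  then have A[measurable]: "A \<in> sets (path_space T)" by (simp add: path_convolution_def)
  define g :: "'d path \<Rightarrow> real" where "g z = (\<Prod>s = 1..T. gauss \<sigma> (z s))" for z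
  have g_nonneg: "0 \<le> g z" for z unfolding g_def by (intro prod_nonneg) (auto simp: gauss_nonneg)
  have g_meas[measurable]: "g \<in> borel_measurable (path_space T)"
    unfolding g_def[abs_def]
    by (intro borel_measurable_prod measurable_compose[OF component_path_measurable gauss_measurable])
  have G: "path_gaussian T \<sigma> = density (path_lebesgue T) (\<lambda>z. ennreal (g z))"
    unfolding path_gaussian_def g_def gauss_def ..
  have [measurable_cong]: "sets (path_gaussian T \<sigma> :: 'd path measure) = sets (path_space T)" by (simp add: G)
  have "(\<integral>\<^sup>+z. ennreal (g z) \<partial>path_lebesgue T) = 1"
    using nn_integral_path_lebesgue_prod[of "\<lambda>v :: real ^ 'd. ennreal (gauss \<sigma> v)" T] nn_integral_gauss[OF \<sigma>, of "0 :: real ^ 'd"]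
    by (simp add: g_def prod_ennreal gauss_nonneg)
  moreover have "emeasure (path_gaussian T \<sigma>) (space (path_gaussian T \<sigma> :: 'd path measure)) =
      (\<integral>\<^sup>+z. ennreal (g z) \<partial>path_lebesgue T)"
    unfolding G by (subst emeasure_density) (auto intro!: nn_integral_cong)
  ultimately have "emeasure (path_gaussian T \<sigma>) (space (path_gaussian T \<sigma> :: 'd path measure)) = 1"
    by simp
  then interpret Gp: prob_space "path_gaussian T \<sigma> :: 'd path measure" by (rule prob_spaceI)
  interpret PL: sigma_finite_measure "path_lebesgue T :: 'd path measure" by (rule sigma_finite_path_lebesgue)
  interpret PS: pair_sigma_finite \<nu> "path_lebesgue T :: 'd path measure" ..
  let ?add = "\<lambda>k z :: 'd path. \<lambda>s\<in>{1..T}. k s + z s"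
  have add: "(\<lambda>(k, z). ?add k z) \<in> path_space T \<Otimes>\<^sub>M path_space T \<rightarrow>\<^sub>M path_space T"
    unfolding case_prod_unfold unfolding path_space_def
  proof (rule measurable_restrict)
    fix s assume s: "s \<in> {1..T}"
    have c: "(\<lambda>x. x s) \<in> PiM {1..T} (\<lambda>_. borel) \<rightarrow>\<^sub>M (borel :: (real ^ 'd) measure)"
      by (rule measurable_component_singleton[OF s])
    note [measurable] = measurable_compose[OF measurable_fst c, of "PiM {1..T} (\<lambda>_. borel :: (real ^ 'd) measure)"]
      measurable_compose[OF measurable_snd c, of "PiM {1..T} (\<lambda>_. borel :: (real ^ 'd) measure)"]
    show "(\<lambda>x. fst x s + snd x s) \<in> PiM {1..T} (\<lambda>_. borel) \<Otimes>\<^sub>M PiM {1..T} (\<lambda>_. borel) \<rightarrow>\<^sub>M (borel :: (real ^ 'd) measure)"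
      by measurable
  qed
  note [measurable] = add
  note T = order_refl[of T]
  note [measurable] = noise_meas[OF T]
  have addk[measurable]: "?add k \<in> path_space T \<rightarrow>\<^sub>M path_space T" if "k \<in> space (path_space T)" for k
    using measurable_Pair2[OF add that] by simp
  have shift: "(\<integral>\<^sup>+z. indicator A (?add k z) \<partial>path_gaussian T \<sigma>) =
      (\<integral>\<^sup>+x. ennreal (noise_density T x k) * indicator A x \<partial>path_lebesgue T)"
    if k: "k \<in> path_ball T R" for k
  proof -
    have ks: "k \<in> space (path_space T)" using k by (simp add: path_ball_def)
    note [measurable] = addk[OF ks]
    have nd[measurable]: "(\<lambda>x. noise_density T x k) \<in> borel_measurable (path_space T)"
      using measurable_Pair1[OF noise_density_measurable[OF T] ks] by simp
    have "(\<integral>\<^sup>+z. indicator A (?add k z) \<partial>path_gaussian T \<sigma>) =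
        (\<integral>\<^sup>+z. ennreal (g z) * indicator A (?add k z) \<partial>path_lebesgue T)"
      unfolding G by (rule nn_integral_density) measurable
    also have "\<dots> = (\<integral>\<^sup>+z. ennreal (noise_density T (?add k z) k) * indicator A (?add k z) \<partial>path_lebesgue T)"
      using k by (intro nn_integral_cong) (simp add: noise_density_def g_def)
    also have "\<dots> = (\<integral>\<^sup>+x. ennreal (noise_density T x k) * indicator A x
        \<partial>distr (path_lebesgue T) (path_lebesgue T) (?add k))"
    proof -
      have "?add k \<in> path_lebesgue T \<rightarrow>\<^sub>M path_lebesgue T"
        unfolding measurable_cong_sets[OF sets_path_lebesgue sets_path_lebesgue] by (rule addk[OF ks])
      then show ?thesis by (intro nn_integral_distr[symmetric]) measurable
    qed
    finally show ?thesis unfolding distr_path_lebesgue_translate .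
  qed
  have "emeasure (path_convolution T \<nu> (path_gaussian T \<sigma>)) A =
      (\<integral>\<^sup>+x. indicator A x \<partial>path_convolution T \<nu> (path_gaussian T \<sigma>))"
    using A by (subst nn_integral_indicator) (auto simp: path_convolution_def)
  also have "\<dots> = (\<integral>\<^sup>+y. indicator A (case y of (k, z) \<Rightarrow> ?add k z) \<partial>(\<nu> \<Otimes>\<^sub>M path_gaussian T \<sigma>))"
    unfolding path_convolution_def by (rule nn_integral_distr) measurable
  also have "\<dots> = (\<integral>\<^sup>+k. \<integral>\<^sup>+z. indicator A (?add k z) \<partial>path_gaussian T \<sigma> \<partial>\<nu>)"
  proof -
    have "(\<lambda>y. indicator A (case y of (k, z) \<Rightarrow> ?add k z) :: ennreal) \<in> borel_measurable (\<nu> \<Otimes>\<^sub>M path_gaussian T \<sigma>)"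
      by measurable
    from Gp.nn_integral_fst[OF this, symmetric] show ?thesis by (simp only: prod.case)
  qed
  also have "\<dots> = (\<integral>\<^sup>+k. \<integral>\<^sup>+x. ennreal (noise_density T x k) * indicator A x \<partial>path_lebesgue T \<partial>\<nu>)"
    using ball_\<nu> by (intro nn_integral_cong_AE, eventually_elim) (rule shift)
  also have "\<dots> = (\<integral>\<^sup>+x. \<integral>\<^sup>+k. ennreal (noise_density T x k) * indicator A x \<partial>\<nu> \<partial>path_lebesgue T)"
    by (rule PS.Fubini'[symmetric]) measurable
  also have "\<dots> = (\<integral>\<^sup>+x. ennreal (smooth_density T x) * indicator A x \<partial>path_lebesgue T)"
    using noise_integrable[OF T]
    by (intro nn_integral_cong) (simp add: nn_integral_multc ennreal_smooth_density)
  also have "\<dots> = emeasure (law T) A"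
    unfolding law_def using A p_meas[OF T] by (subst emeasure_density) auto
  finally show "emeasure (path_convolution T \<nu> (path_gaussian T \<sigma>)) A = emeasure (law T) A" .
qed

end

section \<open>Smoothed empirical measures\<close>

context smoothed_measure
begin

lemma l1_deviation_noise:
  assumes t: "t \<le> T"
  shows "l1_deviation \<nu> (path_lebesgue t) (\<lambda>x k. noise_density t x k * path_weight t x)
    (\<lambda>x. noise_envelope t x * path_weight t x)"
proof (intro l1_deviation.intro l1_deviation_axioms.intro)
  note [measurable] = noise_meas[OF t] noise_envelope_measurable[of t]
  show "(\<lambda>(x, k). noise_density t x k * path_weight t x) \<in> borel_measurable (path_lebesgue t \<Otimes>\<^sub>M \<nu>)"
    by measurable
  show "integrable (path_lebesgue t) (\<lambda>x. noise_envelope t x * path_weight t x)"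
    by (rule integrableI_nonneg)
       (auto simp: noise_envelope_nonneg nn_integral_noise_envelope)
  show "sigma_finite_measure (path_lebesgue t :: 'd path measure)" by (rule sigma_finite_path_lebesgue)
qed (auto intro: \<nu>.prob_space_axioms mult_nonneg_nonneg mult_right_mono noise_density_nonneg noise_density_le[OF t])

text \<open>
The weighted distance between the smoothed densities for length \<open>t\<close> of \<open>\<nu>\<close> and of the sample.
\<close>

definition noise_deviation :: "nat \<Rightarrow> nat set \<Rightarrow> (nat \<Rightarrow> 'd path) \<Rightarrow> real" where
  "noise_deviation t = l1_deviation.deviation \<nu> (path_lebesgue t) (\<lambda>x k. noise_density t x k * path_weight t x)"

lemma integral_noise_envelope: "(\<integral>x. noise_envelope t x * path_weight t x \<partial>path_lebesgue t) = J ^ t"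
  using nn_integral_noise_envelope[of t] J_ge_1 noise_envelope_measurable[of t]
  by (subst integral_eq_nn_integral) (auto simp: noise_envelope_nonneg)

text \<open>
For points \<open>k 1, \<dots>, k N\<close> of the ball, \<open>total_deviation N k\<close> bounds the smoothed adapted distance between
\<open>\<nu>\<close> and their empirical measure. In \<open>deviation_const\<close> each deviation is replaced by its bound \<open>J ^ t\<close>,
the integral of the weighted envelope.
\<close>

definition total_deviation :: "nat \<Rightarrow> (nat \<Rightarrow> 'd path) \<Rightarrow> real" where
  "total_deviation N k = (3 * J) ^ T * (\<Sum>t\<le>T. noise_deviation t {1..N} k)"

definition deviation_const :: real where
  "deviation_const = (3 * J) ^ T * (\<Sum>t\<le>T. J ^ t)"

lemma deviation_const_pos: "0 < deviation_const"
  unfolding deviation_const_def using J_ge_1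
  by (intro mult_pos_pos zero_less_power sum_pos) auto

text \<open>
The empirical measure of points of the ball is again a measure of the kind considered, and its
smoothed densities are averages of the densities \<open>noise_density t x (k n)\<close>.
\<close>

lemma smoothed_AW_le_deviation:
  assumes N: "1 \<le> N" and k: "\<And>n. n \<in> {1..N} \<Longrightarrow> k n \<in> path_ball T R"
  shows "smoothed_AW T \<sigma> \<nu> (empirical_measure T N k) \<le> ennreal (total_deviation N k)"
proof -
  have ks: "k n \<in> space (path_space T)" if "n \<in> {1..N}" for n
    using k[OF that] by (simp add: path_ball_def)
  have sets_e: "sets (empirical_measure T N k) = sets (path_space T)"
    by (simp add: empirical_measure_def)
  have one: "emeasure (empirical_measure T N k) A = 1" if "A \<in> sets (path_space T)" "\<And>n. n \<in> {1..N} \<Longrightarrow> k n \<in> A" for A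
    using emeasure_empirical_measure[OF N ks that(1)] that(2) N by simp
  interpret e: prob_space "empirical_measure T N k"
    by (rule prob_spaceI) (use one[OF sets.top] ks sets_eq_imp_space_eq[OF sets_e] in simp)
  interpret e: smoothed_measure T \<sigma> R J d_type "empirical_measure T N k"
  proof
    show "AE x in empirical_measure T N k. x \<in> path_ball T R"
      by (rule e.AE_prob_1) (use one[OF path_ball_sets] k in \<open>simp add: e.emeasure_eq_measure\<close>)
  qed (rule sets_e)
  interpret pair: density_process_pair T J smooth_density e.smooth_density ..
  have dens: "e.smooth_density t x = (\<Sum>n\<in>{1..N}. noise_density t x (k n)) / card {1..N}"
    if t: "t \<le> T" and x: "x \<in> space (path_space t)" for t x
  proof -
    have "k \<in> uniform_count_measure {1..N} \<rightarrow>\<^sub>M path_space T"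
      using ks by (auto simp: measurable_def sets_uniform_count_measure space_uniform_count_measure)
    moreover have "noise_density t x \<in> borel_measurable (path_space T)"
      using measurable_Pair2[OF noise_density_measurable[OF t] x] by simp
    ultimately show ?thesis
      unfolding e.smooth_density_def unfolding empirical_measure_def
      by (subst integral_distr) (auto simp: integral_uniform_count_measure)
  qed
  have gap: "pair.l1_gap t = ennreal (noise_deviation t {1..N} k)" if t: "t \<le> T" for t
  proof -
    interpret D: l1_deviation \<nu> "path_lebesgue t" "\<lambda>x k. noise_density t x k * path_weight t x"
      "\<lambda>x. noise_envelope t x * path_weight t x"
      by (rule l1_deviation_noise[OF t])
    define k' where "k' = restrict k {1..N}"
    have k': "k' \<in> space (PiM {1..N} (\<lambda>_. \<nu>))"
      using ks sets_eq_imp_space_eq[OF sets_\<nu>] by (auto simp: k'_def space_PiM)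
    have J: "finite {1..N}" "{1..N} \<noteq> {}" using N by auto
    have "pair.l1_gap t = (\<integral>\<^sup>+x. ennreal \<bar>(\<integral>k. noise_density t x k * path_weight t x \<partial>\<nu>) -
        (\<Sum>n\<in>{1..N}. noise_density t x (k' n) * path_weight t x) / card {1..N}\<bar> \<partial>path_lebesgue t)"
      unfolding pair.l1_gap_def
    proof (rule nn_integral_cong)
      fix x :: "'d path" assume "x \<in> space (path_lebesgue t)"
      then have x: "x \<in> space (path_space t)" by simp
      have e1: "(\<Sum>n\<in>{1..N}. noise_density t x (k' n) * path_weight t x) / card {1..N} =
          e.smooth_density t x * path_weight t x"
        unfolding dens[OF t x] by (simp add: k'_def sum_distrib_right)
      have e2: "(\<integral>k. noise_density t x k * path_weight t x \<partial>\<nu>) = smooth_density t x * path_weight t x"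
        unfolding smooth_density_def by simp
      show "ennreal (\<bar>smooth_density t x - e.smooth_density t x\<bar> * path_weight t x) =
          ennreal \<bar>(\<integral>k. noise_density t x k * path_weight t x \<partial>\<nu>) -
            (\<Sum>n\<in>{1..N}. noise_density t x (k' n) * path_weight t x) / card {1..N}\<bar>"
        unfolding e1 e2 by (simp add: left_diff_distrib[symmetric] abs_mult)
    qed
    also have "\<dots> = ennreal (D.deviation {1..N} k')"
      unfolding D.deviation_def
      by (rule nn_integral_eq_integral[OF D.integrand_integrable[OF J k']]) simp
    also have "D.deviation {1..N} k' = noise_deviation t {1..N} k"
      unfolding noise_deviation_def D.deviation_def by (simp add: k'_def)
    finally show ?thesis .
  qed
  have "smoothed_AW T \<sigma> \<nu> (empirical_measure T N k) = adapted_wasserstein T (law T) (e.law T)"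
    unfolding smoothed_AW_def convolution_eq_law e.convolution_eq_law ..
  also have "\<dots> \<le> ennreal ((3 * J) ^ T) * (\<Sum>t\<le>T. pair.l1_gap t)"
    by (rule pair.adapted_wasserstein_le_l1_gap)
  also have "(\<Sum>t\<le>T. pair.l1_gap t) = (\<Sum>t\<le>T. ennreal (noise_deviation t {1..N} k))"
    by (intro sum.cong) (auto simp: gap)
  also have "\<dots> = ennreal (\<Sum>t\<le>T. noise_deviation t {1..N} k)"
  proof (rule sum_ennreal)
    fix t assume "t \<in> {..T}"
    then show "0 \<le> noise_deviation t {1..N} k"
      unfolding noise_deviation_def using N by (intro l1_deviation.deviation_nonneg[OF l1_deviation_noise]) auto
  qed
  also have "ennreal ((3 * J) ^ T) * \<dots> = ennreal (total_deviation N k)"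
    unfolding total_deviation_def using J_ge_1 by (intro ennreal_mult'[symmetric]) simp
  finally show ?thesis .
qed

context
  fixes N :: nat
  assumes N: "1 \<le> N"
begin

lemma sample_index: "finite {1..N}" "{1..N} \<noteq> {}"
  using N by auto

lemma noise_deviation_nonneg: "t \<le> T \<Longrightarrow> 0 \<le> noise_deviation t {1..N} k"
  unfolding noise_deviation_def by (rule l1_deviation.deviation_nonneg[OF l1_deviation_noise sample_index])

lemma total_deviation_nonneg: "0 \<le> total_deviation N k"
  unfolding total_deviation_def using J_ge_1
  by (intro mult_nonneg_nonneg sum_nonneg noise_deviation_nonneg) auto

lemma noise_deviation_measurable:
  "t \<le> T \<Longrightarrow> noise_deviation t {1..N} \<in> borel_measurable (PiM {1..N} (\<lambda>_. \<nu>))"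
  unfolding noise_deviation_def by (rule l1_deviation.deviation_measurable[OF l1_deviation_noise sample_index])

lemma total_deviation_measurable: "total_deviation N \<in> borel_measurable (PiM {1..N} (\<lambda>_. \<nu>))"
  unfolding total_deviation_def[abs_def] using noise_deviation_measurable
  by (intro borel_measurable_times borel_measurable_sum) auto

lemma total_deviation_bound:
  assumes "k \<in> space (PiM {1..N} (\<lambda>_. \<nu>))"
  shows "\<bar>total_deviation N k\<bar> \<le> deviation_const"
proof -
  have "noise_deviation t {1..N} k \<le> J ^ t" if "t \<le> T" for t
    using l1_deviation.deviation_bound[OF l1_deviation_noise[OF that] sample_index assms]
    by (simp add: noise_deviation_def integral_noise_envelope)
  then have "total_deviation N k \<le> deviation_const"
    unfolding total_deviation_def deviation_const_def using J_ge_1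
    by (intro mult_left_mono sum_mono) auto
  then show ?thesis using total_deviation_nonneg by simp
qed

lemma total_deviation_diff:
  assumes "k \<in> space (PiM {1..N} (\<lambda>_. \<nu>))" "i \<in> {1..N}" "a \<in> space \<nu>"
  shows "\<bar>total_deviation N (k(i := a)) - total_deviation N k\<bar> \<le> deviation_const / N"
proof -
  have d: "\<bar>noise_deviation t {1..N} (k(i := a)) - noise_deviation t {1..N} k\<bar> \<le> J ^ t / N" if "t \<le> T" for t
    using l1_deviation.deviation_diff[OF l1_deviation_noise[OF that] sample_index assms]
    by (simp add: noise_deviation_def integral_noise_envelope)
  have "\<bar>total_deviation N (k(i := a)) - total_deviation N k\<bar> =
      (3 * J) ^ T * \<bar>\<Sum>t\<le>T. noise_deviation t {1..N} (k(i := a)) - noise_deviation t {1..N} k\<bar>"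
    unfolding total_deviation_def right_diff_distrib[symmetric] sum_subtractf[symmetric]
    using J_ge_1 by (simp add: abs_mult)
  also have "\<dots> \<le> (3 * J) ^ T * (\<Sum>t\<le>T. J ^ t / N)"
    using J_ge_1 d by (intro mult_left_mono order_trans[OF sum_abs] sum_mono) auto
  finally show ?thesis by (simp add: deviation_const_def flip: sum_divide_distrib)
qed

lemma total_deviation_mean:
  "(\<integral>\<^sup>+k. ennreal (total_deviation N k) \<partial>PiM {1..N} (\<lambda>_. \<nu>)) \<le> ennreal (deviation_const / sqrt N)"
proof -
  have c: "0 \<le> (3 * J) ^ T" using J_ge_1 by simp
  have m: "(\<integral>\<^sup>+k. ennreal (noise_deviation t {1..N} k) \<partial>PiM {1..N} (\<lambda>_. \<nu>)) \<le> ennreal (J ^ t / sqrt N)"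
    if "t \<le> T" for t
    using l1_deviation.deviation_mean[OF l1_deviation_noise[OF that] sample_index]
    by (simp add: noise_deviation_def integral_noise_envelope)
  have "(\<integral>\<^sup>+k. ennreal (total_deviation N k) \<partial>PiM {1..N} (\<lambda>_. \<nu>)) =
      (\<integral>\<^sup>+k. ennreal ((3 * J) ^ T) * (\<Sum>t\<le>T. ennreal (noise_deviation t {1..N} k)) \<partial>PiM {1..N} (\<lambda>_. \<nu>))"
  proof (rule nn_integral_cong)
    fix k
    have "(\<Sum>t\<le>T. ennreal (noise_deviation t {1..N} k)) = ennreal (\<Sum>t\<le>T. noise_deviation t {1..N} k)"
      by (rule sum_ennreal) (rule noise_deviation_nonneg, simp)
    then show "ennreal (total_deviation N k) =
        ennreal ((3 * J) ^ T) * (\<Sum>t\<le>T. ennreal (noise_deviation t {1..N} k))"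
      unfolding total_deviation_def using ennreal_mult'[OF c] by simp
  qed
  also have "\<dots> = ennreal ((3 * J) ^ T) * (\<Sum>t\<le>T. \<integral>\<^sup>+k. ennreal (noise_deviation t {1..N} k) \<partial>PiM {1..N} (\<lambda>_. \<nu>))"
  proof -
    have m: "(\<lambda>k. ennreal (noise_deviation t {1..N} k)) \<in> borel_measurable (PiM {1..N} (\<lambda>_. \<nu>))"
      if "t \<in> {..T}" for t
      using noise_deviation_measurable[of t] that by simp
    show ?thesis
      by (subst nn_integral_cmult[OF borel_measurable_sum[OF m]]) (simp_all only: nn_integral_sum[OF m])
  qed
  also have "\<dots> \<le> ennreal ((3 * J) ^ T) * (\<Sum>t\<le>T. ennreal (J ^ t / sqrt N))"
    by (intro mult_left_mono sum_mono m) auto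
  also have "(\<Sum>t\<le>T. ennreal (J ^ t / sqrt N)) = ennreal (\<Sum>t\<le>T. J ^ t / sqrt N)"
    using J_ge_1 by (intro sum_ennreal) simp
  also have "ennreal ((3 * J) ^ T) * \<dots> = ennreal (deviation_const / sqrt N)"
    using c by (simp add: deviation_const_def ennreal_mult'[symmetric] flip: sum_divide_distrib)
  finally show ?thesis .
qed

lemma integral_total_deviation: "(\<integral>k. total_deviation N k \<partial>PiM {1..N} (\<lambda>_. \<nu>)) \<le> deviation_const / sqrt N"
proof -
  have "ennreal (\<integral>k. total_deviation N k \<partial>PiM {1..N} (\<lambda>_. \<nu>)) =
      (\<integral>\<^sup>+k. ennreal (total_deviation N k) \<partial>PiM {1..N} (\<lambda>_. \<nu>))"
  proof (rule nn_integral_eq_integral[symmetric])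
    interpret PP: prob_space "PiM {1..N} (\<lambda>_. \<nu>)"
      by (intro prob_space_PiM \<nu>.prob_space_axioms)
    show "integrable (PiM {1..N} (\<lambda>_. \<nu>)) (total_deviation N)"
      by (rule PP.integrable_const_bound[where B=deviation_const])
         (use total_deviation_bound total_deviation_measurable in auto)
  qed (simp add: total_deviation_nonneg)
  also note total_deviation_mean
  finally show ?thesis using deviation_const_pos by (simp add: ennreal_le_iff)
qed

lemma total_deviation_tail:
  assumes "0 < x"
  shows "emeasure (PiM {1..N} (\<lambda>_. \<nu>))
      {k \<in> space (PiM {1..N} (\<lambda>_. \<nu>)). x + deviation_const / sqrt N \<le> total_deviation N k}
    \<le> ennreal (exp (- (real N * x\<^sup>2 / (2 * deviation_const\<^sup>2))))"
proof -
  interpret product_prob_space "\<lambda>_::nat. \<nu>" UNIV by standard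
  let ?P = "PiM {1..N} (\<lambda>_. \<nu>)"
  have "emeasure ?P {k \<in> space ?P. x + deviation_const / sqrt N \<le> total_deviation N k} \<le>
      emeasure ?P {k \<in> space ?P. x \<le> total_deviation N k - (\<integral>k. total_deviation N k \<partial>?P)}"
    using integral_total_deviation total_deviation_measurable
    by (intro emeasure_mono) (auto intro!: borel_measurable_le borel_measurable_diff)
  also have "\<dots> \<le> ennreal (exp (- x\<^sup>2 / (2 * (deviation_const / N)\<^sup>2 * card {1..N})))"
    by (rule bounded_differences_inequality[where B=deviation_const])
       (use N assms deviation_const_pos total_deviation_measurable total_deviation_bound total_deviation_diff in auto)
  also have "- x\<^sup>2 / (2 * (deviation_const / N)\<^sup>2 * card {1..N}) = - (real N * x\<^sup>2 / (2 * deviation_const\<^sup>2))"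
    using N by (simp add: power2_eq_square field_simps)
  finally show ?thesis .
qed

end

end

section \<open>Compact sets and the constants of the statement\<close>

lemma compactin_subset_path_ball:
  fixes K :: "('d::finite) path set"
  assumes "compactin (path_topology T) K"
  shows "\<exists>R\<ge>0. K \<subseteq> path_ball T R"
proof -
  have "\<exists>r. \<forall>x\<in>K. norm (x s) \<le> r" if s: "s \<in> {1..T}" for s
  proof -
    have "continuous_map (path_topology T) euclidean (\<lambda>x :: 'd path. x s)"
      unfolding path_topology_def by (rule continuous_map_product_projection[OF s])
    from image_compactin[OF assms this] have "bounded ((\<lambda>x. x s) ` K)"
      by (simp add: compact_imp_bounded)
    then show ?thesis by (auto simp: bounded_iff)
  qed
  then obtain r where r: "\<And>s x. s \<in> {1..T} \<Longrightarrow> x \<in> K \<Longrightarrow> norm (x s) \<le> r s" by metis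
  have "norm (x s) \<le> (\<Sum>s = 1..T. \<bar>r s\<bar>)" if "s \<in> {1..T}" "x \<in> K" for s x
  proof -
    have "norm (x s) \<le> \<bar>r s\<bar>" using r[OF that] by linarith
    also have "\<dots> \<le> (\<Sum>s = 1..T. \<bar>r s\<bar>)" using that by (intro member_le_sum) auto
    finally show ?thesis .
  qed
  moreover have "K \<subseteq> space (path_space T)"
    using compactin_subset_topspace[OF assms] by (auto simp: path_topology_def space_path_space PiE_def)
  ultimately have "K \<subseteq> path_ball T (\<Sum>s = 1..T. \<bar>r s\<bar>)"
    by (auto simp: path_ball_def)
  then show ?thesis by (intro exI[of _ "\<Sum>s = 1..T. \<bar>r s\<bar>"]) (auto intro: sum_nonneg)
qed

lemma ennreal_sqrt_pos: "a \<noteq> 0 \<Longrightarrow> 0 < ennreal_sqrt a"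
  by (cases a) (auto simp: ennreal_sqrt_def)

text \<open>
The value \<open>\<infinity>\<close> is allowed. The integral is positive since its integrand is positive everywhere.
\<close>

lemma C_const_pos:
  fixes \<mu> :: "('d::finite) path measure"
  assumes "0 < \<sigma>" "0 < C\<^sub>1" "0 < C\<^sub>2"
  shows "0 < C_const T \<sigma> p \<mu> C\<^sub>1 C\<^sub>2"
proof -
  let ?f = "\<lambda>x :: 'd path. (path_norm T x + 1 / 2)\<^sup>2 / (1 + path_norm T x powr p)"
  have norm_nonneg: "0 \<le> path_norm T x" for x :: "'d path"
    unfolding path_norm_def by (intro sum_nonneg) simp
  have norm_meas[measurable]: "path_norm T \<in> borel_measurable (path_space T :: 'd path measure)"
    unfolding path_norm_def[abs_def]
    by (intro borel_measurable_sum measurable_compose[OF component_path_measurable borel_measurable_norm])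
  have "(\<integral>\<^sup>+x. ennreal (?f x) \<partial>path_lebesgue T) \<noteq> 0"
  proof
    assume "(\<integral>\<^sup>+x. ennreal (?f x) \<partial>path_lebesgue T) = 0"
    then have "AE x in path_lebesgue T. ennreal (?f x) = 0"
      by (subst (asm) nn_integral_0_iff_AE) auto
    moreover have "0 < ?f x" for x
      using norm_nonneg[of x] by (intro divide_pos_pos) (auto simp: add_pos_nonneg intro!: zero_less_power)
    then have "ennreal (?f x) \<noteq> 0" for x
      by (simp only: ennreal_eq_0_iff not_le)
    ultimately have "AE x in (path_lebesgue T :: 'd path measure). False" by simp
    then have "(\<integral>\<^sup>+x. 1 \<partial>(path_lebesgue T :: 'd path measure)) = (\<integral>\<^sup>+x. 0 \<partial>(path_lebesgue T :: 'd path measure))"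
      by (intro nn_integral_cong_AE) (auto elim: eventually_mono)
    moreover have "(\<integral>\<^sup>+x. 1 \<partial>(path_lebesgue T :: 'd path measure)) = (\<integral>\<^sup>+v. 1 \<partial>(lborel :: (real ^ 'd) measure)) ^ T"
      using nn_integral_path_lebesgue_prod[of "\<lambda>_ :: real ^ 'd. 1" T] by simp
    ultimately show False by (auto simp: emeasure_lborel_UNIV)
  qed
  then have "0 < ennreal_sqrt (\<integral>\<^sup>+x. ennreal (?f x) \<partial>path_lebesgue T)"
    by (rule ennreal_sqrt_pos)
  moreover have "0 \<le> moment T p \<mu>" unfolding moment_def by simp
  then have "0 < sqrt ((C\<^sub>1 * (2 powr p * moment T p \<mu> + 1) + C\<^sub>2 * 2 powr p * \<sigma> powr p) *
      (1 / (2 * pi * \<sigma>) ^ (CARD('d) * T)))"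
    using assms by (simp add: add_nonneg_pos add_pos_nonneg mult_nonneg_nonneg)
  ultimately show ?thesis
    unfolding C_const_def by (simp add: ennreal_zero_less_mult_iff)
qed

lemma c_const_pos:
  assumes "0 < \<sigma>" "0 < c\<^sub>1" "K \<noteq> {}" "K \<subseteq> path_ball T R"
  shows "0 < c_const T \<sigma> K c\<^sub>1"
proof -
  let ?f = "\<lambda>x. (1 + 2 * path_norm T x) / (2 * \<sigma>)"
  obtain x where x: "x \<in> K" using assms by auto
  have "path_norm T y \<le> (\<Sum>s = 1..T. R)" if "y \<in> K" for y
    unfolding path_norm_def using that assms by (intro sum_mono) (auto simp: path_ball_def)
  then have "bdd_above (?f ` K)"
    using assms by (intro bdd_aboveI2[where M="(1 + 2 * (\<Sum>s = 1..T. R)) / (2 * \<sigma>)"])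
      (auto intro!: divide_right_mono)
  then have "?f x \<le> (SUP x\<in>K. ?f x)" using x by (intro cSUP_upper)
  moreover have "0 \<le> ?f x"
    using assms unfolding path_norm_def by (intro divide_nonneg_pos add_nonneg_nonneg mult_nonneg_nonneg sum_nonneg) auto
  ultimately show ?thesis using assms unfolding c_const_def by (intro mult_pos_pos) auto
qed

section \<open>Mean and tail of the smoothed adapted distance\<close>

text \<open>
The samples lie in the ball almost surely, and there the distance is bounded by the measurable
function \<open>total_deviation\<close> of the samples. This also takes care of outer expectations and measures.
\<close>

lemma (in smoothed_measure) empirical_smoothed_AW:
  fixes P :: "'w measure" and X :: "nat \<Rightarrow> 'w \<Rightarrow> 'd path"
  assumes P: "prob_space P" and indep: "prob_space.indep_vars P (\<lambda>_. path_space T) X {1..}"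
    and X_law: "\<And>n. 1 \<le> n \<Longrightarrow> distr P (path_space T) (X n) = \<nu>"
    and N: "1 \<le> N"
  shows "outer_expectation P (\<lambda>\<omega>. smoothed_AW T \<sigma> \<nu> (empirical_measure T N (\<lambda>n. X n \<omega>)))
      \<le> ennreal (deviation_const / sqrt N)"
    and "0 < x \<Longrightarrow> outer_measure_of P {\<omega> \<in> space P.
        ennreal (x + deviation_const / sqrt N) \<le> smoothed_AW T \<sigma> \<nu> (empirical_measure T N (\<lambda>n. X n \<omega>))}
      \<le> ennreal (exp (- (real N * x\<^sup>2 / (2 * deviation_const\<^sup>2))))"
proof -
  interpret P: prob_space P by fact
  let ?PN = "PiM {1..N} (\<lambda>_. \<nu>)"
  let ?AW = "\<lambda>\<omega>. smoothed_AW T \<sigma> \<nu> (empirical_measure T N (\<lambda>n. X n \<omega>))"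
  define Y where "Y \<omega> = (\<lambda>n\<in>{1..N}. X n \<omega>)" for \<omega>
  have X_meas: "X n \<in> P \<rightarrow>\<^sub>M path_space T" if "1 \<le> n" for n
    using indep that unfolding P.indep_vars_def by auto
  have sets_PN: "sets ?PN = sets (PiM {1..N} (\<lambda>_. path_space T))"
    by (intro sets_PiM_cong) (auto simp: sets_\<nu>)
  have Y_meas: "Y \<in> P \<rightarrow>\<^sub>M ?PN"
    unfolding measurable_cong_sets[OF refl sets_PN] unfolding Y_def[abs_def]
    by (intro measurable_restrict X_meas) auto
  have "P.indep_vars (\<lambda>_. path_space T) X {1..N}"
    by (rule P.indep_vars_subset[OF indep]) auto
  then have "distr P (PiM {1..N} (\<lambda>_. path_space T)) Y = PiM {1..N} (\<lambda>n. distr P (path_space T) (X n))"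
    unfolding Y_def[abs_def] using N X_meas by (subst (asm) P.indep_vars_iff_distr_eq_PiM') auto
  also have "\<dots> = ?PN" by (intro PiM_cong) (auto simp: X_law)
  also have "distr P (PiM {1..N} (\<lambda>_. path_space T)) Y = distr P ?PN Y"
    by (rule distr_cong[OF refl sets_PN[symmetric] refl])
  finally have Y_law: "distr P ?PN Y = ?PN" .
  have good: "AE \<omega> in P. \<forall>n\<in>{1..N}. X n \<omega> \<in> path_ball T R"
  proof (rule AE_finite_allI)
    fix n assume "n \<in> {1..N}"
    then have n: "1 \<le> n" by simp
    have "AE k in distr P (path_space T) (X n). k \<in> path_ball T R"
      unfolding X_law[OF n] by (rule ball_\<nu>)
    then show "AE \<omega> in P. X n \<omega> \<in> path_ball T R"
      by (rule AE_distrD[OF X_meas[OF n]])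
  qed simp
  have AW_le: "?AW \<omega> \<le> ennreal (total_deviation N (Y \<omega>))" if "\<forall>n\<in>{1..N}. X n \<omega> \<in> path_ball T R" for \<omega>
  proof -
    have "noise_deviation t {1..N} (Y \<omega>) = noise_deviation t {1..N} (\<lambda>n. X n \<omega>)" if "t \<le> T" for t
    proof -
      have "(\<Sum>n\<in>{1..N}. noise_density t x (Y \<omega> n) * path_weight t x) =
          (\<Sum>n\<in>{1..N}. noise_density t x (X n \<omega>) * path_weight t x)" for x
        by (intro sum.cong) (auto simp: Y_def)
      then show ?thesis
        unfolding noise_deviation_def l1_deviation.deviation_def[OF l1_deviation_noise[OF that]]
        by (simp only:)
    qed
    then have "total_deviation N (Y \<omega>) = total_deviation N (\<lambda>n. X n \<omega>)"
      unfolding total_deviation_def by simp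
    with smoothed_AW_le_deviation[OF N, of "\<lambda>n. X n \<omega>"] that show ?thesis by simp
  qed
  let ?good = "{\<omega> \<in> space P. \<forall>n\<in>{1..N}. X n \<omega> \<in> path_ball T R}"
  have good_sets: "?good \<in> sets P"
    using X_meas path_ball_sets
    by (intro sets.sets_Collect_finite_All) (auto intro!: measurable_sets_Collect)
  have F_meas: "(\<lambda>\<omega>. total_deviation N (Y \<omega>)) \<in> borel_measurable P"
    by (rule measurable_compose[OF Y_meas total_deviation_measurable[OF N]])
  show "outer_expectation P ?AW \<le> ennreal (deviation_const / sqrt N)"
  proof -
    \<comment> \<open>a measurable majorant of the distance, infinite on the null set of samples outside the ball\<close>
    let ?g = "\<lambda>\<omega>. if \<omega> \<in> ?good then ennreal (total_deviation N (Y \<omega>)) else \<infinity>"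
    have "?g \<in> borel_measurable P"
      using good_sets F_meas by (intro measurable_If_set) auto
    then have "outer_expectation P ?AW \<le> (\<integral>\<^sup>+\<omega>. ?g \<omega> \<partial>P)"
      unfolding outer_expectation_def using AW_le by (intro INF_lower) auto
    also have "\<dots> = (\<integral>\<^sup>+\<omega>. ennreal (total_deviation N (Y \<omega>)) \<partial>P)"
    proof (rule nn_integral_cong_AE)
      show "AE \<omega> in P. ?g \<omega> = ennreal (total_deviation N (Y \<omega>))"
        using good AE_space by eventually_elim simp
    qed
    also have "\<dots> = (\<integral>\<^sup>+k. ennreal (total_deviation N k) \<partial>distr P ?PN Y)"
      using total_deviation_measurable[OF N] by (intro nn_integral_distr[OF Y_meas, symmetric]) simp
    also have "\<dots> \<le> ennreal (deviation_const / sqrt N)"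
      unfolding Y_law by (rule total_deviation_mean[OF N])
    finally show ?thesis .
  qed
  show "outer_measure_of P {\<omega> \<in> space P. ennreal (x + deviation_const / sqrt N) \<le> ?AW \<omega>}
      \<le> ennreal (exp (- (real N * x\<^sup>2 / (2 * deviation_const\<^sup>2))))" if x: "0 < x"
  proof -
    let ?A = "{k \<in> space ?PN. x + deviation_const / sqrt N \<le> total_deviation N k}"
    let ?E = "{\<omega> \<in> space P. ennreal (x + deviation_const / sqrt N) \<le> ?AW \<omega>}"
    have A: "?A \<in> sets ?PN"
      using total_deviation_measurable[OF N] by (intro borel_measurable_le) auto
    have null: "space P - ?good \<in> null_sets P"
    proof -
      have "AE \<omega> in P. \<omega> \<notin> space P - ?good"
        using good by eventually_elim simp
      then show ?thesis using good_sets by (subst AE_iff_null_sets) auto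
    qed
    have "?E
        \<subseteq> (Y -` ?A \<inter> space P) \<union> (space P - ?good)"
    proof
      fix \<omega> assume \<omega>: "\<omega> \<in> ?E"
      show "\<omega> \<in> (Y -` ?A \<inter> space P) \<union> (space P - ?good)"
      proof (cases "\<omega> \<in> ?good")
        case True
        then have "ennreal (x + deviation_const / sqrt N) \<le> ennreal (total_deviation N (Y \<omega>))"
          using \<omega> AW_le[of \<omega>] by (auto intro: order_trans)
        then have "x + deviation_const / sqrt N \<le> total_deviation N (Y \<omega>)"
          by (simp add: total_deviation_nonneg[OF N])
        then show ?thesis using \<omega> measurable_space[OF Y_meas] by auto
      qed (use \<omega> in auto)
    qed
    then have "outer_measure_of P ?E
        \<le> outer_measure_of P ((Y -` ?A \<inter> space P) \<union> (space P - ?good))"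
      by (rule outer_measure_of_mono)
    also have "\<dots> = emeasure P ((Y -` ?A \<inter> space P) \<union> (space P - ?good))"
      using measurable_sets[OF Y_meas A] null by (intro outer_measure_of_eq) auto
    also have "\<dots> = emeasure P (Y -` ?A \<inter> space P)"
      by (rule emeasure_Un_null_set[OF measurable_sets[OF Y_meas A] null])
    also have "\<dots> = emeasure (distr P ?PN Y) ?A"
      by (rule emeasure_distr[OF Y_meas A, symmetric])
    also have "\<dots> \<le> ennreal (exp (- (real N * x\<^sup>2 / (2 * deviation_const\<^sup>2))))"
      unfolding Y_law by (rule total_deviation_tail[OF N x])
    finally show ?thesis .
  qed
qed

theorem theorem4p4:
  fixes T :: nat
    and K :: "('d::finite) path set"
    and \<mu> :: "'d path measure"
    and p :: real
    and P :: "'w measure"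
    and X :: "nat \<Rightarrow> 'w \<Rightarrow> 'd path"
  assumes "T \<ge> 1"
    and "compactin (path_topology T) K"
    and "\<mu> \<in> prob_on T K"
    and "p > 2"
    and "prob_space P"
    and "prob_space.indep_vars P (\<lambda>_. path_space T) X {1..}"
    and "\<forall>n \<ge> 1. distr P (path_space T) (X n) = \<mu>"
  shows "\<forall>\<sigma>::real. 0 < \<sigma> \<and> \<sigma> \<le> 1 \<longrightarrow>
    (\<exists>C\<^sub>K C\<^sub>1 C\<^sub>2 c\<^sub>1 :: real. C\<^sub>K > 0 \<and> C\<^sub>1 > 0 \<and> C\<^sub>2 > 0 \<and> c\<^sub>1 > 0 \<and>
      (\<forall>x::real. \<forall>N::nat. x > 0 \<and> N \<ge> 1 \<longrightarrow>
        outer_expectation P (\<lambda>\<omega>. smoothed_AW T \<sigma> \<mu> (empirical_measure T N (\<lambda>n. X n \<omega>)))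
          \<le> ennreal C\<^sub>K * C_const T \<sigma> p \<mu> C\<^sub>1 C\<^sub>2 * ennreal (real N powr (- 1 / 2)) \<and>
        outer_measure_of P {\<omega> \<in> space P.
            smoothed_AW T \<sigma> \<mu> (empirical_measure T N (\<lambda>n. X n \<omega>))
              \<ge> ennreal x + ennreal C\<^sub>K * C_const T \<sigma> p \<mu> C\<^sub>1 C\<^sub>2 * ennreal (real N powr (- 1 / 2))}
          \<le> ennreal (exp (- (real N * x\<^sup>2 / (C\<^sub>K\<^sup>2 * (c_const T \<sigma> K c\<^sub>1)\<^sup>2))))))"
proof (intro allI impI, goal_cases)
  case (1 \<sigma>)
  then have \<sigma>: "0 < \<sigma>" by simp
  obtain R where R_nonneg: "0 \<le> R" and K_R: "K \<subseteq> path_ball T R"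
    using compactin_subset_path_ball[OF assms(2)] by auto
  have \<mu>: "prob_space \<mu>" "sets \<mu> = sets (path_space T)" "emeasure \<mu> K = 1"
    using assms(3) by (auto simp: prob_on_def)
  interpret \<mu>: prob_space \<mu> by fact
  have K_sets: "K \<in> sets \<mu>"
    using \<mu>(3) emeasure_notin_sets[of K \<mu>] by fastforce
  have ball: "AE k in \<mu>. k \<in> path_ball T R"
  proof -
    have "AE k in \<mu>. k \<in> K"
      by (rule \<mu>.AE_prob_1) (use \<mu>(3) in \<open>simp add: \<mu>.emeasure_eq_measure\<close>)
    then show ?thesis using K_R by (auto elim: eventually_mono)
  qed
  define J where "J = enn2real (envelope_moment TYPE('d) \<sigma> R)"
  interpret smoothed_measure T \<sigma> R J "TYPE('d)" \<mu>
    by unfold_locales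
       (use \<sigma> R_nonneg \<mu>(2) ball envelope_moment_finite[OF \<sigma>, where 'd='d] in \<open>auto simp: J_def less_top\<close>)
  define I where "I = C_const T \<sigma> p \<mu> 1 1"
  define c where "c = c_const T \<sigma> K 1"
  define B where "B = deviation_const"
  \<comment> \<open>The first summand gives \<open>C\<^sub>K * I \<ge> B\<close> and the second one \<open>C\<^sub>K * c \<ge> 2 * B\<close>. If \<open>I = \<infinity>\<close>, the
    first summand is \<open>0\<close>, and \<open>C\<^sub>K * I = \<infinity>\<close> as \<open>C\<^sub>K > 0\<close>.\<close>
  define C\<^sub>K where "C\<^sub>K = B / enn2real I + 2 * B / c"
  have I: "0 < I" unfolding I_def by (rule C_const_pos) (use \<sigma> in auto)
  have "K \<noteq> {}" using \<mu>(3) by auto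
  then have c: "0 < c" unfolding c_def using \<sigma> K_R by (intro c_const_pos) auto
  have B: "0 < B" unfolding B_def by (rule deviation_const_pos)
  have CK: "0 < C\<^sub>K" unfolding C\<^sub>K_def using B c by (intro add_nonneg_pos) auto
  have CI: "ennreal B \<le> ennreal C\<^sub>K * I"
  proof (cases I)
    case (real r)
    then have r: "0 < r" using I by simp
    have "B = B / r * r" using r by simp
    also have "\<dots> \<le> C\<^sub>K * r"
      unfolding C\<^sub>K_def using real r B c by (intro mult_right_mono) auto
    finally show ?thesis using real CK by (simp add: ennreal_mult[symmetric] ennreal_leI)
  next
    case top
    then show ?thesis using CK by (simp add: ennreal_mult_top)
  qed
  have CKc: "2 * B\<^sup>2 \<le> C\<^sub>K\<^sup>2 * c\<^sup>2"
  proof -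
    have "2 * B = 2 * B / c * c" using c by simp
    also have "\<dots> \<le> C\<^sub>K * c"
      unfolding C\<^sub>K_def using B c by (intro mult_right_mono) auto
    finally have "(2 * B)\<^sup>2 \<le> (C\<^sub>K * c)\<^sup>2" using B by (intro power_mono) auto
    then have "4 * B\<^sup>2 \<le> C\<^sub>K\<^sup>2 * c\<^sup>2" by (simp add: power_mult_distrib)
    then show ?thesis using zero_le_power2[of B] by linarith
  qed
  show ?case
  proof (rule exI[of _ C\<^sub>K], rule exI[of _ 1], rule exI[of _ 1], rule exI[of _ 1],
      intro conjI allI impI CK zero_less_one; elim conjE; fold I_def c_def)
    fix x :: real and N :: nat assume x: "0 < x" and N: "1 \<le> N"
    let ?AW = "\<lambda>\<omega>. smoothed_AW T \<sigma> \<mu> (empirical_measure T N (\<lambda>n. X n \<omega>))"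
    let ?r = "ennreal C\<^sub>K * I * ennreal (real N powr (- 1 / 2))"
    have X_law: "\<And>n. 1 \<le> n \<Longrightarrow> distr P (path_space T) (X n) = \<mu>" using assms(7) by simp
    note est = empirical_smoothed_AW[OF assms(5,6) X_law N, folded B_def]
    have "real N powr (- 1 / 2) = 1 / sqrt N"
      using powr_minus_divide[of "real N" "1 / 2"] powr_half_sqrt[of "real N"] by simp
    then have "B / sqrt N = B * real N powr (- 1 / 2)" by simp
    then have "ennreal (B / sqrt N) = ennreal B * ennreal (real N powr (- 1 / 2))"
      using B by (simp add: ennreal_mult)
    also have "\<dots> \<le> ?r"
      by (intro mult_right_mono CI) simp
    finally have rate: "ennreal (B / sqrt N) \<le> ?r" .
    show "outer_expectation P ?AW \<le> ?r"
      using est(1) rate by (rule order_trans)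
    have "ennreal (x + B / sqrt N) \<le> ennreal x + ?r"
      using x B rate by (simp add: add_left_mono)
    from order_trans[OF this]
    have "outer_measure_of P {\<omega> \<in> space P. ?AW \<omega> \<ge> ennreal x + ?r}
        \<le> outer_measure_of P {\<omega> \<in> space P. ennreal (x + B / sqrt N) \<le> ?AW \<omega>}"
      by (intro outer_measure_of_mono) blast
    also have "\<dots> \<le> ennreal (exp (- (real N * x\<^sup>2 / (2 * B\<^sup>2))))"
      by (rule est(2)[OF _ x])
    also have "\<dots> \<le> ennreal (exp (- (real N * x\<^sup>2 / (C\<^sub>K\<^sup>2 * c\<^sup>2))))"
    proof -
      have "real N * x\<^sup>2 / (C\<^sub>K\<^sup>2 * c\<^sup>2) \<le> real N * x\<^sup>2 / (2 * B\<^sup>2)"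
        using CKc B CK c by (intro divide_left_mono) auto
      then show ?thesis by (intro ennreal_leI) simp
    qed
    finally show "outer_measure_of P {\<omega> \<in> space P. ?AW \<omega> \<ge> ennreal x + ?r}
        \<le> ennreal (exp (- (real N * x\<^sup>2 / (C\<^sub>K\<^sup>2 * c\<^sup>2))))" .
  qed
qed

end
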